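(* Let $\boldsymbol p\in\mathbb N_0^2$. For representations $\boldsymbol a_1,\boldsymbol a_2,\boldsymbol a$ there exist real coefficients $M[\boldsymbol p]^{(\boldsymbol a_1;\sigma_1)(\boldsymbol a_2;\sigma_2)}_{(\boldsymbol a;\sigma,\sigma')}$ (not depending on the labels $\boldsymbol\nu_1,J_1,\boldsymbol\nu_2,J_2,\boldsymbol\nu,J$) such that the operator product of elements of a coupled basis of $\boldsymbol p\otimes\check{\boldsymbol p}$ decomposes as $$\boldsymbol e((\boldsymbol a_1;\sigma_1);\boldsymbol\nu_1,J_1)\,\boldsymbol e((\boldsymbol a_2;\sigma_2);\boldsymbol\nu_2,J_2)=\sum_{\substack{(\boldsymbol a;\sigma,\sigma')\\ \boldsymbol\nu,J}}C^{\boldsymbol a_1,\boldsymbol a_2,(\boldsymbol a;\sigma')}_{\boldsymbol\nu_1J_1,\boldsymbol\nu_2J_2,\boldsymbol\nu J}\;M[\boldsymbol p]^{(\boldsymbol a_1;\sigma_1)(\boldsymbol a_2;\sigma_2)}_{(\boldsymbol a;\sigma,\sigma')}\;\boldsymbol e((\boldsymbol a;\sigma);\boldsymbol\nu,J),$$ where the sum is over terms with $t_{\boldsymbol\nu}=t_{\boldsymbol\nu_1}+t_{\boldsymbol\nu_2}$, $u_{\boldsymbol\nu}=u_{\boldsymbol\nu_1}+u_{\boldsymbol\nu_2}$ and $\delta(J_1,J_2,J)=1$, and $\sigma$ and $\sigma'$ count the multiplicity of $\boldsymbol a$ in $\boldsymbol p\otimes\check{\boldsymbol p}$ and in $\boldsymbol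 a_1\otimes\boldsymbol a_2$, respectively.
   Context: Representations. In a representation of $SU(3)$ (extended to $\mathfrak{sl}(3,\mathbb C)$) let $T_+,T_-,T_3,U_+,U_-,U_3$ be the images of $E_{12},E_{21},\tfrac12(E_{11}-E_{22}),E_{23},E_{32},\tfrac12(E_{22}-E_{33})$. For $\boldsymbol p=(p,q)\in\mathbb N_0^2$, "the irrep $\boldsymbol p$" is the unitary irrep on $\mathcal H_{\boldsymbol p}$ whose highest weight vector has eigenvalue $p/2$ for $T_3$ and $q/2$ for $U_3$; $|\boldsymbol p|=p+q$, $\check{\boldsymbol p}=(q,p)$ (the dual irrep). Inner products are linear in the second entry. Gelfand-Tsetlin (GT) basis: an orthonormal basis $\{\boldsymbol e(\boldsymbol p;\boldsymbol\nu,J)\}$ indexed by $\boldsymbol\nu=(\nu_1,\nu_2,\nu_3)$ and $J$ where, for integers $0\le r_-\le q\le r_+\le p+q$ and $r_-\le\nu_3\le r_+$: $\nu_1=p+2q-(r_++r_-)$, $\nu_2=r_++r_--\nu_3$, $J=\frac12(r_+-r_-)$. Put $t_{\boldsymbol\nu}=\frac{\nu_1-\nu_2}2$, $u_{\boldsymbol\nu}=\frac{\nu_2-\nu_3}2$ (the eigenvalues of $T_3,U_3$). The basis is determined by a unit highest weight vector $\boldsymbol e(\boldsymbol p;(p+q,q,0),q/2)$ via, with $u=u_{\boldsymbol\nu}$, $U_-\boldsymbol e(\boldsymbol p;\boldsymbol\nu,J)=\sqrt{(J+u)(J-u+1)}\,\boldsymbol e(\boldsymbol p;(\nu_1,\nu_2-1,\nu_3+1),J)$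 and $T_-\boldsymbol e(\boldsymbol p;\boldsymbol\nu,J)=\sqrt{\tfrac{(J-u)(p+q+J-u-\nu_3+1)(q+J-u-\nu_3)(u-J+\nu_3+1)}{2J(2J+1)}}\,\boldsymbol e(\boldsymbol p;(\nu_1-1,\nu_2+1,\nu_3),J-\tfrac12)+\sqrt{\tfrac{(J+u+1)(p+q-J-u-\nu_3)(J+u+1+\nu_3-q)(J+u+2+\nu_3)}{2(J+1)(2J+1)}}\,\boldsymbol e(\boldsymbol p;(\nu_1-1,\nu_2+1,\nu_3),J+\tfrac12)$ (terms with zero numerator are $0$). For a GT label $\boldsymbol\nu$ of $\boldsymbol p$ put $\check{\boldsymbol\nu}=(|\boldsymbol p|,|\boldsymbol p|,|\boldsymbol p|)-\boldsymbol\nu$. The induced GT basis of $\mathcal H_{\check{\boldsymbol p}}=\mathcal H_{\boldsymbol p}^*$ is $\check{\boldsymbol e}(\check{\boldsymbol p};\check{\boldsymbol\nu},J)=(-1)^{2(t_{\boldsymbol\nu}+u_{\boldsymbol\nu})}\boldsymbol e^*(\boldsymbol p;\boldsymbol\nu,J)$. Coupled bases. For irreps $\boldsymbol p_1,\boldsymbol p_2$, decompose $\boldsymbol p_1\otimes\boldsymbol p_2$ orthogonally into irreps $(\boldsymbol a;\sigma)$ of class $\boldsymbol a$, where $\sigma$ runs from $1$ to the multiplicity of $\boldsymbol a$ (the Clebsch-Gordan series). A coupled basis is the union of GT bases $\boldsymbol e((\boldsymbol a;\sigma);\boldsymbol\nu,J)$ of the $(\boldsymbol a;\sigma)$; the uncoupled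 basis is the tensor product of GT bases (with the induced GT basis on the second factor if $\boldsymbol p_2=\check{\boldsymbol p}_1$). The Clebsch-Gordan coefficients are $C^{\boldsymbol p_1,\boldsymbol p_2,(\boldsymbol a;\sigma)}_{\boldsymbol\nu_1J_1,\boldsymbol\nu_2J_2,\boldsymbol\nu J}=\langle\boldsymbol e((\boldsymbol a;\sigma);\boldsymbol\nu,J)|\boldsymbol e(\boldsymbol p_1;\boldsymbol\nu_1,J_1)\otimes\boldsymbol e(\boldsymbol p_2;\boldsymbol\nu_2,J_2)\rangle$; decompositions and phases are always chosen so that these are all real. The operator product on $\boldsymbol p\otimes\check{\boldsymbol p}$ is that of $\mathcal B(\mathcal H_{\boldsymbol p})\simeq\mathcal H_{\boldsymbol p}\otimes\mathcal H_{\boldsymbol p}^*$. $\delta(x,y,z)=1$ if $x,y,z$ satisfy the triangle inequality and $x+y+z\in\mathbb Z$, and $0$ otherwise. *)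

theory Defs
  imports "HOL-Analysis.Analysis" "HOL-Library.Function_Algebras"
begin

section \<open>Finite-dimensional Hilbert spaces in coordinates\<close>

text \<open>
  A finite-dimensional Hilbert space is presented as the space of complex functions supported on a
  finite set \<open>I\<close>, whose indicator functions form an orthonormal basis; operators are \<open>I \<times> I\<close>
  matrices, and their entries outside \<open>I \<times> I\<close> are irrelevant.  Dimensions thus are ordinary data
  that may vary inside a statement.
\<close>

type_synonym 'i cvec = "'i \<Rightarrow> complex"
type_synonym 'i cmat = "'i \<Rightarrow> 'i \<Rightarrow> complex"

definition hilb :: "'i set \<Rightarrow> 'i cvec set" where
  "hilb I = {v. \<forall>i. i \<notin> I \<longrightarrow> v i = 0}"

definition cinner :: "'i set \<Rightarrow> 'i cvec \<Rightarrow> 'i cvec \<Rightarrow> complex" where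
  "cinner I v w = (\<Sum>i\<in>I. cnj (v i) * w i)"

definition csc :: "complex \<Rightarrow> 'i cvec \<Rightarrow> 'i cvec" where
  "csc c v = (\<lambda>i. c * v i)"

lemma vector_space_csc: "vector_space (csc :: complex \<Rightarrow> 'i cvec \<Rightarrow> 'i cvec)"
  by unfold_locales (auto simp: csc_def fun_eq_iff algebra_simps)

abbreviation csubspace :: "'i cvec set \<Rightarrow> bool" where
  "csubspace \<equiv> module.subspace csc"

abbreviation cspan :: "'i cvec set \<Rightarrow> 'i cvec set" where
  "cspan \<equiv> module.span csc"

definition app :: "'i set \<Rightarrow> 'i cmat \<Rightarrow> 'i cvec \<Rightarrow> 'i cvec" where
  "app I A v = (\<lambda>i. if i \<in> I then \<Sum>j\<in>I. A i j * v j else 0)"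

definition orthonormal_basis_of :: "'i set \<Rightarrow> 'i cvec set \<Rightarrow> 'l set \<Rightarrow> ('l \<Rightarrow> 'i cvec) \<Rightarrow> bool" where
  "orthonormal_basis_of I W L b \<longleftrightarrow>
     (\<forall>l\<in>L. \<forall>l'\<in>L. cinner I (b l) (b l') = (if l = l' then 1 else 0)) \<and> cspan (b ` L) = W"


section \<open>Unitary representations of SU(3) and their extension to sl(3,C)\<close>

definition hconj :: "complex^3^3 \<Rightarrow> complex^3^3" where
  "hconj X = (\<chi> i j. cnj (X $ j $ i))"

definition SU3 :: "(complex^3^3) set" where
  "SU3 = {g. g ** hconj g = mat 1 \<and> det g = 1}"

text \<open>The ring structure of \<open>complex^3^3\<close> is componentwise, so the generic \<open>exp\<close> is not available here.\<close>

definition mexp :: "complex^3^3 \<Rightarrow> complex^3^3" where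
  "mexp X = (\<Sum>k. (1 / fact k) *\<^sub>R (((\<lambda>Y. X ** Y) ^^ k) (mat 1)))"

type_synonym 'i rep = "complex^3^3 \<Rightarrow> 'i cmat"

definition unitary_rep :: "'i set \<Rightarrow> 'i rep \<Rightarrow> bool" where
  "unitary_rep I \<pi> \<longleftrightarrow>
     finite I \<and>
     (\<forall>i\<in>I. \<forall>k\<in>I. \<pi> (mat 1) i k = (if i = k then 1 else 0)) \<and>
     (\<forall>g\<in>SU3. \<forall>h\<in>SU3. \<forall>i\<in>I. \<forall>k\<in>I. \<pi> (g ** h) i k = (\<Sum>j\<in>I. \<pi> g i j * \<pi> h j k)) \<and>
     (\<forall>g\<in>SU3. \<forall>i\<in>I. \<forall>k\<in>I. (\<Sum>j\<in>I. \<pi> g i j * cnj (\<pi> g k j)) = (if i = k then 1 else 0)) \<and>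
     (\<forall>i\<in>I. \<forall>k\<in>I. continuous_on SU3 (\<lambda>g. \<pi> g i k))"

definition drep :: "'i rep \<Rightarrow> complex^3^3 \<Rightarrow> 'i cmat" where
  "drep \<pi> X = (\<lambda>i j. vector_derivative (\<lambda>t. \<pi> (mexp (t *\<^sub>R X)) i j) (at 0))"

text \<open>
  Complex-linear extension to sl(3,C) of the differential on su(3), by means of the decomposition
  \<open>X = A + \<i> B\<close> with the antihermitian \<open>A = (X - X\<^sup>*) / 2\<close> and \<open>B = (X + X\<^sup>*) / (2 \<i>)\<close>.
\<close>

definition sl_rep :: "'i rep \<Rightarrow> complex^3^3 \<Rightarrow> 'i cmat" where
  "sl_rep \<pi> X = (\<lambda>i j.
     drep \<pi> (\<chi> k l. (X $ k $ l - hconj X $ k $ l) / 2) i j +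
     \<i> * drep \<pi> (\<chi> k l. (X $ k $ l + hconj X $ k $ l) / (2 * \<i>)) i j)"

definition munit :: "3 \<Rightarrow> 3 \<Rightarrow> complex^3^3" where
  "munit m n = axis m (axis n 1)"

definition Tp :: "'i rep \<Rightarrow> 'i cmat" where "Tp \<pi> = sl_rep \<pi> (munit 1 2)"
definition Tm :: "'i rep \<Rightarrow> 'i cmat" where "Tm \<pi> = sl_rep \<pi> (munit 2 1)"
definition T3 :: "'i rep \<Rightarrow> 'i cmat" where
  "T3 \<pi> = sl_rep \<pi> ((1/2) *\<^sub>R (munit 1 1 - munit 2 2))"
definition Up :: "'i rep \<Rightarrow> 'i cmat" where "Up \<pi> = sl_rep \<pi> (munit 2 3)"
definition Um :: "'i rep \<Rightarrow> 'i cmat" where "Um \<pi> = sl_rep \<pi> (munit 3 2)"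
definition U3 :: "'i rep \<Rightarrow> 'i cmat" where
  "U3 \<pi> = sl_rep \<pi> ((1/2) *\<^sub>R (munit 2 2 - munit 3 3))"

type_synonym irrep_class = "nat \<times> nat"

definition highest_weight_vector :: "irrep_class \<Rightarrow> 'i set \<Rightarrow> 'i rep \<Rightarrow> 'i cvec \<Rightarrow> bool" where
  "highest_weight_vector p I \<pi> v \<longleftrightarrow>
     v \<noteq> 0 \<and> app I (Tp \<pi>) v = 0 \<and> app I (Up \<pi>) v = 0 \<and>
     app I (T3 \<pi>) v = csc (of_nat (fst p) / 2) v \<and>
     app I (U3 \<pi>) v = csc (of_nat (snd p) / 2) v"

definition invariant :: "'i set \<Rightarrow> 'i rep \<Rightarrow> 'i cvec set \<Rightarrow> bool" where
  "invariant I \<pi> W \<longleftrightarrow> (\<forall>g\<in>SU3. \<forall>v\<in>W. app I (\<pi> g) v \<in> W)"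

text \<open>\<open>W\<close> is an irreducible subrepresentation, of class \<open>p\<close>, of the unitary representation \<open>\<pi>\<close>.\<close>

definition irrep_on :: "irrep_class \<Rightarrow> 'i set \<Rightarrow> 'i rep \<Rightarrow> 'i cvec set \<Rightarrow> bool" where
  "irrep_on p I \<pi> W \<longleftrightarrow>
     unitary_rep I \<pi> \<and> csubspace W \<and> W \<subseteq> hilb I \<and> W \<noteq> {0} \<and> invariant I \<pi> W \<and>
     (\<forall>W'. csubspace W' \<and> W' \<subseteq> W \<and> invariant I \<pi> W' \<longrightarrow> W' = {0} \<or> W' = W) \<and>
     (\<exists>v\<in>W. highest_weight_vector p I \<pi> v)"

definition dual_class :: "irrep_class \<Rightarrow> irrep_class" where
  "dual_class p = (snd p, fst p)"

text \<open>
  A functional \<open>f\<close> on \<open>hilb I\<close> has as coordinates its values on the indicator functions, so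
  that \<open>(g f) v = f (g\<inverse> v)\<close> becomes the transpose below, and the coordinates of the functional
  \<open>cinner I v\<close> are those of \<open>v\<close>, conjugated.
\<close>

definition dual_rep :: "'i rep \<Rightarrow> 'i rep" where
  "dual_rep \<pi> = (\<lambda>g i j. \<pi> (matrix_inv g) j i)"

definition dual_vec :: "'i cvec \<Rightarrow> 'i cvec" where
  "dual_vec v = (\<lambda>i. cnj (v i))"

definition tensor_rep :: "'i rep \<Rightarrow> 'j rep \<Rightarrow> ('i \<times> 'j) rep" where
  "tensor_rep \<pi> \<rho> = (\<lambda>g x y. \<pi> g (fst x) (fst y) * \<rho> g (snd x) (snd y))"

definition tensor_vec :: "'i cvec \<Rightarrow> 'j cvec \<Rightarrow> ('i \<times> 'j) cvec" where
  "tensor_vec v w = (\<lambda>x. v (fst x) * w (snd x))"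

text \<open>
  Under \<open>v \<otimes> f \<mapsto> (w \<mapsto> f w v)\<close>, which identifies the tensor product of a Hilbert space with its
  dual and the operators on it, an element of \<open>hilb (I \<times> I)\<close> is the matrix of the corresponding
  operator.
\<close>

definition op_product :: "'i set \<Rightarrow> ('i \<times> 'i) cvec \<Rightarrow> ('i \<times> 'i) cvec \<Rightarrow> ('i \<times> 'i) cvec" where
  "op_product I A B = (\<lambda>x. \<Sum>j\<in>I. A (fst x, j) * B (j, snd x))"


section \<open>Gelfand-Tsetlin bases\<close>

type_synonym gt_weight = "int \<times> int \<times> int"
type_synonym 'i gt_family = "gt_weight \<Rightarrow> real \<Rightarrow> 'i cvec"

definition gt_labels :: "irrep_class \<Rightarrow> (gt_weight \<times> real) set" where
  "gt_labels = (\<lambda>(p, q).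
     {((int p + 2 * int q - (rp + rm), rp + rm - n\<^sub>3, n\<^sub>3), of_int (rp - rm) / 2) | rm rp n\<^sub>3.
        0 \<le> rm \<and> rm \<le> int q \<and> int q \<le> rp \<and> rp \<le> int p + int q \<and> rm \<le> n\<^sub>3 \<and> n\<^sub>3 \<le> rp})"

definition t_of :: "gt_weight \<Rightarrow> real" where
  "t_of = (\<lambda>(n\<^sub>1, n\<^sub>2, n\<^sub>3). of_int (n\<^sub>1 - n\<^sub>2) / 2)"

definition u_of :: "gt_weight \<Rightarrow> real" where
  "u_of = (\<lambda>(n\<^sub>1, n\<^sub>2, n\<^sub>3). of_int (n\<^sub>2 - n\<^sub>3) / 2)"

text \<open>
  A value of \<open>e\<close> at an index that is not a label only occurs below with coefficient zero; this
  includes the case \<open>J = 0\<close> of the first coefficient for \<open>T_-\<close>, where \<open>0 / 0 = 0\<close>.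
\<close>

definition gt_basis :: "irrep_class \<Rightarrow> 'i set \<Rightarrow> 'i rep \<Rightarrow> 'i cvec set \<Rightarrow> 'i gt_family \<Rightarrow> bool" where
  "gt_basis = (\<lambda>(p, q) I \<pi> W e.
     orthonormal_basis_of I W (gt_labels (p, q)) (\<lambda>(\<nu>, J). e \<nu> J) \<and>
     highest_weight_vector (p, q) I \<pi> (e (int (p + q), int q, 0) (q / 2)) \<and>
     (\<forall>n\<^sub>1 n\<^sub>2 n\<^sub>3 J. ((n\<^sub>1, n\<^sub>2, n\<^sub>3), J) \<in> gt_labels (p, q) \<longrightarrow>
       (let u = u_of (n\<^sub>1, n\<^sub>2, n\<^sub>3); n = real_of_int n\<^sub>3 in
         app I (Um \<pi>) (e (n\<^sub>1, n\<^sub>2, n\<^sub>3) J) =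
           csc (of_real (sqrt ((J + u) * (J - u + 1)))) (e (n\<^sub>1, n\<^sub>2 - 1, n\<^sub>3 + 1) J) \<and>
         app I (Tm \<pi>) (e (n\<^sub>1, n\<^sub>2, n\<^sub>3) J) =
           csc (of_real (sqrt ((J - u) * (p + q + J - u - n + 1) * (q + J - u - n) * (u - J + n + 1)
                               / (2 * J * (2 * J + 1)))))
               (e (n\<^sub>1 - 1, n\<^sub>2 + 1, n\<^sub>3) (J - 1/2)) +
           csc (of_real (sqrt ((J + u + 1) * (p + q - J - u - n) * (J + u + 1 + n - q) * (J + u + 2 + n)
                               / (2 * (J + 1) * (2 * J + 1)))))
               (e (n\<^sub>1 - 1, n\<^sub>2 + 1, n\<^sub>3) (J + 1/2)))))"

text \<open>
  The argument of \<open>induced_gt p e\<close> is a label of the dual class; the label of \<open>p\<close> it comes from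
  is recovered by the same reflection.  Note that \<open>2 (t\<^sub>\<nu> + u\<^sub>\<nu>) = n\<^sub>1 - n\<^sub>3\<close>.
\<close>

definition reflect_weight :: "irrep_class \<Rightarrow> gt_weight \<Rightarrow> gt_weight" where
  "reflect_weight p = (\<lambda>(n\<^sub>1, n\<^sub>2, n\<^sub>3).
     (let s = int (fst p + snd p) in (s - n\<^sub>1, s - n\<^sub>2, s - n\<^sub>3)))"

definition induced_gt :: "irrep_class \<Rightarrow> 'i gt_family \<Rightarrow> 'i gt_family" where
  "induced_gt p e = (\<lambda>\<nu>' J. let \<nu> = reflect_weight p \<nu>' in
     csc ((-1) powi (fst \<nu> - snd (snd \<nu>))) (dual_vec (e \<nu> J)))"


section \<open>Coupled bases and Clebsch-Gordan coefficients\<close>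

text \<open>
  Given an index set, a representation and a GT basis for every class, the following three select
  the second factor of \<open>a\<^sub>1 \<otimes> a\<^sub>2\<close>: the dual of the first one, with the induced GT basis, when
  \<open>a\<^sub>2\<close> is the class dual to \<open>a\<^sub>1\<close>, and the given irrep of class \<open>a\<^sub>2\<close> otherwise.
\<close>

definition snd_index :: "(irrep_class \<Rightarrow> 'i set) \<Rightarrow> irrep_class \<Rightarrow> irrep_class \<Rightarrow> 'i set" where
  "snd_index I a\<^sub>1 a\<^sub>2 = (if a\<^sub>2 = dual_class a\<^sub>1 then I a\<^sub>1 else I a\<^sub>2)"

definition snd_rep :: "(irrep_class \<Rightarrow> 'i rep) \<Rightarrow> irrep_class \<Rightarrow> irrep_class \<Rightarrow> 'i rep" where
  "snd_rep \<pi> a\<^sub>1 a\<^sub>2 = (if a\<^sub>2 = dual_class a\<^sub>1 then dual_rep (\<pi> a\<^sub>1) else \<pi> a\<^sub>2)"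

definition snd_gt :: "(irrep_class \<Rightarrow> 'i gt_family) \<Rightarrow> irrep_class \<Rightarrow> irrep_class \<Rightarrow> 'i gt_family" where
  "snd_gt e a\<^sub>1 a\<^sub>2 = (if a\<^sub>2 = dual_class a\<^sub>1 then induced_gt a\<^sub>1 (e a\<^sub>1) else e a\<^sub>2)"

text \<open>
  \<open>m a\<close> is the multiplicity of \<open>a\<close> in \<open>\<pi>\<close>: the number of summands of class \<open>a\<close> in an orthogonal
  decomposition into irreps.  The summand \<open>(a;\<sigma>)\<close> is the span of its GT basis \<open>E a \<sigma>\<close>.
\<close>

definition coupled_basis ::
    "'i set \<Rightarrow> 'i rep \<Rightarrow> (irrep_class \<Rightarrow> nat) \<Rightarrow> (irrep_class \<Rightarrow> nat \<Rightarrow> 'i gt_family) \<Rightarrow> bool" where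
  "coupled_basis I \<pi> m E \<longleftrightarrow>
     orthonormal_basis_of I (hilb I)
       {(a, \<sigma>, \<nu>, J). \<sigma> \<in> {1..m a} \<and> (\<nu>, J) \<in> gt_labels a} (\<lambda>(a, \<sigma>, \<nu>, J). E a \<sigma> \<nu> J) \<and>
     (\<forall>a. \<forall>\<sigma>\<in>{1..m a}.
        let W = cspan ((\<lambda>(\<nu>, J). E a \<sigma> \<nu> J) ` gt_labels a) in
          irrep_on a I \<pi> W \<and> gt_basis a I \<pi> W (E a \<sigma>))"

text \<open>\<open>E a\<^sub>1 a\<^sub>2\<close> is the coupled basis of \<open>a\<^sub>1 \<otimes> a\<^sub>2\<close>.\<close>

definition clebsch_gordan ::
    "(irrep_class \<Rightarrow> 'i set) \<Rightarrow> (irrep_class \<Rightarrow> 'i gt_family) \<Rightarrow>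
     (irrep_class \<Rightarrow> irrep_class \<Rightarrow> irrep_class \<Rightarrow> nat \<Rightarrow> ('i \<times> 'i) gt_family) \<Rightarrow>
     irrep_class \<Rightarrow> irrep_class \<Rightarrow> irrep_class \<Rightarrow> nat \<Rightarrow>
     gt_weight \<Rightarrow> real \<Rightarrow> gt_weight \<Rightarrow> real \<Rightarrow> gt_weight \<Rightarrow> real \<Rightarrow> complex" where
  "clebsch_gordan I e E a\<^sub>1 a\<^sub>2 a \<sigma> \<nu>\<^sub>1 J\<^sub>1 \<nu>\<^sub>2 J\<^sub>2 \<nu> J =
     cinner (I a\<^sub>1 \<times> snd_index I a\<^sub>1 a\<^sub>2) (E a\<^sub>1 a\<^sub>2 a \<sigma> \<nu> J)
       (tensor_vec (e a\<^sub>1 \<nu>\<^sub>1 J\<^sub>1) (snd_gt e a\<^sub>1 a\<^sub>2 \<nu>\<^sub>2 J\<^sub>2))"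

definition tri_delta :: "real \<Rightarrow> real \<Rightarrow> real \<Rightarrow> nat" where
  "tri_delta x y z =
     (if x \<le> y + z \<and> y \<le> x + z \<and> z \<le> x + y \<and> x + y + z \<in> \<int> then 1 else 0)"

end

theory Submission
  imports Defs
begin

text \<open>
  The product of operators, read as a linear map from \<open>a\<^sub>1 \<otimes> a\<^sub>2\<close> to \<open>p \<otimes> p\<^sup>*\<close>, commutes with
  \<open>sl(3)\<close>, because \<open>sl(3)\<close> acts on operators by commutators, that is, by derivations.  By Schur's
  lemma it carries the Gelfand-Tsetlin basis of \<open>(a;\<sigma>')\<close> to a combination of those of the
  \<open>(a;\<sigma>)\<close> whose coefficients do not depend on the label; expanding a product of basis vectors in
  the coupled basis of \<open>a\<^sub>1 \<otimes> a\<^sub>2\<close> gives the formula.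

  Only \<open>T\<^sub>-\<close>, \<open>U\<^sub>-\<close> and their adjoints are needed.  In place of irreducibility, Schur's lemma uses
  that a vector orthogonal to the images of \<open>T\<^sub>-\<close> and \<open>U\<^sub>-\<close> is a multiple of the highest weight
  vector, which is visible from the Gelfand-Tsetlin coefficients; in place of \<open>T\<^sub>3\<close> and \<open>U\<^sub>3\<close>,
  weights are eigenvalues of the commutators of \<open>T\<^sub>-\<close> and \<open>U\<^sub>-\<close> with their adjoints.
\<close>

section \<open>Differentiability of one-parameter groups\<close>

lemma neumann_right_inverse:
  fixes N :: "'i \<Rightarrow> 'i \<Rightarrow> complex"
  assumes fin: "finite I" and small: "\<And>i. i \<in> I \<Longrightarrow> (\<Sum>j\<in>I. norm (N i j)) \<le> 1/2"
  obtains B where "\<And>i j. i \<in> I \<Longrightarrow> j \<in> I \<Longrightarrow>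
    (\<Sum>k\<in>I. ((if i = k then 1 else 0) - N i k) * B k j) = (if i = j then 1 else 0)"
proof -
  define pw where "pw = rec_nat (\<lambda>i j. if i = j then 1 else 0) (\<lambda>_ M i j. \<Sum>k\<in>I. N i k * M k j)"
  have pw0: "pw 0 i j = (if i = j then 1 else 0)" for i j by (simp add: pw_def)
  have pwS: "pw (Suc n) i j = (\<Sum>k\<in>I. N i k * pw n k j)" for n i j by (simp add: pw_def)
  have bound: "norm (pw n i j) \<le> (1/2) ^ n" if "i \<in> I" for n i j
    using that
  proof (induction n arbitrary: i)
    case 0
    then show ?case by (simp add: pw0)
  next
    case (Suc n)
    have "norm (pw (Suc n) i j) \<le> (\<Sum>k\<in>I. norm (N i k) * (1/2) ^ n)"
      unfolding pwS by (rule sum_norm_le) (auto simp: norm_mult intro!: mult_left_mono Suc.IH)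
    also have "\<dots> \<le> 1/2 * (1/2) ^ n"
      unfolding sum_distrib_right[symmetric] by (intro mult_right_mono small Suc.prems) auto
    finally show ?case by simp
  qed
  have summ: "summable (\<lambda>n. pw n i j)" if "i \<in> I" for i j
    by (rule summable_comparison_test[where g = "\<lambda>n. (1/2::real) ^ n"])
       (use bound that in \<open>auto intro!: summable_geometric\<close>)
  show thesis
  proof (rule that[of "\<lambda>i j. \<Sum>n. pw n i j"])
    fix i j assume ij: "i \<in> I" "j \<in> I"
    let ?c = "\<lambda>k. (if i = k then 1 else 0) - N i k"
    have "(\<Sum>k\<in>I. ?c k * (\<Sum>n. pw n k j)) = (\<Sum>k\<in>I. \<Sum>n. ?c k * pw n k j)"
      by (intro sum.cong refl suminf_mult[symmetric] summ) auto
    also have "\<dots> = (\<Sum>n. \<Sum>k\<in>I. ?c k * pw n k j)"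
      by (intro suminf_sum[symmetric] summable_mult summ) auto
    also have "(\<lambda>n. \<Sum>k\<in>I. ?c k * pw n k j) = (\<lambda>n. pw n i j - pw (Suc n) i j)"
    proof
      fix n
      have "(\<Sum>k\<in>I. ?c k * pw n k j) = (\<Sum>k\<in>I. (if k = i then pw n k j else 0) - N i k * pw n k j)"
        by (intro sum.cong refl) (simp add: algebra_simps)
      then show "(\<Sum>k\<in>I. ?c k * pw n k j) = pw n i j - pw (Suc n) i j"
        using ij fin by (simp add: sum_subtractf pwS)
    qed
    also have "(\<Sum>n. pw n i j - pw (Suc n) i j) = pw 0 i j - 0"
      by (intro sums_unique[symmetric] telescope_sums' summable_LIMSEQ_zero summ ij)
    finally show "(\<Sum>k\<in>I. ?c k * (\<Sum>n. pw n k j)) = (if i = j then 1 else 0)"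
      by (simp add: pw0)
  qed
qed

text \<open>
  If \<open>G\<close> is an antiderivative of \<open>f\<close>, then \<open>f t (G h - G 0) = G (t + h) - G t\<close>, and \<open>G h - G 0\<close>,
  which is close to \<open>h\<close> times the identity, can be inverted.
\<close>

lemma one_parameter_group_differentiable:
  fixes f :: "real \<Rightarrow> 'i \<Rightarrow> 'i \<Rightarrow> complex"
  assumes fin: "finite I"
    and one: "\<And>i j. i \<in> I \<Longrightarrow> j \<in> I \<Longrightarrow> f 0 i j = (if i = j then 1 else 0)"
    and mult: "\<And>s t i j. i \<in> I \<Longrightarrow> j \<in> I \<Longrightarrow> f (s + t) i j = (\<Sum>k\<in>I. f s i k * f t k j)"
    and cont: "\<And>i j. i \<in> I \<Longrightarrow> j \<in> I \<Longrightarrow> continuous_on UNIV (\<lambda>t. f t i j)"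
    and ij: "i \<in> I" "j \<in> I"
  shows "\<exists>D. ((\<lambda>t. f t i j) has_vector_derivative D) (at 0)"
proof -
  have "\<exists>g. \<forall>x\<in>{-2<..<2}. (g has_vector_derivative f x i j) (at x)" if "i \<in> I" "j \<in> I" for i j
  proof -
    have "continuous_on {-2..2} (\<lambda>t. f t i j)"
      using cont[OF that] by (rule continuous_on_subset) simp
    then obtain g where g: "\<And>x. x \<in> {-2..2} \<Longrightarrow> (g has_vector_derivative f x i j) (at x within {-2..2})"
      by (rule antiderivative_continuous) blast
    have "(g has_vector_derivative f x i j) (at x)" if "x \<in> {-2<..<2}" for x
      using g[of x] that at_within_Icc_at[of "-2" x 2] by auto
    then show ?thesis by blast
  qed
  then obtain G where G: "\<And>i j x. i \<in> I \<Longrightarrow> j \<in> I \<Longrightarrow> x \<in> {-2<..<2} \<Longrightarrow> (G i j has_vector_derivative f x i j) (at x)"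
    by metis
  have shift: "(\<Sum>k\<in>I. f t i k * (G k j h - G k j 0)) = G i j (t + h) - G i j t"
    if ij: "i \<in> I" "j \<in> I" and t: "t \<in> {-1<..<1}" and h: "h \<in> {0..<1}" for t h i j
  proof -
    let ?F = "\<lambda>s. (\<Sum>k\<in>I. f t i k * G k j s) - G i j (t + s)"
    have "(?F has_vector_derivative 0) (at s within {0..h})" if s: "s \<in> {0..h}" for s
    proof -
      have 1: "((\<lambda>s. \<Sum>k\<in>I. f t i k * G k j s) has_vector_derivative (\<Sum>k\<in>I. f t i k * f s k j)) (at s)"
        using s h ij by (intro has_vector_derivative_sum has_vector_derivative_mult_right G) auto
      have 2: "((G i j \<circ> (+) t) has_vector_derivative 1 *\<^sub>R f (t + s) i j) (at s)"
        using s h t ij by (intro vector_diff_chain_at G) (auto intro!: derivative_eq_intros)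
      have "(?F has_vector_derivative (\<Sum>k\<in>I. f t i k * f s k j) - 1 *\<^sub>R f (t + s) i j) (at s)"
        using has_vector_derivative_diff[OF 1 2] by (simp add: o_def)
      then show ?thesis
        using mult[OF ij] by (auto intro: has_vector_derivative_at_within)
    qed
    then obtain c where "\<And>s. s \<in> {0..h} \<Longrightarrow> ?F s = c"
      using has_vector_derivative_zero_constant[of "{0..h}" ?F] by auto
    then have "?F h = ?F 0" using h by (metis atLeastAtMost_iff atLeastLessThan_iff order_refl)
    then show ?thesis by (simp add: right_diff_distrib sum_subtractf algebra_simps)
  qed
  have lim: "((\<lambda>h. (G i j h - G i j 0) / of_real h) \<longlongrightarrow> f 0 i j) (at_right 0)"
    if "i \<in> I" "j \<in> I" for i j
  proof -
    have "((\<lambda>h. norm (G i j h - G i j 0 - h *\<^sub>R f 0 i j) / norm h) \<longlongrightarrow> 0) (at_right 0)"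
    proof (rule tendsto_mono)
      show "at_right (0::real) \<le> at 0" by (simp add: at_le)
      show "((\<lambda>h. norm (G i j h - G i j 0 - h *\<^sub>R f 0 i j) / norm h) \<longlongrightarrow> 0) (at 0)"
        using G[OF that, of 0] by (simp add: has_vector_derivative_def has_derivative_at)
    qed
    also have "?this \<longleftrightarrow> ((\<lambda>h. norm ((G i j h - G i j 0) / of_real h - f 0 i j)) \<longlongrightarrow> 0) (at_right 0)"
    proof (rule tendsto_cong, unfold eventually_at_right_field, intro exI[of _ 1] conjI allI impI)
      fix h :: real assume "0 < h"
      then have "(G i j h - G i j 0) / of_real h - f 0 i j = (G i j h - G i j 0 - h *\<^sub>R f 0 i j) / of_real h"
        by (simp add: diff_divide_distrib scaleR_conv_of_real)
      then show "norm (G i j h - G i j 0 - h *\<^sub>R f 0 i j) / norm h = norm ((G i j h - G i j 0) / of_real h - f 0 i j)"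
        by (simp only: norm_divide norm_of_real real_norm_def)
    qed simp
    finally show ?thesis
      by (simp add: tendsto_norm_zero_iff Lim_null[of _ "f 0 i j"])
  qed
  have small: "\<forall>\<^sub>F h in at_right 0. norm (f 0 i j - (G i j h - G i j 0) / of_real h) < 1 / (2 * real (card I) + 1)"
    if "i \<in> I" "j \<in> I" for i j
    using tendstoD[OF lim[OF that], of "1 / (2 * real (card I) + 1)"]
    by (simp add: dist_norm norm_minus_commute)
  have ev: "\<forall>\<^sub>F h in at_right 0. h \<in> {0<..<1} \<and>
     (\<forall>i\<in>I. \<forall>j\<in>I. norm (f 0 i j - (G i j h - G i j 0) / of_real h) < 1 / (2 * real (card I) + 1))"
    using fin small by (intro eventually_conj eventually_ball_finite eventually_at_right_real ballI) auto
  then obtain h where h: "h \<in> {0<..<1}"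
    and hs: "\<And>i j. i \<in> I \<Longrightarrow> j \<in> I \<Longrightarrow> norm (f 0 i j - (G i j h - G i j 0) / of_real h) < 1 / (2 * real (card I) + 1)"
    using eventually_happens'[OF trivial_limit_at_right_real ev] by blast
  define N where "N i j = f 0 i j - (G i j h - G i j 0) / of_real h" for i j
  have N: "(\<Sum>j\<in>I. norm (N i j)) \<le> 1/2" if "i \<in> I" for i
  proof -
    have "(\<Sum>j\<in>I. norm (N i j)) \<le> real (card I) * (1 / (2 * real (card I) + 1))"
      using that by (intro sum_bounded_above) (auto simp: N_def intro!: less_imp_le hs)
    also have "\<dots> \<le> 1/2" by (simp add: field_simps)
    finally show ?thesis .
  qed
  obtain B where
    B: "\<And>i j. i \<in> I \<Longrightarrow> j \<in> I \<Longrightarrow>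
      (\<Sum>k\<in>I. ((if i = k then 1 else 0) - N i k) * B k j) = (if i = j then 1 else 0)"
    using neumann_right_inverse[of I N, OF fin N] by blast
  have AB: "(\<Sum>l\<in>I. (G k l h - G k l 0) * (B l j / of_real h)) = (if k = j then 1 else 0)"
    if "k \<in> I" for k
    using B[OF that ij(2)] h that by (simp add: N_def one)
  have f_eq: "f t i j = (\<Sum>l\<in>I. (G i l (t + h) - G i l t) * (B l j / of_real h))"
    if "t \<in> {-1<..<1}" for t
  proof -
    have "(\<Sum>l\<in>I. (G i l (t + h) - G i l t) * (B l j / of_real h))
        = (\<Sum>l\<in>I. (\<Sum>k\<in>I. f t i k * (G k l h - G k l 0)) * (B l j / of_real h))"
      using h that ij by (intro sum.cong refl) (simp add: shift)
    also have "\<dots> = (\<Sum>k\<in>I. f t i k * (\<Sum>l\<in>I. (G k l h - G k l 0) * (B l j / of_real h)))"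
      unfolding sum_distrib_left sum_distrib_right mult.assoc by (rule sum.swap)
    also have "\<dots> = (\<Sum>k\<in>I. f t i k * (if k = j then 1 else 0))"
      by (intro sum.cong refl arg_cong2[where f = "(*)"] AB)
    also have "\<dots> = f t i j" using fin ij by (simp add: if_distrib cong: if_cong)
    finally show ?thesis by simp
  qed
  have "((\<lambda>t. \<Sum>l\<in>I. (G i l (t + h) - G i l t) * (B l j / of_real h)) has_vector_derivative
      (\<Sum>l\<in>I. (1 *\<^sub>R f (0 + h) i l - f 0 i l) * (B l j / of_real h))) (at 0)"
  proof (intro has_vector_derivative_sum has_vector_derivative_mult_left has_vector_derivative_diff)
    fix l assume l: "l \<in> I"
    show "(G i l has_vector_derivative f 0 i l) (at 0)" using G[OF ij(1) l] by simp
    have "((G i l \<circ> (\<lambda>t. t + h)) has_vector_derivative 1 *\<^sub>R f (0 + h) i l) (at 0)"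
      using h by (intro vector_diff_chain_at G ij l) (auto intro!: derivative_eq_intros)
    then show "((\<lambda>t. G i l (t + h)) has_vector_derivative 1 *\<^sub>R f (0 + h) i l) (at 0)"
      by (simp add: o_def)
  qed
  then have "((\<lambda>t. f t i j) has_vector_derivative
      (\<Sum>l\<in>I. (1 *\<^sub>R f (0 + h) i l - f 0 i l) * (B l j / of_real h))) (at 0)"
    by (rule has_vector_derivative_transform_within_open[where S = "{-1<..<1}"]) (auto simp: f_eq)
  then show ?thesis by blast
qed

section \<open>The exponentials of the directions that span the lowering operators\<close>

lemma matrix_cubic_power:
  fixes X :: "complex^3^3"
  assumes cubic: "X ** X ** X = (-1/4) *\<^sub>R X"
  shows "((\<lambda>Y. X ** Y) ^^ (2 * j + 1)) (mat 1) = ((-1/4) ^ j) *\<^sub>R X"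
    and "((\<lambda>Y. X ** Y) ^^ (2 * j + 2)) (mat 1) = ((-1/4) ^ j) *\<^sub>R (X ** X)"
proof -
  have scale: "X ** (c *\<^sub>R Y) = c *\<^sub>R (X ** Y)" for c Y
    by (simp add: matrix_matrix_mult_def vec_eq_iff scaleR_right.sum)
  show 1: "((\<lambda>Y. X ** Y) ^^ (2 * j + 1)) (mat 1) = ((-1/4) ^ j) *\<^sub>R X" for j
    by (induction j) (simp_all add: scale cubic[unfolded matrix_mul_assoc[symmetric]])
  show "((\<lambda>Y. X ** Y) ^^ (2 * j + 2)) (mat 1) = ((-1/4) ^ j) *\<^sub>R (X ** X)"
    using 1[of j] by (simp add: scale)
qed

lemma mexp_cubic:
  fixes X :: "complex^3^3"
  assumes cubic: "X ** X ** X = (-1/4) *\<^sub>R X"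
  shows "mexp (t *\<^sub>R X) = mat 1 + (2 * sin (t/2)) *\<^sub>R X + (4 * (1 - cos (t/2))) *\<^sub>R (X ** X)"
proof -
  have pw: "((\<lambda>Y. (t *\<^sub>R X) ** Y) ^^ k) (mat 1) = t ^ k *\<^sub>R ((\<lambda>Y. X ** Y) ^^ k) (mat 1)" for k
    by (induction k) (simp_all add: matrix_matrix_mult_def vec_eq_iff scaleR_right.sum mult.assoc)
  define c where "c k = (1 / fact k) *\<^sub>R (((\<lambda>Y. (t *\<^sub>R X) ** Y) ^^ k) (mat 1))" for k
  have c: "c k = (sin_coeff k *\<^sub>R (t/2) ^ k) *\<^sub>R (2 *\<^sub>R X) + (cos_coeff k *\<^sub>R (t/2) ^ k) *\<^sub>R ((-4) *\<^sub>R (X ** X))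
      + (if k = 0 then mat 1 + 4 *\<^sub>R (X ** X) else 0)" for k
  proof -
    consider "k = 0" | j where "k = 2 * j + 1" | j where "k = 2 * j + 2"
    proof (cases "even k")
      case True
      then obtain j where "k = 2 * j" by blast
      then show thesis using that(1) that(3)[of "j - 1"] by (cases j) auto
    next
      case False
      then show thesis using that(2) by (auto elim!: oddE)
    qed
    then show ?thesis
    proof cases
      case 1
      then show ?thesis by (simp add: c_def)
    next
      case 2
      have "(-1/4::real) ^ j = (-1) ^ j / 2 ^ (2 * j)"
        using power_mult_distrib[of "-1" "1/4::real" j] by (simp add: power_mult power_one_over)
      then show ?thesis
        unfolding c_def pw 2 matrix_cubic_power[OF cubic]
        by (simp add: sin_coeff_def cos_coeff_def power_divide mult_ac)
    next
      case 3
      have "(-1/4::real) ^ j = (-1) ^ j / 2 ^ (2 * j)"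
        using power_mult_distrib[of "-1" "1/4::real" j] by (simp add: power_mult power_one_over)
      then show ?thesis
        unfolding c_def pw 3 matrix_cubic_power[OF cubic]
        by (simp add: sin_coeff_def cos_coeff_def power_divide mult_ac)
    qed
  qed
  have "c sums (sin (t/2) *\<^sub>R (2 *\<^sub>R X) + cos (t/2) *\<^sub>R ((-4) *\<^sub>R (X ** X)) + (mat 1 + 4 *\<^sub>R (X ** X)))"
    unfolding c
    by (intro sums_add bounded_linear.sums[OF bounded_linear_scaleR_left] sin_converges cos_converges)
       (use sums_single[of 0 "\<lambda>_. mat 1 + 4 *\<^sub>R (X ** X)"] in \<open>simp add: eq_commute\<close>)
  then show ?thesis
    unfolding mexp_def c_def[symmetric] by (simp add: sums_iff algebra_simps)
qed

definition rot_gen :: "3 \<Rightarrow> 3 \<Rightarrow> complex \<Rightarrow> complex^3^3" where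
  "rot_gen m n w = (\<chi> i j. if i = m \<and> j = n then w / 2 else if i = n \<and> j = m then - cnj w / 2 else 0)"

definition rot :: "3 \<Rightarrow> 3 \<Rightarrow> complex \<Rightarrow> real \<Rightarrow> complex^3^3" where
  "rot m n w t = (\<chi> i j. if i = m \<and> j = n then w * of_real (sin (t/2))
     else if i = n \<and> j = m then - cnj w * of_real (sin (t/2))
     else if i \<noteq> j then 0 else if i = m \<or> i = n then of_real (cos (t/2)) else 1)"

lemma scaleR_complex: "r *\<^sub>R (z::complex) = of_real r * z"
  by (rule scaleR_conv_of_real)

lemma index3_distinct: "(1::3) \<noteq> 2" "(1::3) \<noteq> 3" "(2::3) \<noteq> 3" "(2::3) \<noteq> 1" "(3::3) \<noteq> 1" "(3::3) \<noteq> 2"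
  by auto

definition lowering_pairs :: "(3 \<times> 3) set" where
  "lowering_pairs = {(2, 1), (3, 2)}"

lemma mexp_rot_gen:
  assumes "(m, n) \<in> lowering_pairs" "w * cnj w = 1"
  shows "mexp (t *\<^sub>R rot_gen m n w) = rot m n w t"
proof -
  have w: "w * (cnj w * z) = z" for z using assms(2) by (simp add: mult.assoc[symmetric])
  define P :: "complex^3^3" where "P = (\<chi> i j. if i = j \<and> (i = m \<or> i = n) then 1 else 0)"
  have sq: "rot_gen m n w ** rot_gen m n w = (-1/4) *\<^sub>R P"
    using assms w unfolding lowering_pairs_def
    by (elim insertE emptyE)
       (simp_all add: P_def rot_gen_def matrix_matrix_mult_def vec_eq_iff forall_3 sum_3 scaleR_complex index3_distinct mult.commute)
  have scale: "(c *\<^sub>R A) ** B = c *\<^sub>R (A ** B)" for c and A B :: "complex^3^3"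
    by (simp add: matrix_matrix_mult_def vec_eq_iff scaleR_right.sum)
  have "P ** rot_gen m n w = rot_gen m n w"
    using assms unfolding lowering_pairs_def
    by (elim insertE emptyE)
       (simp_all add: P_def rot_gen_def matrix_matrix_mult_def vec_eq_iff forall_3 sum_3 index3_distinct)
  then have cubic: "rot_gen m n w ** rot_gen m n w ** rot_gen m n w = (-1/4) *\<^sub>R rot_gen m n w"
    unfolding sq by (simp only: scale)
  show ?thesis unfolding mexp_cubic[OF cubic] sq
    using assms(1) unfolding lowering_pairs_def
    by (elim insertE emptyE)
       (simp_all add: P_def rot_gen_def rot_def mat_def vec_eq_iff forall_3 scaleR_complex index3_distinct diff_divide_distrib)
qed

lemma rot_0: "m \<noteq> n \<Longrightarrow> rot m n w 0 = mat 1"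
  by (auto simp: rot_def mat_def vec_eq_iff)

lemma lowering_pairs_neq: "(m, n) \<in> lowering_pairs \<Longrightarrow> m \<noteq> n"
  by (auto simp: lowering_pairs_def)

lemma rot_add:
  assumes "(m, n) \<in> lowering_pairs" "w * cnj w = 1"
  shows "rot m n w (s + t) = rot m n w s ** rot m n w t"
proof -
  have w: "w * (cnj w * z) = z" for z using assms(2) by (simp add: mult.assoc[symmetric])
  show ?thesis
    using assms w unfolding lowering_pairs_def
    by (auto simp: rot_def matrix_matrix_mult_def vec_eq_iff forall_3 sum_3 add_divide_distrib sin_add cos_add algebra_simps)
qed

lemma rot_SU3:
  assumes "(m, n) \<in> lowering_pairs" "w * cnj w = 1"
  shows "rot m n w t \<in> SU3"
proof -
  have w: "w * (cnj w * z) = z" for z using assms(2) by (simp add: mult.assoc[symmetric])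
  have "hconj (rot m n w t) = rot m n w (- t)"
    using assms unfolding lowering_pairs_def by (auto simp: rot_def hconj_def vec_eq_iff forall_3)
  then have 1: "rot m n w t ** hconj (rot m n w t) = mat 1"
    using rot_add[OF assms, of t "- t"] by (simp add: rot_0 lowering_pairs_neq[OF assms(1)])
  have "det (rot m n w t) = of_real (cos (t/2)) * of_real (cos (t/2)) + w * (cnj w * (of_real (sin (t/2)) * of_real (sin (t/2))))"
    using assms(1) unfolding lowering_pairs_def
    by (elim insertE emptyE) (simp_all add: rot_def det_3 index3_distinct)
  also have "\<dots> = of_real (cos (t/2) * cos (t/2) + sin (t/2) * sin (t/2))"
    by (simp only: w of_real_mult of_real_add)
  also have "cos (t/2) * cos (t/2) + sin (t/2) * sin (t/2) = 1"
    using sin_cos_squared_add3 by blast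
  finally show ?thesis using 1 by (simp add: SU3_def)
qed

lemma continuous_on_rot: "continuous_on UNIV (rot m n w)"
proof -
  have if_const: "continuous_on UNIV (\<lambda>t. if P then f t else g t)"
    if "continuous_on UNIV f" "continuous_on UNIV g" for P and f g :: "real \<Rightarrow> complex"
    using that by (cases P) simp_all
  show ?thesis
    unfolding rot_def by (intro continuous_on_vec_lambda if_const continuous_intros) simp_all
qed

lemma matrix_inv_rot:
  assumes "(m, n) \<in> lowering_pairs" "w * cnj w = 1"
  shows "matrix_inv (rot m n w t) = rot m n w (- t)"
proof -
  have r: "rot m n w t ** rot m n w (- t) = mat 1" and l: "rot m n w (- t) ** rot m n w t = mat 1"
    using rot_add[OF assms, of t "- t"] rot_add[OF assms, of "- t" t]
    by (simp_all add: rot_0 lowering_pairs_neq[OF assms(1)])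
  then have "rot m n w t ** matrix_inv (rot m n w t) = mat 1"
    unfolding matrix_inv_def
    by (intro conjunct1[OF someI[of "\<lambda>A'. rot m n w t ** A' = mat 1 \<and> A' ** rot m n w t = mat 1"]]) simp
  then show ?thesis
    by (metis l matrix_mul_assoc matrix_mul_lid matrix_mul_rid)
qed

lemma sl_rep_munit:
  assumes "(m, n) \<in> lowering_pairs"
  shows "sl_rep \<pi> (munit m n) i j = drep \<pi> (rot_gen m n 1) i j + \<i> * drep \<pi> (rot_gen m n (- \<i>)) i j"
proof -
  have 1: "(\<chi> k l. (munit m n $ k $ l - hconj (munit m n) $ k $ l) / 2) = rot_gen m n 1"
    using assms unfolding lowering_pairs_def
    by (auto simp: munit_def hconj_def axis_def rot_gen_def vec_eq_iff forall_3)
  have 2: "(\<chi> k l. (munit m n $ k $ l + hconj (munit m n) $ k $ l) / (2 * \<i>)) = rot_gen m n (- \<i>)"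
    using assms unfolding lowering_pairs_def
    by (auto simp: munit_def hconj_def axis_def rot_gen_def vec_eq_iff forall_3 complex_eq_iff)
  show ?thesis unfolding sl_rep_def 1 2 ..
qed

section \<open>Lowering operators of tensor products and duals\<close>

definition differentiable_rep :: "'i set \<Rightarrow> 'i rep \<Rightarrow> bool" where
  "differentiable_rep I \<pi> \<longleftrightarrow>
    (\<forall>i\<in>I. \<forall>j\<in>I. \<pi> (mat 1) i j = (if i = j then 1 else 0)) \<and>
    (\<forall>m n w. (m, n) \<in> lowering_pairs \<longrightarrow> w * cnj w = 1 \<longrightarrow>
       (\<forall>i\<in>I. \<forall>j\<in>I. ((\<lambda>t. \<pi> (rot m n w t) i j) has_vector_derivative drep \<pi> (rot_gen m n w) i j) (at 0)))"

lemma drep_rot_gen: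
  assumes "(m, n) \<in> lowering_pairs" "w * cnj w = 1"
    and "((\<lambda>t. \<pi> (rot m n w t) i j) has_vector_derivative D) (at 0)"
  shows "drep \<pi> (rot_gen m n w) i j = D"
  unfolding drep_def mexp_rot_gen[OF assms(1,2)] by (rule vector_derivative_at[OF assms(3)])

lemma unitary_rep_differentiable:
  assumes "unitary_rep I \<pi>"
  shows "differentiable_rep I \<pi>"
proof -
  have "((\<lambda>t. \<pi> (rot m n w t) i j) has_vector_derivative drep \<pi> (rot_gen m n w) i j) (at 0)"
    if dir: "(m, n) \<in> lowering_pairs" "w * cnj w = 1" and ij: "i \<in> I" "j \<in> I" for m n w i j
  proof -
    have "\<exists>D. ((\<lambda>t. \<pi> (rot m n w t) i j) has_vector_derivative D) (at 0)"
    proof (rule one_parameter_group_differentiable[of I "\<lambda>t. \<pi> (rot m n w t)", OF _ _ _ _ ij])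
      show "finite I" using assms by (simp add: unitary_rep_def)
    next
      fix i j assume "i \<in> I" "j \<in> I"
      then show "\<pi> (rot m n w 0) i j = (if i = j then 1 else 0)"
        using assms by (simp add: unitary_rep_def rot_0 lowering_pairs_neq[OF dir(1)])
    next
      fix s t i j assume "i \<in> I" "j \<in> I"
      then show "\<pi> (rot m n w (s + t)) i j = (\<Sum>k\<in>I. \<pi> (rot m n w s) i k * \<pi> (rot m n w t) k j)"
        using assms rot_SU3[OF dir] by (simp add: unitary_rep_def rot_add[OF dir])
    next
      fix i j assume "i \<in> I" "j \<in> I"
      then have "continuous_on SU3 (\<lambda>g. \<pi> g i j)" using assms by (simp add: unitary_rep_def)
      then show "continuous_on UNIV (\<lambda>t. \<pi> (rot m n w t) i j)"
        by (rule continuous_on_compose2[OF _ continuous_on_rot]) (use rot_SU3[OF dir] in auto)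
    qed
    then show ?thesis using drep_rot_gen[OF dir] by metis
  qed
  then show ?thesis using assms unfolding differentiable_rep_def unitary_rep_def by simp
qed

lemma matrix_inv_mat_1: "matrix_inv (mat 1 :: complex^3^3) = mat 1"
  using matrix_inv_rot[of 2 1 1 0] by (simp add: lowering_pairs_def rot_0)

lemma dual_rep_derivative:
  assumes "differentiable_rep I \<pi>" and dir: "(m, n) \<in> lowering_pairs" "w * cnj w = 1"
    and "i \<in> I" "j \<in> I"
  shows "((\<lambda>t. dual_rep \<pi> (rot m n w t) i j) has_vector_derivative - drep \<pi> (rot_gen m n w) j i) (at 0)"
proof -
  have "((\<lambda>t. \<pi> (rot m n w t) j i) has_vector_derivative drep \<pi> (rot_gen m n w) j i) (at (- 0))"
    using assms by (simp add: differentiable_rep_def)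
  then have "(((\<lambda>t. \<pi> (rot m n w t) j i) \<circ> uminus) has_vector_derivative (- 1) *\<^sub>R drep \<pi> (rot_gen m n w) j i) (at 0)"
    by (intro vector_diff_chain_at) (auto intro!: derivative_eq_intros)
  then show ?thesis
    by (simp add: dual_rep_def matrix_inv_rot[OF dir] o_def)
qed

lemma drep_dual_rep:
  assumes "differentiable_rep I \<pi>" and "(m, n) \<in> lowering_pairs" "w * cnj w = 1"
    and "i \<in> I" "j \<in> I"
  shows "drep (dual_rep \<pi>) (rot_gen m n w) i j = - drep \<pi> (rot_gen m n w) j i"
  using assms(2,3) dual_rep_derivative[OF assms] by (rule drep_rot_gen)

lemma dual_rep_differentiable:
  assumes "differentiable_rep I \<pi>"
  shows "differentiable_rep I (dual_rep \<pi>)"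
  unfolding differentiable_rep_def
proof (intro conjI ballI allI impI)
  fix i j assume "i \<in> I" "j \<in> I"
  then show "dual_rep \<pi> (mat 1) i j = (if i = j then 1 else 0)"
    using assms by (auto simp: differentiable_rep_def dual_rep_def matrix_inv_mat_1)
next
  fix m n w i j assume *: "(m, n) \<in> lowering_pairs" "w * cnj w = 1" "i \<in> I" "j \<in> I"
  show "((\<lambda>t. dual_rep \<pi> (rot m n w t) i j) has_vector_derivative drep (dual_rep \<pi>) (rot_gen m n w) i j) (at 0)"
    unfolding drep_dual_rep[OF assms *] by (rule dual_rep_derivative[OF assms *])
qed

lemma sl_rep_dual:
  assumes "differentiable_rep I \<pi>" and dir: "(m, n) \<in> lowering_pairs" and "i \<in> I" "j \<in> I"
  shows "sl_rep (dual_rep \<pi>) (munit m n) i j = - sl_rep \<pi> (munit m n) j i"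
  by (simp add: sl_rep_munit[OF dir] drep_dual_rep[OF assms(1) dir _ assms(3,4)])

lemma sl_rep_tensor:
  assumes \<pi>: "differentiable_rep I \<pi>" and \<rho>: "differentiable_rep J \<rho>"
    and dir: "(m, n) \<in> lowering_pairs" and x: "x \<in> I \<times> J" and y: "y \<in> I \<times> J"
  shows "sl_rep (tensor_rep \<pi> \<rho>) (munit m n) x y =
    (if snd x = snd y then sl_rep \<pi> (munit m n) (fst x) (fst y) else 0) +
    (if fst x = fst y then sl_rep \<rho> (munit m n) (snd x) (snd y) else 0)"
proof -
  have "drep (tensor_rep \<pi> \<rho>) (rot_gen m n w) x y =
    (if snd x = snd y then drep \<pi> (rot_gen m n w) (fst x) (fst y) else 0) +
    (if fst x = fst y then drep \<rho> (rot_gen m n w) (snd x) (snd y) else 0)"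
    if w: "w * cnj w = 1" for w
  proof (rule drep_rot_gen[OF dir w])
    have "((\<lambda>t. \<pi> (rot m n w t) (fst x) (fst y) * \<rho> (rot m n w t) (snd x) (snd y)) has_vector_derivative
        \<pi> (rot m n w 0) (fst x) (fst y) * drep \<rho> (rot_gen m n w) (snd x) (snd y) +
        drep \<pi> (rot_gen m n w) (fst x) (fst y) * \<rho> (rot m n w 0) (snd x) (snd y)) (at 0)"
      using \<pi> \<rho> dir w x y by (intro has_vector_derivative_mult) (auto simp: differentiable_rep_def)
    moreover have "\<pi> (rot m n w 0) (fst x) (fst y) * drep \<rho> (rot_gen m n w) (snd x) (snd y) +
        drep \<pi> (rot_gen m n w) (fst x) (fst y) * \<rho> (rot m n w 0) (snd x) (snd y) =
      (if snd x = snd y then drep \<pi> (rot_gen m n w) (fst x) (fst y) else 0) +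
      (if fst x = fst y then drep \<rho> (rot_gen m n w) (snd x) (snd y) else 0)"
      using \<pi> \<rho> x y unfolding differentiable_rep_def rot_0[OF lowering_pairs_neq[OF dir]]
      by (simp add: mem_Times_iff)
    ultimately show "((\<lambda>t. tensor_rep \<pi> \<rho> (rot m n w t) x y) has_vector_derivative
      (if snd x = snd y then drep \<pi> (rot_gen m n w) (fst x) (fst y) else 0) +
      (if fst x = fst y then drep \<rho> (rot_gen m n w) (snd x) (snd y) else 0)) (at 0)"
      unfolding tensor_rep_def by simp
  qed
  then show ?thesis by (simp add: sl_rep_munit[OF dir] algebra_simps)
qed

section \<open>Linear algebra in coordinates\<close>

definition adj :: "'i cmat \<Rightarrow> 'i cmat" where
  "adj X = (\<lambda>i j. cnj (X j i))"

lemma adj_adj [simp]: "adj (adj X) = X"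
  by (simp add: adj_def)

lemma cinner_adj: "cinner I v (app I X w) = cinner I (app I (adj X) v) w"
proof -
  have "cinner I v (app I X w) = (\<Sum>i\<in>I. \<Sum>j\<in>I. cnj (v i) * (X i j * w j))"
    unfolding cinner_def app_def by (intro sum.cong refl) (simp add: sum_distrib_left)
  also have "\<dots> = (\<Sum>j\<in>I. \<Sum>i\<in>I. cnj (v i) * (X i j * w j))"
    by (rule sum.swap)
  also have "\<dots> = cinner I (app I (adj X) v) w"
    unfolding cinner_def app_def adj_def
    by (intro sum.cong refl) (simp add: sum_distrib_right sum_distrib_left algebra_simps)
  finally show ?thesis .
qed

lemma cinner_cnj: "cnj (cinner I v w) = cinner I w v"
  by (simp add: cinner_def mult.commute)

lemma cinner_sum_right: "cinner I v (\<lambda>i. \<Sum>x\<in>A. c x * f x i) = (\<Sum>x\<in>A. c x * cinner I v (f x))"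
  unfolding cinner_def sum_distrib_left by (subst sum.swap) (simp add: mult_ac)

lemma cinner_sum_left: "cinner I (\<lambda>i. \<Sum>x\<in>A. c x * f x i) v = (\<Sum>x\<in>A. cnj (c x) * cinner I (f x) v)"
  unfolding cinner_def sum_distrib_left cnj_sum sum_distrib_right by (subst sum.swap) (simp add: mult_ac)

lemma cinner_zero [simp]: "cinner I v (\<lambda>i. 0) = 0" "cinner I (\<lambda>i. 0) v = 0"
  by (simp_all add: cinner_def)

lemma cinner_lincomb_right:
  "cinner I v (\<lambda>i. x * f i + y * g i) = x * cinner I v f + y * cinner I v g"
  by (simp add: cinner_def sum.distrib sum_distrib_left algebra_simps)

lemma cinner_lincomb_left:
  "cinner I (\<lambda>i. x * f i + y * g i) v = cnj x * cinner I f v + cnj y * cinner I g v"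
  by (simp add: cinner_def sum.distrib sum_distrib_left algebra_simps)

lemma app_lincomb: "app I X (\<lambda>i. x * f i + y * g i) = (\<lambda>i. x * app I X f i + y * app I X g i)"
  by (simp add: app_def fun_eq_iff sum.distrib sum_distrib_left algebra_simps)

lemma app_sum: "app I X (\<lambda>i. \<Sum>x\<in>A. c x * f x i) = (\<lambda>i. \<Sum>x\<in>A. c x * app I X (f x) i)"
proof
  fix i
  show "app I X (\<lambda>i. \<Sum>x\<in>A. c x * f x i) i = (\<Sum>x\<in>A. c x * app I X (f x) i)"
    unfolding app_def sum_distrib_left by (subst sum.swap) (simp add: mult_ac sum_distrib_left)
qed

lemma app_zero [simp]: "app I X (\<lambda>i. 0) = (\<lambda>i. 0)"
  by (simp add: app_def fun_eq_iff)

lemma app_hilb: "app I X v \<in> hilb I"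
  by (simp add: app_def hilb_def)

lemma app_cong:
  "(\<And>i j. i \<in> I \<Longrightarrow> j \<in> I \<Longrightarrow> X i j = Y i j) \<Longrightarrow> app I X = app I Y"
  by (auto simp: app_def fun_eq_iff intro!: sum.cong)

section \<open>The Gelfand-Tsetlin coefficients\<close>

text \<open>
  A label is given by the triple \<open>(r\<^sub>-, r\<^sub>+, \<nu>\<^sub>3)\<close>; in these coordinates \<open>U\<^sub>-\<close> raises the third
  component and \<open>T\<^sub>-\<close> raises one of the first two.
\<close>

type_synonym triple = "int \<times> int \<times> int"

definition triples :: "irrep_class \<Rightarrow> triple set" where
  "triples c = {(a, b, n). 0 \<le> a \<and> a \<le> int (snd c) \<and> int (snd c) \<le> b \<and> b \<le> int (fst c + snd c) \<and> a \<le> n \<and> n \<le> b}"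

definition coeff_a :: "irrep_class \<Rightarrow> int \<Rightarrow> int \<Rightarrow> int \<Rightarrow> real" where
  "coeff_a c a b n = sqrt (of_int ((n - a) * (int (fst c + snd c) + 1 - a) * (int (snd c) - a) * (a + 1)) /
     of_int ((b - a) * (b - a + 1)))"

definition coeff_b :: "irrep_class \<Rightarrow> int \<Rightarrow> int \<Rightarrow> int \<Rightarrow> real" where
  "coeff_b c a b n = sqrt (of_int ((b + 1 - n) * (int (fst c + snd c) - b) * (b + 1 - int (snd c)) * (b + 2)) /
     of_int ((b - a + 2) * (b - a + 1)))"

definition coeff_n :: "int \<Rightarrow> int \<Rightarrow> int \<Rightarrow> real" where
  "coeff_n a b n = sqrt (of_int ((b - n) * (n - a + 1)))"

definition LT :: "irrep_class \<Rightarrow> (triple \<Rightarrow> complex) \<Rightarrow> triple \<Rightarrow> complex" where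
  "LT c f = (\<lambda>(a, b, n). of_real (coeff_a c a b n) * f (a + 1, b, n) + of_real (coeff_b c a b n) * f (a, b + 1, n))"

definition RT :: "irrep_class \<Rightarrow> (triple \<Rightarrow> complex) \<Rightarrow> triple \<Rightarrow> complex" where
  "RT c f = (\<lambda>(a, b, n). of_real (coeff_a c (a - 1) b n) * f (a - 1, b, n) +
     of_real (coeff_b c a (b - 1) n) * f (a, b - 1, n))"

definition LU :: "(triple \<Rightarrow> complex) \<Rightarrow> triple \<Rightarrow> complex" where
  "LU f = (\<lambda>(a, b, n). of_real (coeff_n a b n) * f (a, b, n + 1))"

definition RU :: "(triple \<Rightarrow> complex) \<Rightarrow> triple \<Rightarrow> complex" where
  "RU f = (\<lambda>(a, b, n). of_real (coeff_n a b (n - 1)) * f (a, b, n - 1))"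

lemma finite_triples: "finite (triples c)"
proof (rule finite_subset)
  let ?A = "{0..int (fst c + snd c)}"
  show "triples c \<subseteq> ?A \<times> ?A \<times> ?A" by (auto simp: triples_def)
qed auto

lemma LT_cong: "l \<in> triples c \<Longrightarrow> (\<And>x. x \<in> triples c \<Longrightarrow> f x = g x) \<Longrightarrow> LT c f l = LT c g l"
proof -
  assume l: "l \<in> triples c" and eq: "\<And>x. x \<in> triples c \<Longrightarrow> f x = g x"
  obtain a b n where abn: "l = (a, b, n)" by (cases l)
  have "coeff_a c a b n = 0 \<or> (a + 1, b, n) \<in> triples c"
    using l unfolding abn triples_def coeff_a_def by auto
  moreover have "coeff_b c a b n = 0 \<or> (a, b + 1, n) \<in> triples c"
    using l unfolding abn triples_def coeff_b_def by auto
  ultimately show ?thesis using eq by (auto simp: LT_def abn)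
qed

lemma RT_cong: "l \<in> triples c \<Longrightarrow> (\<And>x. x \<in> triples c \<Longrightarrow> f x = g x) \<Longrightarrow> RT c f l = RT c g l"
proof -
  assume l: "l \<in> triples c" and eq: "\<And>x. x \<in> triples c \<Longrightarrow> f x = g x"
  obtain a b n where abn: "l = (a, b, n)" by (cases l)
  have "coeff_a c (a - 1) b n = 0 \<or> (a - 1, b, n) \<in> triples c"
    using l unfolding abn triples_def coeff_a_def by auto
  moreover have "coeff_b c a (b - 1) n = 0 \<or> (a, b - 1, n) \<in> triples c"
    using l unfolding abn triples_def coeff_b_def by auto
  ultimately show ?thesis using eq by (auto simp: RT_def abn)
qed

lemma LU_cong: "l \<in> triples c \<Longrightarrow> (\<And>x. x \<in> triples c \<Longrightarrow> f x = g x) \<Longrightarrow> LU f l = LU g l"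
proof -
  assume l: "l \<in> triples c" and eq: "\<And>x. x \<in> triples c \<Longrightarrow> f x = g x"
  obtain a b n where abn: "l = (a, b, n)" by (cases l)
  have "coeff_n a b n = 0 \<or> (a, b, n + 1) \<in> triples c"
    using l unfolding abn triples_def coeff_n_def by auto
  then show ?thesis using eq by (auto simp: LU_def abn)
qed

lemma RU_cong: "l \<in> triples c \<Longrightarrow> (\<And>x. x \<in> triples c \<Longrightarrow> f x = g x) \<Longrightarrow> RU f l = RU g l"
proof -
  assume l: "l \<in> triples c" and eq: "\<And>x. x \<in> triples c \<Longrightarrow> f x = g x"
  obtain a b n where abn: "l = (a, b, n)" by (cases l)
  have "coeff_n a b (n - 1) = 0 \<or> (a, b, n - 1) \<in> triples c"
    using l unfolding abn triples_def coeff_n_def by auto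
  then show ?thesis using eq by (auto simp: RU_def abn)
qed

lemma coeff_ab_commute:
  "coeff_a c a b n * coeff_b c (a + 1) (b - 1) n = coeff_b c a (b - 1) n * coeff_a c a (b - 1) n"
  unfolding coeff_a_def coeff_b_def real_sqrt_mult[symmetric]
  unfolding times_divide_times_eq of_int_mult[symmetric]
  by (intro arg_cong[where f = sqrt] arg_cong2[where f = "\<lambda>x y. of_int x / of_int y"])
     (simp_all only: mult.commute, simp add: algebra_simps)

lemma sqrt_of_int_ratio_square:
  "0 \<le> N \<Longrightarrow> 0 \<le> D \<Longrightarrow> sqrt (of_int N / of_int D) * sqrt (of_int N / of_int D) = of_int N / of_int D"
  by simp

lemma four_fractions:
  fixes d :: real
  assumes "0 < d" "(N1 - N4) * (d + 2) + (N2 - N3) * d = R * d * (d + 1) * (d + 2)"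
  shows "N1 / (d * (d + 1)) + N2 / ((d + 2) * (d + 1)) - N3 / ((d + 1) * (d + 2)) - N4 / ((d + 1) * d) = R"
proof -
  have "N1 / (d * (d + 1)) + N2 / ((d + 2) * (d + 1)) - N3 / ((d + 1) * (d + 2)) - N4 / ((d + 1) * d)
    = ((N1 - N4) * (d + 2) + (N2 - N3) * d) / (d * (d + 1) * (d + 2))"
    using assms(1) by (simp add: divide_simps) (simp add: algebra_simps)
  also have "\<dots> = R" using assms(1) by (simp add: assms(2))
  finally show ?thesis .
qed

lemma coeff_squares:
  assumes "(a, b, n) \<in> triples c"
  shows "coeff_a c a b n * coeff_a c a b n + coeff_b c a b n * coeff_b c a b n
    - coeff_a c (a - 1) b n * coeff_a c (a - 1) b n - coeff_b c a (b - 1) n * coeff_b c a (b - 1) n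
    = of_int (int (fst c) + 2 * int (snd c) - 2 * a - 2 * b + n)"
proof -
  obtain p q where c: "c = (p, q)" by (cases c)
  define S Q where "S = int (p + q)" and "Q = int q"
  have r: "0 \<le> a" "a \<le> Q" "Q \<le> b" "b \<le> S" "a \<le> n" "n \<le> b"
    using assms by (auto simp: triples_def c S_def Q_def)
  define N1 N2 N3 N4 where
    "N1 = (n - a) * (S + 1 - a) * (Q - a) * (a + 1)"
    and "N2 = (b + 1 - n) * (S - b) * (b + 1 - Q) * (b + 2)"
    and "N3 = (n - (a - 1)) * (S + 1 - (a - 1)) * (Q - (a - 1)) * (a - 1 + 1)"
    and "N4 = (b - 1 + 1 - n) * (S - (b - 1)) * (b - 1 + 1 - Q) * (b - 1 + 2)"
  note N = N1_def N2_def N3_def N4_def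
  have sq: "coeff_a c a b n * coeff_a c a b n = of_int N1 / of_int ((b - a) * (b - a + 1))"
    "coeff_b c a b n * coeff_b c a b n = of_int N2 / of_int ((b - a + 2) * (b - a + 1))"
    "coeff_a c (a - 1) b n * coeff_a c (a - 1) b n = of_int N3 / of_int ((b - (a - 1)) * (b - (a - 1) + 1))"
    "coeff_b c a (b - 1) n * coeff_b c a (b - 1) n = of_int N4 / of_int ((b - 1 - a + 2) * (b - 1 - a + 1))"
    unfolding coeff_a_def coeff_b_def c fst_conv snd_conv S_def[symmetric] Q_def[symmetric] N[symmetric]
    by (rule sqrt_of_int_ratio_square; use r in \<open>auto simp: N intro!: mult_nonneg_nonneg\<close>)+
  have R: "int (fst c) + 2 * int (snd c) - 2 * a - 2 * b + n = S + Q - 2 * a - 2 * b + n"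
    by (simp add: c S_def Q_def)
  show ?thesis
  proof (cases "a = b")
    case True
    then have "Q = a" "n = a" "b = a" using r by auto
    then show ?thesis unfolding sq R N by (simp add: field_simps)
  next
    case False
    define d where "d = b - a"
    have d: "0 < d" and b: "b = a + d" using False r by (auto simp: d_def)
    have "(N1 - N4) * (d + 2) + (N2 - N3) * d = (S + Q - 2 * a - 2 * b + n) * d * (d + 1) * (d + 2)"
      unfolding N b by (simp add: algebra_simps)
    then have "real_of_int ((N1 - N4) * (d + 2) + (N2 - N3) * d) = of_int ((S + Q - 2 * a - 2 * b + n) * d * (d + 1) * (d + 2))"
      by (rule arg_cong)
    then have "(real_of_int N1 - of_int N4) * (of_int d + 2) + (of_int N2 - of_int N3) * of_int d =
      of_int (S + Q - 2 * a - 2 * b + n) * of_int d * (of_int d + 1) * (of_int d + 2)"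
      by simp
    from four_fractions[OF _ this] show ?thesis
      unfolding sq R using d by (simp add: b algebra_simps)
  qed
qed

lemma LT_RT_commutator:
  assumes "l \<in> triples c"
  shows "LT c (RT c f) l - RT c (LT c f) l =
    of_int (case l of (a, b, n) \<Rightarrow> int (fst c) + 2 * int (snd c) - 2 * a - 2 * b + n) * f l"
proof -
  obtain a b n where l: "l = (a, b, n)" by (cases l)
  define A B A' B' where "A = complex_of_real (coeff_a c a b n)" and "B = complex_of_real (coeff_b c a b n)"
    and "A' = complex_of_real (coeff_a c (a - 1) b n)" and "B' = complex_of_real (coeff_b c a (b - 1) n)"
  have 1: "A * of_real (coeff_b c (a + 1) (b - 1) n) = B' * of_real (coeff_a c a (b - 1) n)"
    unfolding A_def B'_def of_real_mult[symmetric] coeff_ab_commute ..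
  have 2: "A' * of_real (coeff_b c (a - 1) b n) = B * of_real (coeff_a c (a - 1) (b + 1) n)"
    using coeff_ab_commute[of c "a - 1" "b + 1" n]
    unfolding A'_def B_def of_real_mult[symmetric] by (simp add: mult.commute)
  have 3: "A * A + B * B - A' * A' - B' * B' = of_int (int (fst c) + 2 * int (snd c) - 2 * a - 2 * b + n)"
    using arg_cong[OF coeff_squares[OF assms[unfolded l]], of complex_of_real]
    by (simp only: A_def B_def A'_def B'_def of_real_mult of_real_add of_real_diff of_real_of_int_eq)
  have "LT c (RT c f) l - RT c (LT c f) l = (A * A + B * B - A' * A' - B' * B') * f l
    + (A * of_real (coeff_b c (a + 1) (b - 1) n) - B' * of_real (coeff_a c a (b - 1) n)) * f (a + 1, b - 1, n)
    - (A' * of_real (coeff_b c (a - 1) b n) - B * of_real (coeff_a c (a - 1) (b + 1) n)) * f (a - 1, b + 1, n)"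
    by (simp add: l LT_def RT_def A_def B_def A'_def B'_def algebra_simps)
  then show ?thesis unfolding 1 2 3 by (simp add: l)
qed

lemma LU_RU_commutator:
  assumes "l \<in> triples c"
  shows "LU (RU f) l - RU (LU f) l = of_int (case l of (a, b, n) \<Rightarrow> a + b - 2 * n) * f l"
proof -
  obtain a b n where l: "l = (a, b, n)" by (cases l)
  have r: "a \<le> n" "n \<le> b" using assms by (auto simp: l triples_def)
  have sq: "sqrt (of_int N) * sqrt (of_int N) = of_int N" if "0 \<le> N" for N
    using that by simp
  have "0 \<le> (b - n) * (n - a + 1)" "0 \<le> (b - (n - 1)) * (n - 1 - a + 1)"
    using r by (auto intro!: mult_nonneg_nonneg)
  then have "coeff_n a b n * coeff_n a b n - coeff_n a b (n - 1) * coeff_n a b (n - 1)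
      = of_int ((b - n) * (n - a + 1) - (b - (n - 1)) * (n - 1 - a + 1))"
    unfolding coeff_n_def by (simp only: sq of_int_diff)
  also have "(b - n) * (n - a + 1) - (b - (n - 1)) * (n - 1 - a + 1) = a + b - 2 * n"
    by (simp add: algebra_simps)
  finally have "coeff_n a b n * coeff_n a b n - coeff_n a b (n - 1) * coeff_n a b (n - 1) = of_int (a + b - 2 * n)" .
  then have "complex_of_real (coeff_n a b n) * complex_of_real (coeff_n a b n)
      - complex_of_real (coeff_n a b (n - 1)) * complex_of_real (coeff_n a b (n - 1)) = of_int (a + b - 2 * n)"
    by (metis of_real_diff of_real_mult of_real_of_int_eq)
  moreover have "LU (RU f) l - RU (LU f) l = (complex_of_real (coeff_n a b n) * complex_of_real (coeff_n a b n)
      - complex_of_real (coeff_n a b (n - 1)) * complex_of_real (coeff_n a b (n - 1))) * f l"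
    by (simp add: l LU_def RU_def algebra_simps)
  ultimately show ?thesis by (simp add: l)
qed

definition top_label :: "irrep_class \<Rightarrow> triple" where
  "top_label c = (0, int (snd c), 0)"

lemma top_label_in_triples: "top_label c \<in> triples c"
  by (simp add: top_label_def triples_def)

lemma coeff_n_nonzero: "a \<le> n \<Longrightarrow> n < b \<Longrightarrow> coeff_n a b n \<noteq> 0"
  by (simp add: coeff_n_def)

lemma coeff_b_nonzero:
  "(a, b, n) \<in> triples c \<Longrightarrow> b < int (fst c + snd c) \<Longrightarrow> coeff_b c a b n \<noteq> 0"
  by (auto simp: coeff_b_def triples_def)

lemma coeff_a_nonzero:
  "(a, b, n) \<in> triples c \<Longrightarrow> a < n \<Longrightarrow> a < int (snd c) \<Longrightarrow> coeff_a c a b n \<noteq> 0"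
  by (auto simp: coeff_a_def triples_def)

lemma coeff_a_edge [simp]: "coeff_a c a b a = 0"
  by (simp add: coeff_a_def)

lemma lowering_kernel:
  assumes out: "\<And>l. l \<notin> triples c \<Longrightarrow> g l = 0"
    and t: "\<And>l. l \<in> triples c \<Longrightarrow> LT c g l = 0"
    and u: "\<And>l. l \<in> triples c \<Longrightarrow> LU g l = 0"
    and l: "l \<noteq> top_label c"
  shows "g l = 0"
proof -
  have above: "g (a, b, n) = 0" if "a < n" for a b n
  proof (cases "(a, b, n) \<in> triples c")
    case True
    then have "(a, b, n - 1) \<in> triples c" using that by (auto simp: triples_def)
    from u[OF this] show ?thesis
      using True that coeff_n_nonzero[of a "n - 1" b] by (auto simp: LU_def triples_def)
  qed (rule out)
  obtain a b n where abn: "l = (a, b, n)" by (cases l)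
  consider "l \<notin> triples c" | "a < n" | "l \<in> triples c" "n = a" "int (snd c) < b"
    | "l \<in> triples c" "n = a" "b = int (snd c)" "0 < a"
    using l abn by (fastforce simp: triples_def top_label_def)
  then show ?thesis
  proof cases
    case 3
    then have "(a, b - 1, a) \<in> triples c" by (auto simp: triples_def abn)
    from t[OF this] coeff_b_nonzero[OF this] show ?thesis
      using 3 by (auto simp: LT_def triples_def abn)
  next
    case 4
    then have "(a - 1, b, a) \<in> triples c" by (auto simp: triples_def abn)
    from t[OF this] coeff_a_nonzero[OF this] show ?thesis
      using 4 by (auto simp: LT_def triples_def abn above)
  qed (use out above abn in auto)
qed

lemma lowering_generates:
  assumes out: "\<And>l i. l \<notin> triples c \<Longrightarrow> d l i = 0"
    and t: "\<And>l. l \<in> triples c \<Longrightarrow> app I tm (d l) = (\<lambda>i. LT c (\<lambda>x. d x i) l)"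
    and u: "\<And>l. l \<in> triples c \<Longrightarrow> app I um (d l) = (\<lambda>i. LU (\<lambda>x. d x i) l)"
    and top: "d (top_label c) = (\<lambda>i. 0)"
  shows "d l = (\<lambda>i. 0)"
proof -
  define Q where "Q = int (snd c)"
  have step_n: "d (a, b, n + 1) = (\<lambda>i. 0)" if "d (a, b, n) = (\<lambda>i. 0)" "(a, b, n) \<in> triples c" for a b n
  proof (cases "n < b")
    case True
    show ?thesis
      using u[OF that(2)] that(1) coeff_n_nonzero[OF _ True, of a] that(2)
      by (auto simp: LU_def triples_def fun_eq_iff)
  next
    case False
    then show ?thesis using out[of "(a, b, n + 1)"] by (auto simp: triples_def)
  qed
  have col: "d (a, b, n) = (\<lambda>i. 0)" if "(a, b, n) \<in> triples c" "d (a, b, a) = (\<lambda>i. 0)" for a b n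
  proof -
    have "a \<le> n" using that by (simp add: triples_def)
    then have "(a, b, n) \<in> triples c \<longrightarrow> d (a, b, n) = (\<lambda>i. 0)"
    proof (induction n rule: int_ge_induct)
      case (step m)
      then show ?case using step_n[of a b m] by (auto simp: triples_def)
    qed (use that in simp)
    then show ?thesis using that by blast
  qed
  have row: "d (a, b, a) = (\<lambda>i. 0)" if "(a, b, a) \<in> triples c" "d (a, Q, a) = (\<lambda>i. 0)" for a b
  proof -
    have "Q \<le> b" using that by (simp add: triples_def Q_def)
    then have "(a, b, a) \<in> triples c \<longrightarrow> d (a, b, a) = (\<lambda>i. 0)"
    proof (induction b rule: int_ge_induct)
      case (step m)
      show ?case
      proof
        assume "(a, m + 1, a) \<in> triples c"
        then have m: "(a, m, a) \<in> triples c" "m < int (fst c + snd c)"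
          using step.hyps \<open>(a, b, a) \<in> triples c\<close> by (auto simp: triples_def Q_def)
        then show "d (a, m + 1, a) = (\<lambda>i. 0)"
          using t[OF m(1)] coeff_b_nonzero[OF m] step.IH by (auto simp: LT_def fun_eq_iff)
      qed
    qed (use that in simp)
    then show ?thesis using that by blast
  qed
  have all: "d (a, b, n) = (\<lambda>i. 0)" if "0 \<le> a" for a b n
    using that
  proof (induction a arbitrary: b n rule: int_ge_induct)
    case base
    have "d (0, Q, 0) = (\<lambda>i. 0)" using top by (simp add: top_label_def Q_def)
    then show ?case
      using col[of 0 b n] row[of 0 b] out[of "(0, b, n)"]
      by (cases "(0, b, n) \<in> triples c") (auto simp: triples_def)
  next
    case (step a)
    have "d (a + 1, Q, a + 1) = (\<lambda>i. 0)" if "(a + 1, b, n) \<in> triples c"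
    proof -
      have m: "(a, Q, a + 1) \<in> triples c" and "a < int (snd c)"
        using that step.hyps by (auto simp: triples_def Q_def)
      then show ?thesis
        using t[OF m] coeff_a_nonzero[OF m] step.IH by (auto simp: LT_def fun_eq_iff)
    qed
    then show ?case
      using col[of "a + 1" b n] row[of "a + 1" b] out[of "(a + 1, b, n)"]
      by (cases "(a + 1, b, n) \<in> triples c") (auto simp: triples_def)
  qed
  obtain a b n where "l = (a, b, n)" by (cases l)
  then show ?thesis
    using all[of a b n] out[of l] by (cases "0 \<le> a") (auto simp: triples_def)
qed

lemma cinner_LT: "cinner I v (\<lambda>i. LT c (\<lambda>x. G x i) l) = LT c (\<lambda>x. cinner I v (G x)) l"
  "cinner I (\<lambda>i. LT c (\<lambda>x. G x i) l) v = LT c (\<lambda>x. cinner I (G x) v) l"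
  by (cases l; simp add: LT_def cinner_lincomb_right cinner_lincomb_left)+

lemma cinner_RT: "cinner I v (\<lambda>i. RT c (\<lambda>x. G x i) l) = RT c (\<lambda>x. cinner I v (G x)) l"
  "cinner I (\<lambda>i. RT c (\<lambda>x. G x i) l) v = RT c (\<lambda>x. cinner I (G x) v) l"
  by (cases l; simp add: RT_def cinner_lincomb_right cinner_lincomb_left)+

lemma cinner_scale: "cinner I v (\<lambda>i. x * f i) = x * cinner I v f" "cinner I (\<lambda>i. x * f i) v = cnj x * cinner I f v"
  using cinner_lincomb_right[of I v x f 0 f] cinner_lincomb_left[of I x f 0 f v] by simp_all

lemma app_scale: "app I X (\<lambda>i. x * f i) = (\<lambda>i. x * app I X f i)"
  using app_lincomb[of I X x f 0 f] by simp

lemma cinner_LU: "cinner I v (\<lambda>i. LU (\<lambda>x. G x i) l) = LU (\<lambda>x. cinner I v (G x)) l"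
  "cinner I (\<lambda>i. LU (\<lambda>x. G x i) l) v = LU (\<lambda>x. cinner I (G x) v) l"
  by (cases l; simp add: LU_def cinner_scale)+

lemma cinner_RU: "cinner I v (\<lambda>i. RU (\<lambda>x. G x i) l) = RU (\<lambda>x. cinner I v (G x)) l"
  "cinner I (\<lambda>i. RU (\<lambda>x. G x i) l) v = RU (\<lambda>x. cinner I (G x) v) l"
  by (cases l; simp add: RU_def cinner_scale)+

lemma app_LT: "app I X (\<lambda>i. LT c (\<lambda>x. G x i) l) = (\<lambda>i. LT c (\<lambda>x. app I X (G x) i) l)"
  by (cases l) (simp add: LT_def app_lincomb)

lemma app_RT: "app I X (\<lambda>i. RT c (\<lambda>x. G x i) l) = (\<lambda>i. RT c (\<lambda>x. app I X (G x) i) l)"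
  by (cases l) (simp add: RT_def app_lincomb)

lemma app_LU: "app I X (\<lambda>i. LU (\<lambda>x. G x i) l) = (\<lambda>i. LU (\<lambda>x. app I X (G x) i) l)"
  by (cases l) (simp add: LU_def app_scale)

lemma app_RU: "app I X (\<lambda>i. RU (\<lambda>x. G x i) l) = (\<lambda>i. RU (\<lambda>x. app I X (G x) i) l)"
  by (cases l) (simp add: RU_def app_scale)

definition cartan :: "'i set \<Rightarrow> 'i cmat \<Rightarrow> 'i cvec \<Rightarrow> 'i cvec" where
  "cartan I X v = (\<lambda>i. app I (adj X) (app I X v) i - app I X (app I (adj X) v) i)"

definition weight_t :: "irrep_class \<Rightarrow> triple \<Rightarrow> int" where
  "weight_t c = (\<lambda>(a, b, n). int (fst c) + 2 * int (snd c) - 2 * a - 2 * b + n)"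

definition weight_u :: "triple \<Rightarrow> int" where
  "weight_u = (\<lambda>(a, b, n). a + b - 2 * n)"

lemma cinner_cartan: "cinner I v (cartan I X w) = cinner I (cartan I X v) w"
proof -
  have diff: "cinner I v (\<lambda>i. f i - g i) = cinner I v f - cinner I v g"
    "cinner I (\<lambda>i. f i - g i) v = cinner I f v - cinner I g v" for v f g
    using cinner_lincomb_right[of I v 1 f "-1" g] cinner_lincomb_left[of I 1 f "-1" g v] by simp_all
  show ?thesis
    unfolding cartan_def diff by (simp add: cinner_adj)
qed

text \<open>
  An orthonormal basis \<open>F k l\<close> of \<open>hilb I\<close> on each of whose parts \<open>F k\<close>, indexed by the labels
  \<open>l\<close> of the class \<open>cl k\<close>, the matrices \<open>tm\<close> and \<open>um\<close> act as \<open>T\<^sub>-\<close> and \<open>U\<^sub>-\<close> do on a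
  Gelfand-Tsetlin basis.
\<close>

locale gt_system =
  fixes I :: "'i set" and tm um :: "'i cmat" and K :: "'k set" and cl :: "'k \<Rightarrow> irrep_class"
    and F :: "'k \<Rightarrow> triple \<Rightarrow> 'i cvec"
  assumes finite_index: "finite I" and finite_parts: "finite K"
    and in_hilb: "k \<in> K \<Longrightarrow> F k l \<in> hilb I"
    and outside: "k \<in> K \<Longrightarrow> l \<notin> triples (cl k) \<Longrightarrow> F k l i = 0"
    and orthonormal: "\<lbrakk>k \<in> K; k' \<in> K; l \<in> triples (cl k); l' \<in> triples (cl k')\<rbrakk> \<Longrightarrow>
      cinner I (F k l) (F k' l') = (if k = k' \<and> l = l' then 1 else 0)"
    and complete: "\<lbrakk>i \<in> I; j \<in> I\<rbrakk> \<Longrightarrow>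
      (\<Sum>k\<in>K. \<Sum>l\<in>triples (cl k). F k l i * cnj (F k l j)) = (if i = j then 1 else 0)"
    and lower_t: "\<lbrakk>k \<in> K; l \<in> triples (cl k)\<rbrakk> \<Longrightarrow> app I tm (F k l) = (\<lambda>i. LT (cl k) (\<lambda>x. F k x i) l)"
    and lower_u: "\<lbrakk>k \<in> K; l \<in> triples (cl k)\<rbrakk> \<Longrightarrow> app I um (F k l) = (\<lambda>i. LU (\<lambda>x. F k x i) l)"
begin

lemma expand:
  assumes "v \<in> hilb I"
  shows "v = (\<lambda>i. \<Sum>k\<in>K. \<Sum>l\<in>triples (cl k). cinner I (F k l) v * F k l i)"
proof
  fix i
  show "v i = (\<Sum>k\<in>K. \<Sum>l\<in>triples (cl k). cinner I (F k l) v * F k l i)"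
  proof (cases "i \<in> I")
    case True
    have "v i = (\<Sum>j\<in>I. if i = j then v j else 0)"
      using True finite_index by simp
    also have "\<dots> = (\<Sum>j\<in>I. (\<Sum>k\<in>K. \<Sum>l\<in>triples (cl k). F k l i * cnj (F k l j)) * v j)"
      using True by (intro sum.cong refl) (simp add: complete)
    also have "\<dots> = (\<Sum>j\<in>I. \<Sum>k\<in>K. \<Sum>l\<in>triples (cl k). cnj (F k l j) * v j * F k l i)"
      by (simp add: sum_distrib_right sum_distrib_left mult_ac)
    also have "\<dots> = (\<Sum>k\<in>K. \<Sum>j\<in>I. \<Sum>l\<in>triples (cl k). cnj (F k l j) * v j * F k l i)"
      by (rule sum.swap)
    also have "\<dots> = (\<Sum>k\<in>K. \<Sum>l\<in>triples (cl k). \<Sum>j\<in>I. cnj (F k l j) * v j * F k l i)"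
      by (intro sum.cong refl sum.swap)
    finally show ?thesis by (simp add: cinner_def sum_distrib_right)
  next
    case False
    then show ?thesis using assms in_hilb by (simp add: hilb_def)
  qed
qed

lemma eq_by_coordinates:
  assumes "v \<in> hilb I" "w \<in> hilb I"
    and "\<And>k l. k \<in> K \<Longrightarrow> l \<in> triples (cl k) \<Longrightarrow> cinner I (F k l) v = cinner I (F k l) w"
  shows "v = w"
  by (subst expand[OF assms(1)], subst expand[OF assms(2)]) (simp add: assms(3))

lemma orthonormal':
  assumes "k \<in> K" "k' \<in> K"
  shows "cinner I (F k l) (F k' l') = (if k = k' \<and> l = l' \<and> l \<in> triples (cl k) then 1 else 0)"
proof (cases "l \<in> triples (cl k) \<and> l' \<in> triples (cl k')")
  case True
  then show ?thesis using orthonormal[OF assms] by auto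
next
  case False
  then have "F k l = (\<lambda>i. 0) \<or> F k' l' = (\<lambda>i. 0)" using outside assms by blast
  then show ?thesis using False by auto
qed

lemma raise_t:
  assumes k: "k \<in> K" and l: "l \<in> triples (cl k)"
  shows "app I (adj tm) (F k l) = (\<lambda>i. RT (cl k) (\<lambda>x. F k x i) l)"
proof (rule eq_by_coordinates)
  show "(\<lambda>i. RT (cl k) (\<lambda>x. F k x i) l) \<in> hilb I"
    using in_hilb[OF k] by (cases l) (auto simp: RT_def hilb_def)
  fix k' l' assume k': "k' \<in> K" "l' \<in> triples (cl k')"
  have "cinner I (F k' l') (app I (adj tm) (F k l)) = LT (cl k') (\<lambda>x. cinner I (F k' x) (F k l)) l'"
    by (simp add: cinner_adj lower_t[OF k'] cinner_LT)
  also have "\<dots> = RT (cl k) (\<lambda>x. cinner I (F k' l') (F k x)) l"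
    unfolding orthonormal'[OF k'(1) k] using k' l
    by (cases l; cases l'; cases "k' = k") (auto simp: LT_def RT_def)
  finally show "cinner I (F k' l') (app I (adj tm) (F k l)) = cinner I (F k' l') (\<lambda>i. RT (cl k) (\<lambda>x. F k x i) l)"
    by (simp add: cinner_RT)
qed (rule app_hilb)

lemma raise_u:
  assumes k: "k \<in> K" and l: "l \<in> triples (cl k)"
  shows "app I (adj um) (F k l) = (\<lambda>i. RU (\<lambda>x. F k x i) l)"
proof (rule eq_by_coordinates)
  show "(\<lambda>i. RU (\<lambda>x. F k x i) l) \<in> hilb I"
    using in_hilb[OF k] by (cases l) (auto simp: RU_def hilb_def)
  fix k' l' assume k': "k' \<in> K" "l' \<in> triples (cl k')"
  have "cinner I (F k' l') (app I (adj um) (F k l)) = LU (\<lambda>x. cinner I (F k' x) (F k l)) l'"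
    by (simp add: cinner_adj lower_u[OF k'] cinner_LU)
  also have "\<dots> = RU (\<lambda>x. cinner I (F k' l') (F k x)) l"
    unfolding orthonormal'[OF k'(1) k] using k' l
    by (cases l; cases l'; cases "k' = k") (auto simp: LU_def RU_def)
  finally show "cinner I (F k' l') (app I (adj um) (F k l)) = cinner I (F k' l') (\<lambda>i. RU (\<lambda>x. F k x i) l)"
    by (simp add: cinner_RU)
qed (rule app_hilb)

lemma cartan_t:
  assumes "k \<in> K" and l: "l \<in> triples (cl k)"
  shows "cartan I tm (F k l) = (\<lambda>i. of_int (weight_t (cl k) l) * F k l i)"
proof
  fix i
  have "app I (adj tm) (app I tm (F k l)) i = LT (cl k) (RT (cl k) (\<lambda>x. F k x i)) l"
    unfolding lower_t[OF assms] app_LT using assms by (intro LT_cong[OF l]) (simp add: raise_t)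
  moreover have "app I tm (app I (adj tm) (F k l)) i = RT (cl k) (LT (cl k) (\<lambda>x. F k x i)) l"
    unfolding raise_t[OF assms] app_RT using assms by (intro RT_cong[OF l]) (simp add: lower_t)
  ultimately show "cartan I tm (F k l) i = of_int (weight_t (cl k) l) * F k l i"
    by (simp add: cartan_def LT_RT_commutator[OF l] weight_t_def)
qed

lemma cartan_u:
  assumes "k \<in> K" and l: "l \<in> triples (cl k)"
  shows "cartan I um (F k l) = (\<lambda>i. of_int (weight_u l) * F k l i)"
proof
  fix i
  have "app I (adj um) (app I um (F k l)) i = LU (RU (\<lambda>x. F k x i)) l"
    unfolding lower_u[OF assms] app_LU using assms by (intro LU_cong[OF l]) (simp add: raise_u)
  moreover have "app I um (app I (adj um) (F k l)) i = RU (LU (\<lambda>x. F k x i)) l"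
    unfolding raise_u[OF assms] app_RU using assms by (intro RU_cong[OF l]) (simp add: lower_u)
  ultimately show "cartan I um (F k l) i = of_int (weight_u l) * F k l i"
    by (simp add: cartan_def LU_RU_commutator[OF l] weight_u_def)
qed

end

lemma app_add: "app I X (\<lambda>i. f i + g i) = (\<lambda>i. app I X f i + app I X g i)"
  using app_lincomb[of I X 1 f 1 g] by simp

lemma app_diff: "app I X (\<lambda>i. f i - g i) = (\<lambda>i. app I X f i - app I X g i)"
  using app_lincomb[of I X 1 f "-1" g] by simp

section \<open>Schur's lemma\<close>

locale gt_intertwiner =
  S: gt_system I tm um K cl F + S': gt_system J tm' um' K' cl' G
  for I :: "'i set" and tm um and K :: "'k set" and cl F
    and J :: "'j set" and tm' um' and K' :: "'l set" and cl' G +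
  fixes \<Phi> :: "'i cvec \<Rightarrow> 'j cvec"
  assumes \<Phi>_hilb: "\<Phi> v \<in> hilb J"
    and \<Phi>_lincomb: "\<Phi> (\<lambda>i. x * v i + y * w i) = (\<lambda>j. x * \<Phi> v j + y * \<Phi> w j)"
    and \<Phi>_tm: "v \<in> hilb I \<Longrightarrow> \<Phi> (app I tm v) = app J tm' (\<Phi> v)"
    and \<Phi>_um: "v \<in> hilb I \<Longrightarrow> \<Phi> (app I um v) = app J um' (\<Phi> v)"
    and \<Phi>_tp: "v \<in> hilb I \<Longrightarrow> \<Phi> (app I (adj tm) v) = app J (adj tm') (\<Phi> v)"
    and \<Phi>_up: "v \<in> hilb I \<Longrightarrow> \<Phi> (app I (adj um) v) = app J (adj um') (\<Phi> v)"
begin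

lemma \<Phi>_scale: "\<Phi> (\<lambda>i. x * v i) = (\<lambda>j. x * \<Phi> v j)"
  using \<Phi>_lincomb[of x v 0 v] by simp

lemma \<Phi>_zero: "\<Phi> (\<lambda>i. 0) = (\<lambda>j. 0)"
  using \<Phi>_scale[of 0 "\<lambda>i. 0"] by simp

lemma \<Phi>_LT: "\<Phi> (\<lambda>i. LT c (\<lambda>x. f x i) l) = (\<lambda>j. LT c (\<lambda>x. \<Phi> (f x) j) l)"
  by (cases l) (simp add: LT_def \<Phi>_lincomb)

lemma \<Phi>_LU: "\<Phi> (\<lambda>i. LU (\<lambda>x. f x i) l) = (\<lambda>j. LU (\<lambda>x. \<Phi> (f x) j) l)"
  by (cases l) (simp add: LU_def \<Phi>_scale)

lemma \<Phi>_cartan: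
  assumes "v \<in> hilb I"
  shows "\<Phi> (cartan I tm v) = cartan J tm' (\<Phi> v)" "\<Phi> (cartan I um v) = cartan J um' (\<Phi> v)"
  using \<Phi>_lincomb[of 1 _ "-1"] assms
  by (simp_all add: cartan_def \<Phi>_tm \<Phi>_um \<Phi>_tp \<Phi>_up app_hilb)

lemma top_coordinates:
  assumes k: "k \<in> K" and k': "k' \<in> K'" and nz: "cinner J (G k' l') (\<Phi> (F k (top_label (cl k)))) \<noteq> 0"
  shows "l' = top_label (cl' k')" "cl' k' = cl k"
proof -
  let ?top = "top_label (cl k)"
  define D where "D x = cinner J (G k' x) (\<Phi> (F k ?top))" for x
  note Ft = S.in_hilb[OF k]
  have "app I (adj tm) (F k ?top) = (\<lambda>i. 0)" "app I (adj um) (F k ?top) = (\<lambda>i. 0)"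
    unfolding S.raise_t[OF k top_label_in_triples] S.raise_u[OF k top_label_in_triples]
    by (simp_all add: RT_def RU_def top_label_def S.outside[OF k] triples_def)
  then have up: "app J (adj tm') (\<Phi> (F k ?top)) = (\<lambda>j. 0)" "app J (adj um') (\<Phi> (F k ?top)) = (\<lambda>j. 0)"
    using \<Phi>_tp[OF Ft] \<Phi>_up[OF Ft] \<Phi>_zero by metis+
  have out: "D x = 0" if "x \<notin> triples (cl' k')" for x
    using S'.outside[OF k' that] by (simp add: D_def cinner_def)
  have low_t: "LT (cl' k') D x = 0" if "x \<in> triples (cl' k')" for x
  proof -
    have "LT (cl' k') D x = cinner J (app J tm' (G k' x)) (\<Phi> (F k ?top))"
      unfolding S'.lower_t[OF k' that] cinner_LT D_def ..
    also have "\<dots> = cinner J (G k' x) (app J (adj tm') (\<Phi> (F k ?top)))"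
      by (simp add: cinner_adj)
    finally show ?thesis by (simp add: up)
  qed
  have low_u: "LU D x = 0" if "x \<in> triples (cl' k')" for x
  proof -
    have "LU D x = cinner J (app J um' (G k' x)) (\<Phi> (F k ?top))"
      unfolding S'.lower_u[OF k' that] cinner_LU D_def ..
    also have "\<dots> = cinner J (G k' x) (app J (adj um') (\<Phi> (F k ?top)))"
      by (simp add: cinner_adj)
    finally show ?thesis by (simp add: up)
  qed
  show l': "l' = top_label (cl' k')"
    using lowering_kernel[of "cl' k'" D l', OF out low_t low_u] nz by (auto simp: D_def)
  have "cinner J (G k' l') (cartan J tm' (\<Phi> (F k ?top))) = of_int (weight_t (cl' k') l') * D l'"
    unfolding cinner_cartan l' S'.cartan_t[OF k' top_label_in_triples] by (simp add: cinner_scale D_def)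
  moreover have "cartan J tm' (\<Phi> (F k ?top)) = (\<lambda>j. of_int (weight_t (cl k) ?top) * \<Phi> (F k ?top) j)"
    unfolding \<Phi>_cartan(1)[OF Ft, symmetric] S.cartan_t[OF k top_label_in_triples] \<Phi>_scale ..
  ultimately have "of_int (weight_t (cl k) ?top) * D l' = of_int (weight_t (cl' k') l') * D l'"
    by (simp add: cinner_scale D_def)
  then have p: "fst (cl k) = fst (cl' k')"
    using nz by (simp add: D_def weight_t_def l' top_label_def)
  have "cinner J (G k' l') (cartan J um' (\<Phi> (F k ?top))) = of_int (weight_u l') * D l'"
    unfolding cinner_cartan l' S'.cartan_u[OF k' top_label_in_triples] by (simp add: cinner_scale D_def)
  moreover have "cartan J um' (\<Phi> (F k ?top)) = (\<lambda>j. of_int (weight_u ?top) * \<Phi> (F k ?top) j)"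
    unfolding \<Phi>_cartan(2)[OF Ft, symmetric] S.cartan_u[OF k top_label_in_triples] \<Phi>_scale ..
  ultimately have "of_int (weight_u ?top) * D l' = of_int (weight_u l') * D l'"
    by (simp add: cinner_scale D_def)
  then have "snd (cl k) = snd (cl' k')"
    using nz by (simp add: D_def weight_u_def l' top_label_def)
  then show "cl' k' = cl k" using p by (simp add: prod_eq_iff)
qed

theorem schur:
  assumes k: "k \<in> K"
  shows "\<Phi> (F k l) = (\<lambda>j. \<Sum>k'\<in>{k' \<in> K'. cl' k' = cl k}.
    cinner J (G k' (top_label (cl k))) (\<Phi> (F k (top_label (cl k)))) * G k' l j)"
proof -
  let ?top = "top_label (cl k)"
  let ?P = "{k' \<in> K'. cl' k' = cl k}"
  define \<mu> where "\<mu> k' = cinner J (G k' ?top) (\<Phi> (F k ?top))" for k'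
  define d where "d l j = \<Phi> (F k l) j - (\<Sum>k'\<in>?P. \<mu> k' * G k' l j)" for l j
  have app_d: "app J X (d l) = (\<lambda>j. app J X (\<Phi> (F k l)) j - (\<Sum>k'\<in>?P. \<mu> k' * app J X (G k' l) j))" for X l
    unfolding d_def app_diff app_sum ..
  have "d l = (\<lambda>j. 0)"
  proof (rule lowering_generates[of "cl k" d J tm' um'])
    fix l j assume l: "l \<notin> triples (cl k)"
    then have "F k l = (\<lambda>i. 0)" using S.outside[OF k] by blast
    moreover have "G k' l j = 0" if "k' \<in> ?P" for k' using that l S'.outside by auto
    ultimately show "d l j = 0" by (simp add: d_def \<Phi>_zero)
  next
    fix l assume l: "l \<in> triples (cl k)"
    have 1: "app J tm' (\<Phi> (F k l)) = (\<lambda>j. LT (cl k) (\<lambda>x. \<Phi> (F k x) j) l)"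
      unfolding \<Phi>_tm[OF S.in_hilb[OF k], symmetric] S.lower_t[OF k l] \<Phi>_LT ..
    have 2: "(\<Sum>k'\<in>?P. \<mu> k' * app J tm' (G k' l) j) = (\<Sum>k'\<in>?P. \<mu> k' * LT (cl k) (\<lambda>x. G k' x j) l)" for j
      using l by (intro sum.cong refl) (auto simp: S'.lower_t)
    show "app J tm' (d l) = (\<lambda>j. LT (cl k) (\<lambda>x. d x j) l)"
      unfolding app_d 1 2
      by (cases l) (simp add: LT_def d_def algebra_simps sum.distrib sum_distrib_left)
    have 1: "app J um' (\<Phi> (F k l)) = (\<lambda>j. LU (\<lambda>x. \<Phi> (F k x) j) l)"
      unfolding \<Phi>_um[OF S.in_hilb[OF k], symmetric] S.lower_u[OF k l] \<Phi>_LU ..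
    have 2: "(\<Sum>k'\<in>?P. \<mu> k' * app J um' (G k' l) j) = (\<Sum>k'\<in>?P. \<mu> k' * LU (\<lambda>x. G k' x j) l)" for j
      using l by (intro sum.cong refl) (auto simp: S'.lower_u)
    show "app J um' (d l) = (\<lambda>j. LU (\<lambda>x. d x j) l)"
      unfolding app_d 1 2
      by (cases l) (simp add: LU_def d_def algebra_simps sum_distrib_left)
  next
    have "\<Phi> (F k ?top) j = (\<Sum>k'\<in>?P. \<mu> k' * G k' ?top j)" for j
    proof -
      have "\<Phi> (F k ?top) j = (\<Sum>k'\<in>K'. \<Sum>l\<in>triples (cl' k'). cinner J (G k' l) (\<Phi> (F k ?top)) * G k' l j)"
        by (rule fun_cong[OF S'.expand[OF \<Phi>_hilb]])
      also have "\<dots> = (\<Sum>k'\<in>K'. if cl' k' = cl k then \<mu> k' * G k' ?top j else 0)"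
      proof (rule sum.cong[OF refl])
        fix k' assume k': "k' \<in> K'"
        have "(\<Sum>l\<in>triples (cl' k'). cinner J (G k' l) (\<Phi> (F k ?top)) * G k' l j)
          = (\<Sum>l\<in>triples (cl' k'). if l = top_label (cl' k') then cinner J (G k' l) (\<Phi> (F k ?top)) * G k' l j else 0)"
          using top_coordinates(1)[OF k k'] by (intro sum.cong refl) auto
        also have "\<dots> = cinner J (G k' (top_label (cl' k'))) (\<Phi> (F k ?top)) * G k' (top_label (cl' k')) j"
          using top_label_in_triples finite_triples by simp
        also have "\<dots> = (if cl' k' = cl k then \<mu> k' * G k' ?top j else 0)"
          using top_coordinates(2)[OF k k', of "top_label (cl' k')"] by (auto simp: \<mu>_def)
        finally show "(\<Sum>l\<in>triples (cl' k'). cinner J (G k' l) (\<Phi> (F k ?top)) * G k' l j)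
          = (if cl' k' = cl k then \<mu> k' * G k' ?top j else 0)" .
      qed
      finally show ?thesis by (simp add: sum.inter_filter[OF S'.finite_parts])
    qed
    then show "d ?top = (\<lambda>j. 0)" by (simp add: d_def fun_eq_iff)
  qed
  then show ?thesis by (simp add: d_def \<mu>_def fun_eq_iff)
qed

end

section \<open>Tensor products\<close>

definition tens :: "'i cmat \<Rightarrow> 'j cmat \<Rightarrow> ('i \<times> 'j) cmat" where
  "tens X Y = (\<lambda>x y. (if snd x = snd y then X (fst x) (fst y) else 0) +
     (if fst x = fst y then Y (snd x) (snd y) else 0))"

lemma adj_tens: "adj (tens X Y) = tens (adj X) (adj Y)"
  by (auto simp: adj_def tens_def fun_eq_iff)

lemma app_tens:
  assumes "finite I" "finite J" "(i, j) \<in> I \<times> J"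
  shows "app (I \<times> J) (tens X Y) A (i, j) = (\<Sum>k\<in>I. X i k * A (k, j)) + (\<Sum>k\<in>J. Y j k * A (i, k))"
proof -
  have "app (I \<times> J) (tens X Y) A (i, j) =
    (\<Sum>k\<in>I. \<Sum>l\<in>J. (if j = l then X i k * A (k, l) else 0) + (if i = k then Y j l * A (k, l) else 0))"
    unfolding app_def tens_def sum.cartesian_product[symmetric] using assms
    by (auto simp: sum.cartesian_product algebra_simps intro!: sum.cong)
  also have "\<dots> = (\<Sum>k\<in>I. X i k * A (k, j)) + (\<Sum>k\<in>I. if i = k then \<Sum>l\<in>J. Y j l * A (k, l) else 0)"
    unfolding sum.distrib using assms by (intro arg_cong2[where f = "(+)"] sum.cong refl) auto
  also have "\<dots> = (\<Sum>k\<in>I. X i k * A (k, j)) + (\<Sum>k\<in>J. Y j k * A (i, k))"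
    using assms by simp
  finally show ?thesis .
qed

lemma tensor_vec_hilb: "v \<in> hilb I \<Longrightarrow> w \<in> hilb J \<Longrightarrow> tensor_vec v w \<in> hilb (I \<times> J)"
  by (auto simp: hilb_def tensor_vec_def)

lemma app_tens_tensor_vec:
  assumes fin: "finite I" "finite J" and v: "v \<in> hilb I" and w: "w \<in> hilb J"
  shows "app (I \<times> J) (tens X Y) (tensor_vec v w) =
    (\<lambda>x. tensor_vec (app I X v) w x + tensor_vec v (app J Y w) x)"
proof
  fix x :: "'a \<times> 'b"
  obtain i j where x: "x = (i, j)" by (cases x)
  show "app (I \<times> J) (tens X Y) (tensor_vec v w) x = tensor_vec (app I X v) w x + tensor_vec v (app J Y w) x"
  proof (cases "i \<in> I \<and> j \<in> J")
    case True
    then show ?thesis using fin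
      by (simp add: x app_tens) (simp add: tensor_vec_def app_def sum_distrib_left sum_distrib_right mult_ac)
  next
    case False
    then show ?thesis using v w by (auto simp: x tensor_vec_def app_def hilb_def)
  qed
qed

lemma cartan_tens:
  assumes "finite I" "finite J" and "v \<in> hilb I" and "w \<in> hilb J"
  shows "cartan (I \<times> J) (tens X Y) (tensor_vec v w) =
    (\<lambda>x. tensor_vec (cartan I X v) w x + tensor_vec v (cartan J Y w) x)"
  using assms
  by (simp add: cartan_def adj_tens app_tens_tensor_vec app_add app_hilb fun_eq_iff)
     (simp add: tensor_vec_def algebra_simps)

lemma cinner_tensor:
  "cinner (I \<times> J) (tensor_vec v w) (tensor_vec v' w') = cinner I v v' * cinner J w w'"
  unfolding cinner_def tensor_vec_def sum_product sum.cartesian_product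
  by (intro sum.cong refl) (auto simp: mult_ac)

section \<open>Selection rules\<close>

lemma cinner_add_right: "cinner I v (\<lambda>i. f i + g i) = cinner I v f + cinner I v g"
  using cinner_lincomb_right[of I v 1 f 1 g] by simp

lemma tensor_LU:
  "tensor_vec (\<lambda>i. LU (\<lambda>x. f x i) l) w = (\<lambda>y. LU (\<lambda>x. tensor_vec (f x) w y) l)"
  "tensor_vec v (\<lambda>i. LU (\<lambda>x. g x i) l) = (\<lambda>y. LU (\<lambda>x. tensor_vec v (g x) y) l)"
  by (cases l; simp add: LU_def tensor_vec_def fun_eq_iff)+

lemma tensor_RU:
  "tensor_vec (\<lambda>i. RU (\<lambda>x. f x i) l) w = (\<lambda>y. RU (\<lambda>x. tensor_vec (f x) w y) l)"
  "tensor_vec v (\<lambda>i. RU (\<lambda>x. g x i) l) = (\<lambda>y. RU (\<lambda>x. tensor_vec v (g x) y) l)"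
  by (cases l; simp add: RU_def tensor_vec_def fun_eq_iff)+

locale gt_coupling =
  A: gt_system I\<^sub>1 t\<^sub>1 u\<^sub>1 "{()}" "\<lambda>_. a\<^sub>1" "\<lambda>_. e\<^sub>1" +
  B: gt_system I\<^sub>2 t\<^sub>2 u\<^sub>2 "{()}" "\<lambda>_. a\<^sub>2" "\<lambda>_. e\<^sub>2" +
  C: gt_system "I\<^sub>1 \<times> I\<^sub>2" "tens t\<^sub>1 t\<^sub>2" "tens u\<^sub>1 u\<^sub>2" K cl F
  for I\<^sub>1 :: "'i set" and t\<^sub>1 u\<^sub>1 a\<^sub>1 e\<^sub>1
    and I\<^sub>2 :: "'j set" and t\<^sub>2 u\<^sub>2 a\<^sub>2 e\<^sub>2
    and K :: "'k set" and cl F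
begin

lemmas e\<^sub>1_hilb = A.in_hilb[OF singletonI] and e\<^sub>2_hilb = B.in_hilb[OF singletonI]

lemmas app_tensor = app_tens_tensor_vec[OF A.finite_index B.finite_index e\<^sub>1_hilb e\<^sub>2_hilb]

definition CG :: "'k \<Rightarrow> triple \<Rightarrow> triple \<Rightarrow> triple \<Rightarrow> complex" where
  "CG k l l\<^sub>1 l\<^sub>2 = cinner (I\<^sub>1 \<times> I\<^sub>2) (F k l) (tensor_vec (e\<^sub>1 l\<^sub>1) (e\<^sub>2 l\<^sub>2))"

lemma CG_outside:
  "k \<in> K \<Longrightarrow> l \<notin> triples (cl k) \<Longrightarrow> CG k l l\<^sub>1 l\<^sub>2 = 0"
  "l\<^sub>1 \<notin> triples a\<^sub>1 \<Longrightarrow> CG k l l\<^sub>1 l\<^sub>2 = 0"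
  "l\<^sub>2 \<notin> triples a\<^sub>2 \<Longrightarrow> CG k l l\<^sub>1 l\<^sub>2 = 0"
  using A.outside[OF singletonI] B.outside[OF singletonI]
  by (simp_all add: CG_def cinner_def tensor_vec_def C.outside)

lemma CG_lower:
  assumes k: "k \<in> K" and l: "l \<in> triples (cl k)" and l1: "l\<^sub>1 \<in> triples a\<^sub>1" and l2: "l\<^sub>2 \<in> triples a\<^sub>2"
  shows "LU (\<lambda>x. CG k l x l\<^sub>2) l\<^sub>1 + LU (\<lambda>x. CG k l l\<^sub>1 x) l\<^sub>2 = RU (\<lambda>x. CG k x l\<^sub>1 l\<^sub>2) l"
proof -
  have "LU (\<lambda>x. CG k l x l\<^sub>2) l\<^sub>1 + LU (\<lambda>x. CG k l l\<^sub>1 x) l\<^sub>2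
    = cinner (I\<^sub>1 \<times> I\<^sub>2) (F k l) (app (I\<^sub>1 \<times> I\<^sub>2) (tens u\<^sub>1 u\<^sub>2) (tensor_vec (e\<^sub>1 l\<^sub>1) (e\<^sub>2 l\<^sub>2)))"
    unfolding app_tensor A.lower_u[OF singletonI l1] B.lower_u[OF singletonI l2] tensor_LU
      cinner_add_right cinner_LU CG_def ..
  also have "\<dots> = RU (\<lambda>x. CG k x l\<^sub>1 l\<^sub>2) l"
    unfolding cinner_adj C.raise_u[OF k l] cinner_RU CG_def ..
  finally show ?thesis .
qed

lemma CG_raise:
  assumes k: "k \<in> K" and l: "l \<in> triples (cl k)" and l1: "l\<^sub>1 \<in> triples a\<^sub>1" and l2: "l\<^sub>2 \<in> triples a\<^sub>2"
  shows "RU (\<lambda>x. CG k l x l\<^sub>2) l\<^sub>1 + RU (\<lambda>x. CG k l l\<^sub>1 x) l\<^sub>2 = LU (\<lambda>x. CG k x l\<^sub>1 l\<^sub>2) l"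
proof -
  have "RU (\<lambda>x. CG k l x l\<^sub>2) l\<^sub>1 + RU (\<lambda>x. CG k l l\<^sub>1 x) l\<^sub>2
    = cinner (I\<^sub>1 \<times> I\<^sub>2) (F k l) (app (I\<^sub>1 \<times> I\<^sub>2) (adj (tens u\<^sub>1 u\<^sub>2)) (tensor_vec (e\<^sub>1 l\<^sub>1) (e\<^sub>2 l\<^sub>2)))"
    unfolding adj_tens app_tensor A.raise_u[OF singletonI l1] B.raise_u[OF singletonI l2] tensor_RU
      cinner_add_right cinner_RU CG_def ..
  also have "\<dots> = LU (\<lambda>x. CG k x l\<^sub>1 l\<^sub>2) l"
    unfolding cinner_adj adj_adj C.lower_u[OF k l] cinner_LU CG_def ..
  finally show ?thesis .
qed

lemma CG_weight:
  assumes k: "k \<in> K" and l: "l \<in> triples (cl k)" and l1: "l\<^sub>1 \<in> triples a\<^sub>1" and l2: "l\<^sub>2 \<in> triples a\<^sub>2"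
    and nz: "CG k l l\<^sub>1 l\<^sub>2 \<noteq> 0"
  shows "weight_t (cl k) l = weight_t a\<^sub>1 l\<^sub>1 + weight_t a\<^sub>2 l\<^sub>2"
    and "weight_u l = weight_u l\<^sub>1 + weight_u l\<^sub>2"
proof -
  let ?e = "tensor_vec (e\<^sub>1 l\<^sub>1) (e\<^sub>2 l\<^sub>2)"
  note cart = cartan_tens[OF A.finite_index B.finite_index e\<^sub>1_hilb e\<^sub>2_hilb]
  have *: "of_int m = (of_int x :: complex) + of_int y"
    if "cartan (I\<^sub>1 \<times> I\<^sub>2) X ?e = (\<lambda>z. (of_int x + of_int y) * ?e z)"
      and "cartan (I\<^sub>1 \<times> I\<^sub>2) X (F k l) = (\<lambda>z. of_int m * F k l z)" for X x y m
    using cinner_cartan[of "I\<^sub>1 \<times> I\<^sub>2" "F k l" X ?e] nz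
    unfolding that cinner_scale by (simp add: CG_def)
  have "cartan (I\<^sub>1 \<times> I\<^sub>2) (tens t\<^sub>1 t\<^sub>2) ?e = (\<lambda>z. (of_int (weight_t a\<^sub>1 l\<^sub>1) + of_int (weight_t a\<^sub>2 l\<^sub>2)) * ?e z)"
    unfolding cart A.cartan_t[OF singletonI l1] B.cartan_t[OF singletonI l2]
    by (simp add: tensor_vec_def algebra_simps)
  from *[OF this C.cartan_t[OF k l]]
  show "weight_t (cl k) l = weight_t a\<^sub>1 l\<^sub>1 + weight_t a\<^sub>2 l\<^sub>2"
    unfolding of_int_add[symmetric] of_int_eq_iff .
  have "cartan (I\<^sub>1 \<times> I\<^sub>2) (tens u\<^sub>1 u\<^sub>2) ?e = (\<lambda>z. (of_int (weight_u l\<^sub>1) + of_int (weight_u l\<^sub>2)) * ?e z)"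
    unfolding cart A.cartan_u[OF singletonI l1] B.cartan_u[OF singletonI l2]
    by (simp add: tensor_vec_def algebra_simps)
  from *[OF this C.cartan_u[OF k l]]
  show "weight_u l = weight_u l\<^sub>1 + weight_u l\<^sub>2"
    unfolding of_int_add[symmetric] of_int_eq_iff .
qed

lemma CG_triangle_sum:
  assumes k: "k \<in> K" and big: "b - a > (b\<^sub>1 - a\<^sub>1') + (b\<^sub>2 - a\<^sub>2')"
  shows "CG k (a, b, n) (a\<^sub>1', b\<^sub>1, n\<^sub>1) (a\<^sub>2', b\<^sub>2, n\<^sub>2) = 0"
proof (cases "a \<le> n")
  case True
  then show ?thesis
  proof (induction n arbitrary: n\<^sub>1 n\<^sub>2 rule: int_ge_induct)
    case base
    show ?case
    proof (rule ccontr)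
      assume nz: "CG k (a, b, a) (a\<^sub>1', b\<^sub>1, n\<^sub>1) (a\<^sub>2', b\<^sub>2, n\<^sub>2) \<noteq> 0"
      then have "(a, b, a) \<in> triples (cl k)" "(a\<^sub>1', b\<^sub>1, n\<^sub>1) \<in> triples a\<^sub>1" "(a\<^sub>2', b\<^sub>2, n\<^sub>2) \<in> triples a\<^sub>2"
        using CG_outside k by blast+
      from CG_weight(2)[OF k this nz] this big show False
        by (simp add: weight_u_def triples_def)
    qed
  next
    case (step m)
    show ?case
    proof (cases "(a, b, m + 1) \<in> triples (cl k) \<and> (a\<^sub>1', b\<^sub>1, n\<^sub>1) \<in> triples a\<^sub>1 \<and> (a\<^sub>2', b\<^sub>2, n\<^sub>2) \<in> triples a\<^sub>2")
      case True
      then have "(a, b, m) \<in> triples (cl k)" "m < b" using step.hyps by (auto simp: triples_def)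
      then show ?thesis
        using CG_raise[OF k, of "(a, b, m)" "(a\<^sub>1', b\<^sub>1, n\<^sub>1)" "(a\<^sub>2', b\<^sub>2, n\<^sub>2)"] True step.IH
          coeff_n_nonzero[OF step.hyps, of b]
        by (simp add: LU_def RU_def)
    next
      case False
      then show ?thesis using CG_outside k by blast
    qed
  qed
next
  case False
  then show ?thesis using CG_outside(1)[OF k, of "(a, b, n)"] by (auto simp: triples_def)
qed

lemma CG_triangle_fst:
  assumes k: "k \<in> K" and big: "b\<^sub>1 - a\<^sub>1' > (b - a) + (b\<^sub>2 - a\<^sub>2')"
  shows "CG k (a, b, n) (a\<^sub>1', b\<^sub>1, n\<^sub>1) (a\<^sub>2', b\<^sub>2, n\<^sub>2) = 0"
proof (cases "a\<^sub>1' \<le> n\<^sub>1")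
  case True
  then show ?thesis
  proof (induction n\<^sub>1 arbitrary: n n\<^sub>2 rule: int_ge_induct)
    case base
    show ?case
    proof (rule ccontr)
      assume nz: "CG k (a, b, n) (a\<^sub>1', b\<^sub>1, a\<^sub>1') (a\<^sub>2', b\<^sub>2, n\<^sub>2) \<noteq> 0"
      then have "(a, b, n) \<in> triples (cl k)" "(a\<^sub>1', b\<^sub>1, a\<^sub>1') \<in> triples a\<^sub>1" "(a\<^sub>2', b\<^sub>2, n\<^sub>2) \<in> triples a\<^sub>2"
        using CG_outside k by blast+
      from CG_weight(2)[OF k this nz] this big show False
        by (simp add: weight_u_def triples_def)
    qed
  next
    case (step m)
    show ?case
    proof (cases "(a, b, n) \<in> triples (cl k) \<and> (a\<^sub>1', b\<^sub>1, m + 1) \<in> triples a\<^sub>1 \<and> (a\<^sub>2', b\<^sub>2, n\<^sub>2) \<in> triples a\<^sub>2")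
      case True
      then have "(a\<^sub>1', b\<^sub>1, m) \<in> triples a\<^sub>1" "m < b\<^sub>1" using step.hyps by (auto simp: triples_def)
      then show ?thesis
        using CG_lower[OF k, of "(a, b, n)" "(a\<^sub>1', b\<^sub>1, m)" "(a\<^sub>2', b\<^sub>2, n\<^sub>2)"] True step.IH
          coeff_n_nonzero[OF step.hyps, of b\<^sub>1]
        by (simp add: LU_def RU_def)
    next
      case False
      then show ?thesis using CG_outside k by blast
    qed
  qed
next
  case False
  then show ?thesis using CG_outside(2)[of "(a\<^sub>1', b\<^sub>1, n\<^sub>1)"] by (auto simp: triples_def)
qed

lemma CG_triangle_snd:
  assumes k: "k \<in> K" and big: "b\<^sub>2 - a\<^sub>2' > (b - a) + (b\<^sub>1 - a\<^sub>1')"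
  shows "CG k (a, b, n) (a\<^sub>1', b\<^sub>1, n\<^sub>1) (a\<^sub>2', b\<^sub>2, n\<^sub>2) = 0"
proof (cases "a\<^sub>2' \<le> n\<^sub>2")
  case True
  then show ?thesis
  proof (induction n\<^sub>2 arbitrary: n n\<^sub>1 rule: int_ge_induct)
    case base
    show ?case
    proof (rule ccontr)
      assume nz: "CG k (a, b, n) (a\<^sub>1', b\<^sub>1, n\<^sub>1) (a\<^sub>2', b\<^sub>2, a\<^sub>2') \<noteq> 0"
      then have "(a, b, n) \<in> triples (cl k)" "(a\<^sub>1', b\<^sub>1, n\<^sub>1) \<in> triples a\<^sub>1" "(a\<^sub>2', b\<^sub>2, a\<^sub>2') \<in> triples a\<^sub>2"
        using CG_outside k by blast+
      from CG_weight(2)[OF k this nz] this big show False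
        by (simp add: weight_u_def triples_def)
    qed
  next
    case (step m)
    show ?case
    proof (cases "(a, b, n) \<in> triples (cl k) \<and> (a\<^sub>1', b\<^sub>1, n\<^sub>1) \<in> triples a\<^sub>1 \<and> (a\<^sub>2', b\<^sub>2, m + 1) \<in> triples a\<^sub>2")
      case True
      then have "(a\<^sub>2', b\<^sub>2, m) \<in> triples a\<^sub>2" "m < b\<^sub>2" using step.hyps by (auto simp: triples_def)
      then show ?thesis
        using CG_lower[OF k, of "(a, b, n)" "(a\<^sub>1', b\<^sub>1, n\<^sub>1)" "(a\<^sub>2', b\<^sub>2, m)"] True step.IH
          coeff_n_nonzero[OF step.hyps, of b\<^sub>2]
        by (simp add: LU_def RU_def)
    next
      case False
      then show ?thesis using CG_outside k by blast
    qed
  qed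
next
  case False
  then show ?thesis using CG_outside(3)[of "(a\<^sub>2', b\<^sub>2, n\<^sub>2)"] by (auto simp: triples_def)
qed

lemma tensor_expand:
  assumes v: "v \<in> hilb (I\<^sub>1 \<times> I\<^sub>2)"
  shows "v = (\<lambda>x. \<Sum>l\<^sub>1\<in>triples a\<^sub>1. \<Sum>l\<^sub>2\<in>triples a\<^sub>2.
    cinner (I\<^sub>1 \<times> I\<^sub>2) (tensor_vec (e\<^sub>1 l\<^sub>1) (e\<^sub>2 l\<^sub>2)) v * tensor_vec (e\<^sub>1 l\<^sub>1) (e\<^sub>2 l\<^sub>2) x)"
proof
  fix x :: "'i \<times> 'j"
  obtain i j where x: "x = (i, j)" by (cases x)
  have hilb2: "(\<lambda>j. v (i, j)) \<in> hilb I\<^sub>2" and hilb1: "(\<lambda>i. cinner I\<^sub>2 w (\<lambda>j. v (i, j))) \<in> hilb I\<^sub>1" for i w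
    using v by (auto simp: hilb_def cinner_def)
  have nested: "cinner (I\<^sub>1 \<times> I\<^sub>2) (tensor_vec (e\<^sub>1 l\<^sub>1) (e\<^sub>2 l\<^sub>2)) v =
      cinner I\<^sub>1 (e\<^sub>1 l\<^sub>1) (\<lambda>i. cinner I\<^sub>2 (e\<^sub>2 l\<^sub>2) (\<lambda>j. v (i, j)))" for l\<^sub>1 l\<^sub>2
    unfolding cinner_def tensor_vec_def sum_distrib_left sum.cartesian_product
    by (intro sum.cong refl) (auto simp: mult_ac)
  have "v x = (\<Sum>l\<^sub>2\<in>triples a\<^sub>2. cinner I\<^sub>2 (e\<^sub>2 l\<^sub>2) (\<lambda>j. v (i, j)) * e\<^sub>2 l\<^sub>2 j)"
    using fun_cong[OF B.expand[OF hilb2], of i j] by (simp add: x)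
  also have "\<dots> = (\<Sum>l\<^sub>2\<in>triples a\<^sub>2. (\<Sum>l\<^sub>1\<in>triples a\<^sub>1. cinner (I\<^sub>1 \<times> I\<^sub>2) (tensor_vec (e\<^sub>1 l\<^sub>1) (e\<^sub>2 l\<^sub>2)) v * e\<^sub>1 l\<^sub>1 i) * e\<^sub>2 l\<^sub>2 j)"
    using fun_cong[OF A.expand[OF hilb1], of _ i] by (simp add: nested)
  also have "\<dots> = (\<Sum>l\<^sub>1\<in>triples a\<^sub>1. \<Sum>l\<^sub>2\<in>triples a\<^sub>2.
    cinner (I\<^sub>1 \<times> I\<^sub>2) (tensor_vec (e\<^sub>1 l\<^sub>1) (e\<^sub>2 l\<^sub>2)) v * tensor_vec (e\<^sub>1 l\<^sub>1) (e\<^sub>2 l\<^sub>2) x)"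
    unfolding sum_distrib_right by (subst sum.swap) (simp add: tensor_vec_def x mult.assoc)
  finally show "v x = (\<Sum>l\<^sub>1\<in>triples a\<^sub>1. \<Sum>l\<^sub>2\<in>triples a\<^sub>2.
    cinner (I\<^sub>1 \<times> I\<^sub>2) (tensor_vec (e\<^sub>1 l\<^sub>1) (e\<^sub>2 l\<^sub>2)) v * tensor_vec (e\<^sub>1 l\<^sub>1) (e\<^sub>2 l\<^sub>2) x)" .
qed

end

section \<open>Gelfand-Tsetlin bases as coordinate systems\<close>

interpretation csc: vector_space "csc :: complex \<Rightarrow> 'i cvec \<Rightarrow> 'i cvec"
  by (rule vector_space_csc)

lemma orthonormal_set_bound:
  assumes fin: "finite I" "finite L"
    and on: "\<And>l l'. l \<in> L \<Longrightarrow> l' \<in> L \<Longrightarrow> cinner I (b l) (b l') = (if l = l' then 1 else 0)"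
  shows "card L \<le> card I"
proof -
  have bessel: "(\<Sum>l\<in>L. (norm (b l i))\<^sup>2) \<le> 1" if i: "i \<in> I" for i
  proof -
    define e where "e j = (if j = i then 1 else 0 :: complex)" for j
    define S where "S j = (\<Sum>l\<in>L. cnj (b l i) * b l j)" for j
    define s where "s = (\<Sum>l\<in>L. (norm (b l i))\<^sup>2)"
    have e: "cinner I f e = cnj (f i)" "cinner I e f = f i" for f
      using fin(1) i by (simp_all add: cinner_def e_def if_distrib[of cnj] if_distribR mult.commute
          if_distrib[where f = "(*) _"] cong: if_cong)
    have s: "complex_of_real s = (\<Sum>l\<in>L. cnj (b l i) * b l i)"
      unfolding s_def of_real_sum by (intro sum.cong refl) (metis complex_norm_square mult.commute)
    have bS: "cinner I (b l) S = cnj (b l i)" if "l \<in> L" for l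
    proof -
      have "cinner I (b l) S = (\<Sum>l'\<in>L. cnj (b l' i) * (if l = l' then 1 else 0))"
        unfolding S_def cinner_sum_right using that by (intro sum.cong refl) (simp add: on)
      also have "\<dots> = (\<Sum>l'\<in>L. if l = l' then cnj (b l' i) else 0)"
        by (intro sum.cong refl) simp
      finally show ?thesis using that fin(2) by simp
    qed
    have "cinner I S S = (\<Sum>l\<in>L. b l i * cinner I (b l) S)"
      unfolding S_def[abs_def] cinner_sum_left by simp
    also have "\<dots> = of_real s"
      unfolding s by (intro sum.cong refl) (simp add: bS mult.commute)
    finally have SS: "cinner I S S = of_real s" .
    have Si: "S i = of_real s" by (simp add: S_def s)
    have "cinner I (\<lambda>j. 1 * e j + (-1) * S j) (\<lambda>j. 1 * e j + (-1) * S j) = 1 - of_real s"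
      unfolding cinner_lincomb_left cinner_lincomb_right by (simp add: e SS Si) (simp add: e_def)
    moreover have "cinner I v v = of_real (\<Sum>j\<in>I. (norm (v j))\<^sup>2)" for v
      unfolding cinner_def of_real_sum by (intro sum.cong refl) (metis complex_norm_square mult.commute)
    ultimately have "complex_of_real (1 - s) = of_real (\<Sum>j\<in>I. (norm (1 * e j + (-1) * S j))\<^sup>2)"
      by simp
    then have "1 - s = (\<Sum>j\<in>I. (norm (1 * e j + (-1) * S j))\<^sup>2)"
      unfolding of_real_eq_iff .
    also have "\<dots> \<ge> 0" by (intro sum_nonneg) simp
    finally show ?thesis by (simp add: s_def)
  qed
  have "real (card L) = (\<Sum>l\<in>L. \<Sum>i\<in>I. (norm (b l i))\<^sup>2)"
  proof -
    have "(\<Sum>i\<in>I. (norm (b l i))\<^sup>2) = 1" if "l \<in> L" for l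
    proof -
      have "complex_of_real (\<Sum>i\<in>I. (norm (b l i))\<^sup>2) = cinner I (b l) (b l)"
        unfolding cinner_def of_real_sum by (intro sum.cong refl) (metis complex_norm_square mult.commute)
      then show ?thesis using on[OF that that] by (metis of_real_eq_1_iff)
    qed
    then show ?thesis by simp
  qed
  also have "\<dots> = (\<Sum>i\<in>I. \<Sum>l\<in>L. (norm (b l i))\<^sup>2)" by (rule sum.swap)
  also have "\<dots> \<le> (\<Sum>i\<in>I. 1)" by (intro sum_mono bessel)
  finally show ?thesis by simp
qed

lemma orthonormal_basis_finite:
  assumes "finite I" "orthonormal_basis_of I W L b"
  shows "finite L"
proof (rule ccontr)
  assume "infinite L"
  then obtain L' where L': "L' \<subseteq> L" "finite L'" "card L' = card I + 1"
    using infinite_arbitrarily_large by blast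
  have "card L' \<le> card I"
    using assms L' by (intro orthonormal_set_bound[where b = b]) (simp_all add: orthonormal_basis_of_def subset_iff)
  then show False using L' by simp
qed

lemma orthonormal_basis_complete:
  assumes fin: "finite I" and b: "orthonormal_basis_of I (hilb I) L b" and ij: "i \<in> I" "j \<in> I"
  shows "(\<Sum>l\<in>L. b l i * cnj (b l j)) = (if i = j then 1 else 0)"
proof -
  have finL: "finite L" by (rule orthonormal_basis_finite[OF fin b])
  define P where "P = {v :: 'a cvec. \<forall>i. v i = (\<Sum>l\<in>L. cinner I (b l) v * b l i)}"
  have "b ` L \<subseteq> P"
  proof (clarsimp simp: P_def)
    fix l i assume l: "l \<in> L"
    have "(\<Sum>l'\<in>L. cinner I (b l') (b l) * b l' i) = (\<Sum>l'\<in>L. if l' = l then b l' i else 0)"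
      using b l by (intro sum.cong refl) (simp add: orthonormal_basis_of_def)
    then show "b l i = (\<Sum>l'\<in>L. cinner I (b l') (b l) * b l' i)"
      using l finL by simp
  qed
  moreover have "csubspace P"
  proof (rule csc.subspaceI)
    show "0 \<in> P" by (simp add: P_def cinner_def)
  next
    fix v w assume "v \<in> P" "w \<in> P"
    then show "v + w \<in> P"
      using cinner_lincomb_right[of I _ 1 v 1 w]
      by (simp add: P_def plus_fun_def distrib_right sum.distrib)
  next
    fix c v assume "v \<in> P"
    then have v: "\<And>i. v i = (\<Sum>l\<in>L. cinner I (b l) v * b l i)" by (simp add: P_def)
    have "c * v i = (\<Sum>l\<in>L. c * cinner I (b l) v * b l i)" for i
      using arg_cong[OF v, of "(*) c"] by (simp add: sum_distrib_left mult.assoc)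
    then show "csc c v \<in> P"
      unfolding P_def csc_def mem_Collect_eq cinner_scale by blast
  qed
  ultimately have "cspan (b ` L) \<subseteq> P" by (rule csc.span_minimal)
  then have hilb: "hilb I \<subseteq> P" using b by (simp add: orthonormal_basis_of_def)
  define e where "e x = (if x = j then 1 else 0 :: complex)" for x
  have "e \<in> P" using hilb ij by (auto simp: hilb_def e_def)
  moreover have "cinner I f e = cnj (f j)" for f
    using fin ij by (simp add: cinner_def e_def if_distrib[where f = "(*) _"] cong: if_cong)
  ultimately have "e i = (\<Sum>l\<in>L. cnj (b l j) * b l i)" by (simp add: P_def)
  then show ?thesis by (simp add: e_def mult.commute)
qed

lemma orthonormal_basis_in_hilb:
  assumes "orthonormal_basis_of I (hilb I) L b" "l \<in> L"
  shows "b l \<in> hilb I"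
  using assms csc.span_base[of "b l" "b ` L"] by (auto simp: orthonormal_basis_of_def)

lemma gt_systemI:
  assumes fin: "finite I" and b: "orthonormal_basis_of I (hilb I) L b"
    and h: "bij_betw h (SIGMA k:K. triples (cl k)) L"
    and F: "\<And>k l. k \<in> K \<Longrightarrow> F k l = (if l \<in> triples (cl k) then b (h (k, l)) else (\<lambda>i. 0))"
    and lower_t: "\<And>k l. k \<in> K \<Longrightarrow> l \<in> triples (cl k) \<Longrightarrow> app I tm (F k l) = (\<lambda>i. LT (cl k) (\<lambda>x. F k x i) l)"
    and lower_u: "\<And>k l. k \<in> K \<Longrightarrow> l \<in> triples (cl k) \<Longrightarrow> app I um (F k l) = (\<lambda>i. LU (\<lambda>x. F k x i) l)"
  shows "gt_system I tm um K cl F"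
proof
  have "finite (SIGMA k:K. triples (cl k))"
    using orthonormal_basis_finite[OF fin b] h bij_betw_finite by blast
  then have "finite (fst ` (SIGMA k:K. triples (cl k)))" by simp
  moreover have "K \<subseteq> fst ` (SIGMA k:K. triples (cl k))"
  proof
    fix k assume "k \<in> K"
    then show "k \<in> fst ` (SIGMA k:K. triples (cl k))"
      using top_label_in_triples[of "cl k"] by (intro image_eqI[of _ _ "(k, top_label (cl k))"]) auto
  qed
  ultimately show finK: "finite K" by (rule finite_subset[rotated])
  have in_L: "h (k, l) \<in> L" if "k \<in> K" "l \<in> triples (cl k)" for k l
    using h that by (auto simp: bij_betw_def)
  show "F k l \<in> hilb I" if "k \<in> K" for k l
    using orthonormal_basis_in_hilb[OF b in_L] that by (auto simp: F hilb_def)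
  show "F k l i = 0" if "k \<in> K" "l \<notin> triples (cl k)" for k l i
    using that by (simp add: F)
  show "cinner I (F k l) (F k' l') = (if k = k' \<and> l = l' then 1 else 0)"
    if "k \<in> K" "k' \<in> K" "l \<in> triples (cl k)" "l' \<in> triples (cl k')" for k k' l l'
  proof -
    have "h (k, l) = h (k', l') \<longleftrightarrow> k = k' \<and> l = l'"
      using h that by (auto simp: bij_betw_def dest: inj_onD)
    then show ?thesis using b in_L that by (auto simp: F orthonormal_basis_of_def)
  qed
  show "(\<Sum>k\<in>K. \<Sum>l\<in>triples (cl k). F k l i * cnj (F k l j)) = (if i = j then 1 else 0)"
    if "i \<in> I" "j \<in> I" for i j
  proof -
    have "(\<Sum>k\<in>K. \<Sum>l\<in>triples (cl k). F k l i * cnj (F k l j))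
      = (\<Sum>x\<in>(SIGMA k:K. triples (cl k)). b (h x) i * cnj (b (h x) j))"
      using finK finite_triples by (subst sum.Sigma) (auto simp: F intro!: sum.cong)
    also have "\<dots> = (\<Sum>l\<in>L. b l i * cnj (b l j))"
      by (rule sum.reindex_bij_betw[OF h])
    finally show ?thesis using orthonormal_basis_complete[OF fin b that] by simp
  qed
qed (use fin lower_t lower_u in auto)

definition weight_of :: "irrep_class \<Rightarrow> triple \<Rightarrow> gt_weight" where
  "weight_of c = (\<lambda>(a, b, n). (int (fst c) + 2 * int (snd c) - (a + b), a + b - n, n))"

definition spin_of :: "triple \<Rightarrow> real" where
  "spin_of = (\<lambda>(a, b, n). of_int (b - a) / 2)"

definition label_of :: "irrep_class \<Rightarrow> triple \<Rightarrow> gt_weight \<times> real" where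
  "label_of c l = (weight_of c l, spin_of l)"

lemma gt_labels_eq: "gt_labels c = label_of c ` triples c"
proof -
  obtain p q where c: "c = (p, q)" by (cases c)
  show ?thesis
  proof (intro subset_antisym subsetI)
    fix x assume "x \<in> gt_labels c"
    then obtain rm rp n where "x = label_of c (rm, rp, n)" "(rm, rp, n) \<in> triples c"
      unfolding gt_labels_def c prod.case mem_Collect_eq
      by (auto simp: label_of_def triples_def weight_of_def spin_of_def add.commute)
    then show "x \<in> label_of c ` triples c" by blast
  next
    fix x assume "x \<in> label_of c ` triples c"
    then obtain a b n where "x = label_of c (a, b, n)" "(a, b, n) \<in> triples c" by auto
    then show "x \<in> gt_labels c"
      unfolding gt_labels_def c prod.case mem_Collect_eq
      by (intro exI[of _ a] exI[of _ b] exI[of _ n])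
         (simp add: label_of_def triples_def weight_of_def spin_of_def add.commute)
  qed
qed

lemma inj_label_of: "inj (label_of c)"
proof (rule injI)
  fix x y assume eq: "label_of c x = label_of c y"
  obtain a b n a' b' n' where xy: "x = (a, b, n)" "y = (a', b', n')" by (cases x; cases y)
  have "a + b = a' + b'" "n = n'" "b - a = b' - a'"
    using eq by (simp_all add: xy label_of_def weight_of_def spin_of_def)
  then show "x = y" by (simp add: xy)
qed

lemma bij_label_of: "bij_betw (label_of c) (triples c) (gt_labels c)"
  unfolding bij_betw_def gt_labels_eq using inj_on_subset[OF inj_label_of subset_UNIV] by blast

definition gt_triple :: "irrep_class \<Rightarrow> 'i gt_family \<Rightarrow> triple \<Rightarrow> 'i cvec" where
  "gt_triple c e l = (if l \<in> triples c then e (weight_of c l) (spin_of l) else (\<lambda>i. 0))"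

lemma spin_arith:
  assumes "J = of_int (b - a) / 2" "u = of_int (a + b - n - n) / 2" "s = real p + real q"
  shows "J + u = of_int (b - n)" "J - u = of_int (n - a)" "2 * J = of_int (b - a)" "2 * J + 1 = of_int (b - a + 1)"
    "J - u + 1 = of_int (n - a + 1)"
    "s + J - u - of_int n + 1 = of_int (int (p + q) + 1 - a)"
    "real q + J - u - of_int n = of_int (int q - a)"
    "u - J + of_int n + 1 = of_int (a + 1)"
    "J + u + 1 = of_int (b + 1 - n)"
    "s - J - u - of_int n = of_int (int (p + q) - b)"
    "J + u + 1 + of_int n - real q = of_int (b + 1 - int q)"
    "J + u + 2 + of_int n = of_int (b + 2)"
    "2 * (J + 1) = of_int (b - a + 2)"
  by (simp_all add: assms field_simps)

lemma gt_basis_lower: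
  assumes gt: "gt_basis c I \<pi> W e" and l: "l \<in> triples c"
  shows "app I (Um \<pi>) (gt_triple c e l) = (\<lambda>i. LU (\<lambda>x. gt_triple c e x i) l)"
    and "app I (Tm \<pi>) (gt_triple c e l) = (\<lambda>i. LT c (\<lambda>x. gt_triple c e x i) l)"
proof -
  obtain p q where c: "c = (p, q)" by (cases c)
  obtain a b n where abn: "l = (a, b, n)" by (cases l)
  define \<nu>\<^sub>1 where "\<nu>\<^sub>1 = int p + 2 * int q - (a + b)"
  define J where "J = real_of_int (b - a) / 2"
  define u where "u = real_of_int (a + b - n - n) / 2"
  have "label_of c l \<in> gt_labels (p, q)" using l by (auto simp: gt_labels_eq c)
  then have lab: "((\<nu>\<^sub>1, a + b - n, n), J) \<in> gt_labels (p, q)"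
    by (simp add: label_of_def weight_of_def spin_of_def abn c \<nu>\<^sub>1_def J_def)
  have u: "u_of (\<nu>\<^sub>1, a + b - n, n) = u" by (simp add: u_of_def u_def)
  note ar = spin_arith[where p = p and q = q, OF J_def u_def refl]
  have e0: "gt_triple c e l = e (\<nu>\<^sub>1, a + b - n, n) J"
    using l by (simp add: gt_triple_def weight_of_def spin_of_def abn c \<nu>\<^sub>1_def J_def)
  have e1: "(a, b, n + 1) \<in> triples c \<Longrightarrow> gt_triple c e (a, b, n + 1) = e (\<nu>\<^sub>1, a + b - n - 1, n + 1) J"
    by (simp add: diff_diff_eq gt_triple_def weight_of_def spin_of_def c \<nu>\<^sub>1_def J_def)
  have J_e2: "real_of_int (b - (a + 1)) / 2 = J - 1/2"
    by (simp add: J_def field_simps)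
  have e2: "(a + 1, b, n) \<in> triples c \<Longrightarrow> gt_triple c e (a + 1, b, n) = e (\<nu>\<^sub>1 - 1, a + b - n + 1, n) (J - 1/2)"
    unfolding J_e2[symmetric] by (simp add: gt_triple_def weight_of_def spin_of_def c \<nu>\<^sub>1_def algebra_simps)
  have J_e3: "real_of_int (b + 1 - a) / 2 = J + 1/2"
    by (simp add: J_def field_simps)
  have e3: "(a, b + 1, n) \<in> triples c \<Longrightarrow> gt_triple c e (a, b + 1, n) = e (\<nu>\<^sub>1 - 1, a + b - n + 1, n) (J + 1/2)"
    unfolding J_e3[symmetric] by (simp add: gt_triple_def weight_of_def spin_of_def c \<nu>\<^sub>1_def algebra_simps)
  have coeffs: "sqrt ((J + u) * (J - u + 1)) = coeff_n a b n"
    "sqrt ((J - u) * (real p + real q + J - u - of_int n + 1) * (real q + J - u - of_int n) * (u - J + of_int n + 1)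
       / (2 * J * (2 * J + 1))) = coeff_a c a b n"
    "sqrt ((J + u + 1) * (real p + real q - J - u - of_int n) * (J + u + 1 + of_int n - real q) * (J + u + 2 + of_int n)
       / (2 * (J + 1) * (2 * J + 1))) = coeff_b c a b n"
    unfolding coeff_n_def coeff_a_def coeff_b_def of_int_mult c fst_conv snd_conv
    by (intro arg_cong[where f = sqrt] arg_cong2[where f = "(*)"] arg_cong2[where f = "(/)"] ar)+
  have acts: "app I (Um \<pi>) (e (\<nu>\<^sub>1, a + b - n, n) J) =
      csc (of_real (coeff_n a b n)) (e (\<nu>\<^sub>1, a + b - n - 1, n + 1) J)"
    "app I (Tm \<pi>) (e (\<nu>\<^sub>1, a + b - n, n) J) =
      csc (of_real (coeff_a c a b n)) (e (\<nu>\<^sub>1 - 1, a + b - n + 1, n) (J - 1/2)) +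
      csc (of_real (coeff_b c a b n)) (e (\<nu>\<^sub>1 - 1, a + b - n + 1, n) (J + 1/2))"
    using gt lab unfolding gt_basis_def c by (simp_all only: prod.case Let_def u coeffs c)
  have "coeff_n a b n = 0 \<or> (a, b, n + 1) \<in> triples c"
    using l unfolding abn triples_def coeff_n_def by auto
  then show "app I (Um \<pi>) (gt_triple c e l) = (\<lambda>i. LU (\<lambda>x. gt_triple c e x i) l)"
    unfolding e0 acts by (auto simp: LU_def abn csc_def e1)
  have "coeff_a c a b n = 0 \<or> (a + 1, b, n) \<in> triples c"
    using l unfolding abn triples_def coeff_a_def by auto
  moreover have "coeff_b c a b n = 0 \<or> (a, b + 1, n) \<in> triples c"
    using l unfolding abn triples_def coeff_b_def by auto
  ultimately show "app I (Tm \<pi>) (gt_triple c e l) = (\<lambda>i. LT c (\<lambda>x. gt_triple c e x i) l)"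
    unfolding e0 acts by (auto simp: LT_def abn csc_def e2 e3 plus_fun_def)
qed

lemma gt_basis_system:
  assumes "finite I" and gt: "gt_basis c I \<pi> (hilb I) e"
  shows "gt_system I (Tm \<pi>) (Um \<pi>) {()} (\<lambda>_. c) (\<lambda>_. gt_triple c e)"
proof (rule gt_systemI[OF assms(1)])
  show "orthonormal_basis_of I (hilb I) (gt_labels c) (\<lambda>(\<nu>, J). e \<nu> J)"
    using gt by (cases c) (simp add: gt_basis_def)
  have "bij_betw snd (SIGMA k:{()}. triples c) (triples c)"
    by (intro bij_betwI[where g = "Pair ()"]) auto
  from bij_betw_trans[OF this bij_label_of]
  show "bij_betw (label_of c \<circ> snd) (SIGMA k:{()}. triples c) (gt_labels c)" .
qed (use gt_basis_lower[OF gt] in \<open>auto simp: gt_triple_def label_of_def\<close>)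

lemma Tm_tens:
  assumes "differentiable_rep I \<pi>" "differentiable_rep J \<rho>"
  shows "app (I \<times> J) (Tm (tensor_rep \<pi> \<rho>)) = app (I \<times> J) (tens (Tm \<pi>) (Tm \<rho>))"
    and "app (I \<times> J) (Um (tensor_rep \<pi> \<rho>)) = app (I \<times> J) (tens (Um \<pi>) (Um \<rho>))"
  using sl_rep_tensor[OF assms]
  by (auto simp: Tm_def Um_def tens_def lowering_pairs_def intro!: app_cong)

lemma coupled_system:
  assumes fin: "finite I" "finite J" and diff: "differentiable_rep I \<pi>" "differentiable_rep J \<rho>"
    and coupled: "coupled_basis (I \<times> J) (tensor_rep \<pi> \<rho>) m E"
  shows "gt_system (I \<times> J) (tens (Tm \<pi>) (Tm \<rho>)) (tens (Um \<pi>) (Um \<rho>))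
    (SIGMA a:UNIV. {1..m a}) fst (\<lambda>(a, \<sigma>). gt_triple a (E a \<sigma>))"
proof (rule gt_systemI)
  let ?L = "{(a, \<sigma>, \<nu>, J). \<sigma> \<in> {1..m a} \<and> (\<nu>, J) \<in> gt_labels a}"
  let ?h = "\<lambda>((a, \<sigma>), l). (a, \<sigma>, label_of a l)"
  show "finite (I \<times> J)" using fin by simp
  show "orthonormal_basis_of (I \<times> J) (hilb (I \<times> J)) ?L (\<lambda>(a, \<sigma>, \<nu>, J). E a \<sigma> \<nu> J)"
    using coupled by (simp add: coupled_basis_def)
  show "bij_betw ?h (SIGMA k:(SIGMA a:UNIV. {1..m a}). triples (fst k)) ?L"
    unfolding bij_betw_def
  proof
    show "inj_on ?h (SIGMA k:(SIGMA a:UNIV. {1..m a}). triples (fst k))"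
      by (auto simp: inj_on_def dest: injD[OF inj_label_of])
    show "?h ` (SIGMA k:(SIGMA a:UNIV. {1..m a}). triples (fst k)) = ?L"
      unfolding gt_labels_eq by (force simp: image_def)
  qed
next
  fix k l assume k: "k \<in> (SIGMA a:UNIV. {1..m a})" and l: "l \<in> triples (fst k)"
  obtain a \<sigma> where k_eq: "k = (a, \<sigma>)" by (cases k)
  have "gt_basis a (I \<times> J) (tensor_rep \<pi> \<rho>) (cspan ((\<lambda>(\<nu>, J). E a \<sigma> \<nu> J) ` gt_labels a)) (E a \<sigma>)"
    using coupled k unfolding coupled_basis_def Let_def k_eq by blast
  from gt_basis_lower[OF this, of l] l
  show "app (I \<times> J) (tens (Tm \<pi>) (Tm \<rho>)) ((\<lambda>(a, \<sigma>). gt_triple a (E a \<sigma>)) k l) =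
      (\<lambda>i. LT (fst k) (\<lambda>x. (\<lambda>(a, \<sigma>). gt_triple a (E a \<sigma>)) k x i) l)"
    and "app (I \<times> J) (tens (Um \<pi>) (Um \<rho>)) ((\<lambda>(a, \<sigma>). gt_triple a (E a \<sigma>)) k l) =
      (\<lambda>i. LU (\<lambda>x. (\<lambda>(a, \<sigma>). gt_triple a (E a \<sigma>)) k x i) l)"
    by (simp_all add: Tm_tens[OF diff] k_eq)
qed (auto simp: gt_triple_def label_of_def)

section \<open>The induced basis of the dual\<close>

definition reflect :: "irrep_class \<Rightarrow> triple \<Rightarrow> triple" where
  "reflect c = (\<lambda>(a, b, n). let s = int (fst c + snd c) in (s - b, s - a, s - n))"

definition dual_sign :: "irrep_class \<Rightarrow> triple \<Rightarrow> complex" where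
  "dual_sign c l = (case weight_of c (reflect c l) of (\<nu>\<^sub>1, \<nu>\<^sub>2, \<nu>\<^sub>3) \<Rightarrow> (-1) powi (\<nu>\<^sub>1 - \<nu>\<^sub>3))"

lemma minus_one_powi: "(-1 :: complex) powi m = (if even m then 1 else -1)"
  by (cases "m \<ge> 0") (auto simp: power_int_def even_nat_iff)

lemma dual_sign_cases: "dual_sign c l = 1 \<or> dual_sign c l = -1"
  by (auto simp: dual_sign_def minus_one_powi split: prod.split)

lemma dual_sign_square: "dual_sign c l * dual_sign c l = 1" "cnj (dual_sign c l) = dual_sign c l"
  using dual_sign_cases[of c l] by auto

lemma dual_sign_shift:
  "dual_sign c (a + 1, b, n) = - dual_sign c (a, b, n)"
  "dual_sign c (a, b + 1, n) = - dual_sign c (a, b, n)"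
  "dual_sign c (a, b, n + 1) = - dual_sign c (a, b, n)"
  by (auto simp: dual_sign_def weight_of_def reflect_def Let_def minus_one_powi)

lemma reflect_triples: "reflect c l \<in> triples c \<longleftrightarrow> l \<in> triples (dual_class c)"
  by (cases l) (auto simp: reflect_def triples_def dual_class_def Let_def)

lemma reflect_reflect: "reflect c (reflect c l) = l"
  by (cases l) (simp add: reflect_def Let_def)

lemma reflect_dual: "reflect (dual_class c) = reflect c"
  by (simp add: reflect_def dual_class_def add.commute)

lemma bij_reflect: "bij_betw (reflect c) (triples (dual_class c)) (triples c)"
  by (intro bij_betwI[where g = "reflect c"])
     (auto simp: reflect_triples reflect_reflect simp flip: reflect_dual[of c] reflect_triples)

lemma coeff_dual:
  assumes "s = int (fst c + snd c)"
  shows "coeff_a (dual_class c) a b n = coeff_b c (s - b) (s - a - 1) (s - n)"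
    and "coeff_b (dual_class c) a b n = coeff_a c (s - b - 1) (s - a) (s - n)"
    and "coeff_n a b n = coeff_n (s - b) (s - a) (s - n - 1)"
proof -
  have "coeff_a (dual_class c) a b n = sqrt (of_int ((n - a) * (s + 1 - a) * (int (fst c) - a) * (a + 1)) /
     of_int ((b - a) * (b - a + 1)))"
    by (simp add: coeff_a_def dual_class_def assms add.commute)
  also have "\<dots> = coeff_b c (s - b) (s - a - 1) (s - n)"
    unfolding coeff_b_def
    by (intro arg_cong[where f = sqrt] arg_cong2[where f = "\<lambda>x y. of_int x / of_int y"]) (simp_all add: assms mult_ac)
  finally show "coeff_a (dual_class c) a b n = coeff_b c (s - b) (s - a - 1) (s - n)" .
  have "coeff_b (dual_class c) a b n = sqrt (of_int ((b + 1 - n) * (b + 2) * (b + 1 - int (fst c)) * (s - b)) /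
     of_int ((b - a + 1) * (b - a + 2)))"
    by (simp add: coeff_b_def dual_class_def assms add.commute mult_ac)
  also have "\<dots> = coeff_a c (s - b - 1) (s - a) (s - n)"
    unfolding coeff_a_def
    by (intro arg_cong[where f = sqrt] arg_cong2[where f = "\<lambda>x y. of_int x / of_int y"] arg_cong2[where f = "(*)"])
       (simp_all add: assms)
  finally show "coeff_b (dual_class c) a b n = coeff_a c (s - b - 1) (s - a) (s - n)" .
  show "coeff_n a b n = coeff_n (s - b) (s - a) (s - n - 1)"
    unfolding coeff_n_def by (intro arg_cong[where f = sqrt] arg_cong[where f = of_int]) (simp add: mult.commute)
qed

lemma app_dual:
  assumes "\<And>i j. i \<in> I \<Longrightarrow> j \<in> I \<Longrightarrow> X' i j = - X j i"
  shows "app I X' (\<lambda>i. x * cnj (v i)) = (\<lambda>i. - x * cnj (app I (adj X) v i))"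
proof
  fix i
  show "app I X' (\<lambda>i. x * cnj (v i)) i = - x * cnj (app I (adj X) v i)"
    using assms by (auto simp: app_def adj_def sum_distrib_left sum_negf[symmetric] intro!: sum.cong)
qed

lemma dual_system:
  fixes f :: "triple \<Rightarrow> 'i cvec"
  assumes sys: "gt_system I tm um {()} (\<lambda>_. c) (\<lambda>_. f)"
    and tm': "\<And>i j. i \<in> I \<Longrightarrow> j \<in> I \<Longrightarrow> tm' i j = - tm j i"
    and um': "\<And>i j. i \<in> I \<Longrightarrow> j \<in> I \<Longrightarrow> um' i j = - um j i"
  shows "gt_system I tm' um' {()} (\<lambda>_. dual_class c) (\<lambda>_ l i. dual_sign c l * cnj (f (reflect c l) i))"
proof -
  interpret gt_system I tm um "{()}" "\<lambda>_. c" "\<lambda>_. f" by (rule sys)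
  let ?f = "\<lambda>l i. dual_sign c l * cnj (f (reflect c l) i)"
  have cin: "cinner I (?f l) (?f l') = dual_sign c l * dual_sign c l' * cnj (cinner I (f (reflect c l)) (f (reflect c l')))" for l l'
    unfolding cinner_def by (simp add: sum_distrib_left dual_sign_square mult_ac)
  show ?thesis
  proof
    show "finite I" by (rule finite_index)
    show "?f l \<in> hilb I" for l using in_hilb by (simp add: hilb_def)
    show "?f l i = 0" if "l \<notin> triples (dual_class c)" for l i
      using that outside[of "()" "reflect c l"] by (simp add: reflect_triples)
  next
    fix k k' :: unit and l l' assume l: "l \<in> triples (dual_class c)" "l' \<in> triples (dual_class c)"
    have "reflect c l = reflect c l' \<longleftrightarrow> l = l'" by (metis reflect_reflect)
    then show "cinner I (?f l) (?f l') = (if k = k' \<and> l = l' then 1 else 0)"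
      using l orthonormal[of "()" "()" "reflect c l" "reflect c l'"] dual_sign_square
      by (simp add: cin reflect_triples)
  next
    fix i j assume ij: "i \<in> I" "j \<in> I"
    have "(\<Sum>l\<in>triples (dual_class c). ?f l i * cnj (?f l j))
      = (\<Sum>l\<in>triples (dual_class c). cnj (f (reflect c l) i * cnj (f (reflect c l) j)))"
    proof (intro sum.cong refl)
      fix l
      show "?f l i * cnj (?f l j) = cnj (f (reflect c l) i * cnj (f (reflect c l) j))"
        using dual_sign_cases[of c l] by auto
    qed
    also have "\<dots> = (\<Sum>l\<in>triples c. cnj (f l i * cnj (f l j)))"
      by (rule sum.reindex_bij_betw[OF bij_reflect])
    also have "\<dots> = cnj (\<Sum>k\<in>{()}. \<Sum>l\<in>triples c. f l i * cnj (f l j))" by simp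
    also have "\<dots> = (if i = j then 1 else 0)" unfolding complete[OF ij] by simp
    finally show "(\<Sum>k\<in>{()}. \<Sum>l\<in>triples (dual_class c). ?f l i * cnj (?f l j)) = (if i = j then 1 else 0)"
      by simp
  next
    fix l assume l: "l \<in> triples (dual_class c)"
    then have rl: "reflect c l \<in> triples c" by (simp add: reflect_triples)
    obtain a b n where abn: "l = (a, b, n)" by (cases l)
    have app_t: "app I tm' (?f l) = (\<lambda>i. - dual_sign c l * cnj (app I (adj tm) (f (reflect c l)) i))"
      by (rule app_dual) (rule tm')
    show "app I tm' (?f l) = (\<lambda>i. LT (dual_class c) (\<lambda>x. ?f x i) l)"
      unfolding app_t raise_t[OF singletonI rl]
      by (simp add: abn LT_def RT_def reflect_def Let_def dual_sign_shift coeff_dual[OF refl] algebra_simps)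
    have app_u: "app I um' (?f l) = (\<lambda>i. - dual_sign c l * cnj (app I (adj um) (f (reflect c l)) i))"
      by (rule app_dual) (rule um')
    show "app I um' (?f l) = (\<lambda>i. LU (\<lambda>x. ?f x i) l)"
      unfolding app_u raise_u[OF singletonI rl]
      by (simp add: abn LU_def RU_def reflect_def Let_def dual_sign_shift
          coeff_dual(3)[OF refl, where c = c and a = a and b = b and n = n] algebra_simps)
  qed simp
qed

lemma gt_triple_induced:
  "gt_triple (dual_class c) (induced_gt c e) l = (\<lambda>i. dual_sign c l * cnj (gt_triple c e (reflect c l) i))"
proof -
  obtain a b n where abn: "l = (a, b, n)" by (cases l)
  have "reflect_weight c (weight_of (dual_class c) l) = weight_of c (reflect c l)"
    by (simp add: abn reflect_weight_def weight_of_def dual_class_def reflect_def Let_def)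
  moreover have "spin_of (reflect c l) = spin_of l"
    by (simp add: abn reflect_def spin_of_def Let_def)
  ultimately show ?thesis
    by (auto simp: gt_triple_def reflect_triples induced_gt_def Let_def dual_sign_def csc_def dual_vec_def
        split: prod.split)
qed

section \<open>The operator product\<close>

lemma op_product_hilb: "A \<in> hilb (I \<times> I) \<Longrightarrow> B \<in> hilb (I \<times> I) \<Longrightarrow> op_product I A B \<in> hilb (I \<times> I)"
  by (auto simp: hilb_def op_product_def)

text \<open>
  On matrices \<open>tens X (- X\<^sup>T)\<close> acts as the commutator with \<open>X\<close>, hence as a derivation of the
  operator product.
\<close>

lemma app_op_product:
  assumes fin: "finite I" and A: "A \<in> hilb (I \<times> I)" and B: "B \<in> hilb (I \<times> I)"
    and X': "\<And>i j. i \<in> I \<Longrightarrow> j \<in> I \<Longrightarrow> X' i j = - X j i"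
  shows "app (I \<times> I) (tens X X') (op_product I A B) =
    (\<lambda>x. op_product I (app (I \<times> I) (tens X X') A) B x + op_product I A (app (I \<times> I) (tens X X') B) x)"
proof
  fix x :: "'a \<times> 'a"
  obtain i j where x: "x = (i, j)" by (cases x)
  show "app (I \<times> I) (tens X X') (op_product I A B) x =
    op_product I (app (I \<times> I) (tens X X') A) B x + op_product I A (app (I \<times> I) (tens X X') B) x"
  proof (cases "i \<in> I \<and> j \<in> I")
    case True
    have comm: "app (I \<times> I) (tens X X') C (k, l) = (\<Sum>m\<in>I. X k m * C (m, l)) - (\<Sum>m\<in>I. C (k, m) * X m l)"
      if "k \<in> I" "l \<in> I" for C k l
    proof -
      have "(\<Sum>m\<in>I. X' l m * C (k, m)) = - (\<Sum>m\<in>I. C (k, m) * X m l)"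
        unfolding sum_negf[symmetric] using that by (intro sum.cong refl) (simp add: X')
      then show ?thesis using that fin by (simp add: app_tens)
    qed
    have "op_product I (app (I \<times> I) (tens X X') A) B (i, j) =
      (\<Sum>k\<in>I. ((\<Sum>m\<in>I. X i m * A (m, k)) - (\<Sum>m\<in>I. A (i, m) * X m k)) * B (k, j))"
      unfolding op_product_def using True by (intro sum.cong refl) (simp add: comm)
    also have "\<dots> = (\<Sum>k\<in>I. \<Sum>m\<in>I. X i m * A (m, k) * B (k, j)) - (\<Sum>k\<in>I. \<Sum>m\<in>I. A (i, m) * X m k * B (k, j))"
      by (simp add: left_diff_distrib sum_subtractf sum_distrib_right)
    finally have 1: "op_product I (app (I \<times> I) (tens X X') A) B (i, j) = \<dots>" .
    have "op_product I A (app (I \<times> I) (tens X X') B) (i, j) =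
      (\<Sum>k\<in>I. A (i, k) * ((\<Sum>m\<in>I. X k m * B (m, j)) - (\<Sum>m\<in>I. B (k, m) * X m j)))"
      unfolding op_product_def using True by (intro sum.cong refl) (simp add: comm)
    also have "\<dots> = (\<Sum>k\<in>I. \<Sum>m\<in>I. A (i, k) * X k m * B (m, j)) - (\<Sum>k\<in>I. \<Sum>m\<in>I. A (i, k) * B (k, m) * X m j)"
      by (simp add: right_diff_distrib sum_subtractf sum_distrib_left mult.assoc)
    finally have 2: "op_product I A (app (I \<times> I) (tens X X') B) (i, j) = \<dots>" .
    have "app (I \<times> I) (tens X X') (op_product I A B) (i, j) =
      (\<Sum>m\<in>I. \<Sum>k\<in>I. X i m * A (m, k) * B (k, j)) - (\<Sum>m\<in>I. \<Sum>k\<in>I. A (i, k) * B (k, m) * X m j)"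
      using True by (simp add: comm) (simp add: op_product_def sum_distrib_left sum_distrib_right mult.assoc)
    moreover have "(\<Sum>k\<in>I. \<Sum>m\<in>I. X i m * A (m, k) * B (k, j)) = (\<Sum>m\<in>I. \<Sum>k\<in>I. X i m * A (m, k) * B (k, j))"
      "(\<Sum>k\<in>I. \<Sum>m\<in>I. A (i, k) * B (k, m) * X m j) = (\<Sum>m\<in>I. \<Sum>k\<in>I. A (i, k) * B (k, m) * X m j)"
      "(\<Sum>k\<in>I. \<Sum>m\<in>I. A (i, m) * X m k * B (k, j)) = (\<Sum>k\<in>I. \<Sum>m\<in>I. A (i, k) * X k m * B (m, j))"
      by (rule sum.swap)+
    ultimately show ?thesis by (simp add: x 1 2)
  next
    case False
    then show ?thesis using A B by (auto simp: x app_def op_product_def hilb_def)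
  qed
qed

lemma op_product_LT:
  "op_product I (\<lambda>i. LT c (\<lambda>x. f x i) l) B = (\<lambda>y. LT c (\<lambda>x. op_product I (f x) B y) l)"
  "op_product I A (\<lambda>i. LT c (\<lambda>x. g x i) l) = (\<lambda>y. LT c (\<lambda>x. op_product I A (g x) y) l)"
  by (cases l; simp add: LT_def op_product_def algebra_simps sum.distrib sum_distrib_left fun_eq_iff)+

lemma op_product_RT:
  "op_product I (\<lambda>i. RT c (\<lambda>x. f x i) l) B = (\<lambda>y. RT c (\<lambda>x. op_product I (f x) B y) l)"
  "op_product I A (\<lambda>i. RT c (\<lambda>x. g x i) l) = (\<lambda>y. RT c (\<lambda>x. op_product I A (g x) y) l)"
  by (cases l; simp add: RT_def op_product_def algebra_simps sum.distrib sum_distrib_left fun_eq_iff)+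

lemma op_product_LU:
  "op_product I (\<lambda>i. LU (\<lambda>x. f x i) l) B = (\<lambda>y. LU (\<lambda>x. op_product I (f x) B y) l)"
  "op_product I A (\<lambda>i. LU (\<lambda>x. g x i) l) = (\<lambda>y. LU (\<lambda>x. op_product I A (g x) y) l)"
  by (cases l; simp add: LU_def op_product_def algebra_simps sum_distrib_left fun_eq_iff)+

lemma op_product_RU:
  "op_product I (\<lambda>i. RU (\<lambda>x. f x i) l) B = (\<lambda>y. RU (\<lambda>x. op_product I (f x) B y) l)"
  "op_product I A (\<lambda>i. RU (\<lambda>x. g x i) l) = (\<lambda>y. RU (\<lambda>x. op_product I A (g x) y) l)"
  by (cases l; simp add: RU_def op_product_def algebra_simps sum_distrib_left fun_eq_iff)+

lemma tensor_LT:
  "tensor_vec (\<lambda>i. LT c (\<lambda>x. f x i) l) w = (\<lambda>y. LT c (\<lambda>x. tensor_vec (f x) w y) l)"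
  "tensor_vec v (\<lambda>i. LT c (\<lambda>x. g x i) l) = (\<lambda>y. LT c (\<lambda>x. tensor_vec v (g x) y) l)"
  by (cases l; simp add: LT_def tensor_vec_def fun_eq_iff algebra_simps)+

lemma tensor_RT:
  "tensor_vec (\<lambda>i. RT c (\<lambda>x. f x i) l) w = (\<lambda>y. RT c (\<lambda>x. tensor_vec (f x) w y) l)"
  "tensor_vec v (\<lambda>i. RT c (\<lambda>x. g x i) l) = (\<lambda>y. RT c (\<lambda>x. tensor_vec v (g x) y) l)"
  by (cases l; simp add: RT_def tensor_vec_def fun_eq_iff algebra_simps)+

locale gt_product =
  gt_coupling I\<^sub>1 t\<^sub>1 u\<^sub>1 a\<^sub>1 e\<^sub>1 I\<^sub>2 t\<^sub>2 u\<^sub>2 a\<^sub>2 e\<^sub>2 K cl F +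
  P: gt_system "I \<times> I" "tens t t'" "tens u u'" K' cl' G
  for I\<^sub>1 :: "'i set" and t\<^sub>1 u\<^sub>1 a\<^sub>1 e\<^sub>1
    and I\<^sub>2 :: "'j set" and t\<^sub>2 u\<^sub>2 a\<^sub>2 e\<^sub>2
    and K :: "'k set" and cl F
    and I :: "'h set" and t t' u u' and K' :: "'l set" and cl' G +
  fixes k\<^sub>1 k\<^sub>2 :: 'l
  assumes fin: "finite I"
    and t': "\<And>i j. i \<in> I \<Longrightarrow> j \<in> I \<Longrightarrow> t' i j = - t j i"
    and u': "\<And>i j. i \<in> I \<Longrightarrow> j \<in> I \<Longrightarrow> u' i j = - u j i"
    and k1: "k\<^sub>1 \<in> K'" "cl' k\<^sub>1 = a\<^sub>1" and k2: "k\<^sub>2 \<in> K'" "cl' k\<^sub>2 = a\<^sub>2"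
begin

definition prod_map :: "('i \<times> 'j) cvec \<Rightarrow> ('h \<times> 'h) cvec" where
  "prod_map v = (\<lambda>x. \<Sum>y\<in>triples a\<^sub>1 \<times> triples a\<^sub>2.
     cinner (I\<^sub>1 \<times> I\<^sub>2) (tensor_vec (e\<^sub>1 (fst y)) (e\<^sub>2 (snd y))) v * op_product I (G k\<^sub>1 (fst y)) (G k\<^sub>2 (snd y)) x)"

lemma prod_map_lincomb: "prod_map (\<lambda>i. x * v i + y * w i) = (\<lambda>j. x * prod_map v j + y * prod_map w j)"
  unfolding prod_map_def cinner_lincomb_right
  by (simp add: fun_eq_iff algebra_simps sum.distrib sum_distrib_left)

lemma prod_map_scale: "prod_map (\<lambda>i. x * v i) = (\<lambda>j. x * prod_map v j)"
  using prod_map_lincomb[of x v 0 v] by simp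

lemma prod_map_sum: "prod_map (\<lambda>i. \<Sum>x\<in>A. c x * f x i) = (\<lambda>j. \<Sum>x\<in>A. c x * prod_map (f x) j)"
proof
  fix j
  show "prod_map (\<lambda>i. \<Sum>x\<in>A. c x * f x i) j = (\<Sum>x\<in>A. c x * prod_map (f x) j)"
    unfolding prod_map_def cinner_sum_right sum_distrib_right sum_distrib_left
    by (subst sum.swap) (simp add: mult.assoc)
qed

lemma prod_map_hilb: "prod_map v \<in> hilb (I \<times> I)"
  using op_product_hilb[OF P.in_hilb[OF k1(1)] P.in_hilb[OF k2(1)]]
  by (simp add: prod_map_def hilb_def)

lemma prod_map_tensor: "prod_map (tensor_vec (e\<^sub>1 l\<^sub>1) (e\<^sub>2 l\<^sub>2)) = op_product I (G k\<^sub>1 l\<^sub>1) (G k\<^sub>2 l\<^sub>2)"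
proof (cases "l\<^sub>1 \<in> triples a\<^sub>1 \<and> l\<^sub>2 \<in> triples a\<^sub>2")
  case True
  have "prod_map (tensor_vec (e\<^sub>1 l\<^sub>1) (e\<^sub>2 l\<^sub>2)) x = op_product I (G k\<^sub>1 l\<^sub>1) (G k\<^sub>2 l\<^sub>2) x" for x
  proof -
    have "prod_map (tensor_vec (e\<^sub>1 l\<^sub>1) (e\<^sub>2 l\<^sub>2)) x = (\<Sum>y\<in>triples a\<^sub>1 \<times> triples a\<^sub>2.
      if y = (l\<^sub>1, l\<^sub>2) then op_product I (G k\<^sub>1 (fst y)) (G k\<^sub>2 (snd y)) x else 0)"
      unfolding prod_map_def using True
      by (intro sum.cong refl)
         (auto simp: cinner_tensor A.orthonormal[OF singletonI singletonI] B.orthonormal[OF singletonI singletonI]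
           split: if_splits)
    then show ?thesis using True finite_triples by simp
  qed
  then show ?thesis by blast
next
  case False
  then have "tensor_vec (e\<^sub>1 l\<^sub>1) (e\<^sub>2 l\<^sub>2) = (\<lambda>_. 0)"
    using A.outside[OF singletonI, of l\<^sub>1] B.outside[OF singletonI, of l\<^sub>2] by (auto simp: tensor_vec_def fun_eq_iff)
  moreover have "op_product I (G k\<^sub>1 l\<^sub>1) (G k\<^sub>2 l\<^sub>2) = (\<lambda>_. 0)"
    using False P.outside[OF k1(1), of l\<^sub>1] P.outside[OF k2(1), of l\<^sub>2] k1(2) k2(2)
    by (auto simp: op_product_def fun_eq_iff)
  ultimately show ?thesis by (simp add: prod_map_def)
qed

lemma prod_map_add: "prod_map (\<lambda>i. v i + w i) = (\<lambda>j. prod_map v j + prod_map w j)"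
  using prod_map_lincomb[of 1 v 1 w] by simp

lemma prod_map_LT: "prod_map (\<lambda>i. LT c (\<lambda>x. f x i) l) = (\<lambda>j. LT c (\<lambda>x. prod_map (f x) j) l)"
  by (cases l) (simp add: LT_def prod_map_lincomb)

lemma prod_map_RT: "prod_map (\<lambda>i. RT c (\<lambda>x. f x i) l) = (\<lambda>j. RT c (\<lambda>x. prod_map (f x) j) l)"
  by (cases l) (simp add: RT_def prod_map_lincomb)

lemma prod_map_LU: "prod_map (\<lambda>i. LU (\<lambda>x. f x i) l) = (\<lambda>j. LU (\<lambda>x. prod_map (f x) j) l)"
  by (cases l) (simp add: LU_def prod_map_scale)

lemma prod_map_RU: "prod_map (\<lambda>i. RU (\<lambda>x. f x i) l) = (\<lambda>j. RU (\<lambda>x. prod_map (f x) j) l)"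
  by (cases l) (simp add: RU_def prod_map_scale)

lemma intertwines_on_tensors:
  assumes "v \<in> hilb (I\<^sub>1 \<times> I\<^sub>2)"
    and "\<And>l\<^sub>1 l\<^sub>2. l\<^sub>1 \<in> triples a\<^sub>1 \<Longrightarrow> l\<^sub>2 \<in> triples a\<^sub>2 \<Longrightarrow>
      prod_map (app (I\<^sub>1 \<times> I\<^sub>2) X (tensor_vec (e\<^sub>1 l\<^sub>1) (e\<^sub>2 l\<^sub>2))) = app (I \<times> I) Y (op_product I (G k\<^sub>1 l\<^sub>1) (G k\<^sub>2 l\<^sub>2))"
  shows "prod_map (app (I\<^sub>1 \<times> I\<^sub>2) X v) = app (I \<times> I) Y (prod_map v)"
proof -
  define c where "c y = cinner (I\<^sub>1 \<times> I\<^sub>2) (tensor_vec (e\<^sub>1 (fst y)) (e\<^sub>2 (snd y))) v" for y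
  let ?A = "triples a\<^sub>1 \<times> triples a\<^sub>2"
  have v: "v = (\<lambda>x. \<Sum>y\<in>?A. c y * tensor_vec (e\<^sub>1 (fst y)) (e\<^sub>2 (snd y)) x)"
    using tensor_expand[OF assms(1)] by (simp add: c_def sum.cartesian_product split_def)
  have "prod_map (app (I\<^sub>1 \<times> I\<^sub>2) X v) = (\<lambda>x. \<Sum>y\<in>?A. c y * app (I \<times> I) Y (op_product I (G k\<^sub>1 (fst y)) (G k\<^sub>2 (snd y))) x)"
    by (subst v) (auto simp: app_sum prod_map_sum assms(2) intro!: sum.cong)
  also have "prod_map v = (\<lambda>x. \<Sum>y\<in>?A. c y * op_product I (G k\<^sub>1 (fst y)) (G k\<^sub>2 (snd y)) x)"
    using arg_cong[OF v, of prod_map] by (simp only: prod_map_sum prod_map_tensor)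
  then have "(\<lambda>x. \<Sum>y\<in>?A. c y * app (I \<times> I) Y (op_product I (G k\<^sub>1 (fst y)) (G k\<^sub>2 (snd y))) x) = app (I \<times> I) Y (prod_map v)"
    by (simp only: app_sum)
  finally show ?thesis .
qed

lemma derivation:
  assumes "\<And>i j. i \<in> I \<Longrightarrow> j \<in> I \<Longrightarrow> X' i j = - X j i"
  shows "app (I \<times> I) (tens X X') (op_product I (G k\<^sub>1 l\<^sub>1) (G k\<^sub>2 l\<^sub>2)) =
    (\<lambda>x. op_product I (app (I \<times> I) (tens X X') (G k\<^sub>1 l\<^sub>1)) (G k\<^sub>2 l\<^sub>2) x +
      op_product I (G k\<^sub>1 l\<^sub>1) (app (I \<times> I) (tens X X') (G k\<^sub>2 l\<^sub>2)) x)"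
  by (rule app_op_product[OF fin P.in_hilb[OF k1(1)] P.in_hilb[OF k2(1)] assms])

sublocale gt_intertwiner "I\<^sub>1 \<times> I\<^sub>2" "tens t\<^sub>1 t\<^sub>2" "tens u\<^sub>1 u\<^sub>2" K cl F
    "I \<times> I" "tens t t'" "tens u u'" K' cl' G prod_map
proof
  show "prod_map v \<in> hilb (I \<times> I)" for v by (rule prod_map_hilb)
  show "prod_map (\<lambda>i. x * v i + y * w i) = (\<lambda>j. x * prod_map v j + y * prod_map w j)" for x y v w
    by (rule prod_map_lincomb)
next
  fix v assume v: "v \<in> hilb (I\<^sub>1 \<times> I\<^sub>2)"
  have adj_t': "adj t' i j = - adj t j i" and adj_u': "adj u' i j = - adj u j i" if "i \<in> I" "j \<in> I" for i j
    using that by (simp_all add: adj_def t' u')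
  note [simp] = A.lower_t[OF singletonI] A.lower_u[OF singletonI] A.raise_t[OF singletonI] A.raise_u[OF singletonI]
    B.lower_t[OF singletonI] B.lower_u[OF singletonI] B.raise_t[OF singletonI] B.raise_u[OF singletonI]
  note maps = app_tensor prod_map_add prod_map_tensor
  show "prod_map (app (I\<^sub>1 \<times> I\<^sub>2) (tens t\<^sub>1 t\<^sub>2) v) = app (I \<times> I) (tens t t') (prod_map v)"
    by (rule intertwines_on_tensors[OF v])
       (simp add: maps tensor_LT prod_map_LT derivation[OF t'] P.lower_t k1 k2 op_product_LT)
  show "prod_map (app (I\<^sub>1 \<times> I\<^sub>2) (tens u\<^sub>1 u\<^sub>2) v) = app (I \<times> I) (tens u u') (prod_map v)"
    by (rule intertwines_on_tensors[OF v])
       (simp add: maps tensor_LU prod_map_LU derivation[OF u'] P.lower_u k1 k2 op_product_LU)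
  show "prod_map (app (I\<^sub>1 \<times> I\<^sub>2) (adj (tens t\<^sub>1 t\<^sub>2)) v) = app (I \<times> I) (adj (tens t t')) (prod_map v)"
    by (rule intertwines_on_tensors[OF v])
       (simp add: maps adj_tens tensor_RT prod_map_RT derivation[OF adj_t'] P.raise_t[unfolded adj_tens] k1 k2 op_product_RT)
  show "prod_map (app (I\<^sub>1 \<times> I\<^sub>2) (adj (tens u\<^sub>1 u\<^sub>2)) v) = app (I \<times> I) (adj (tens u u')) (prod_map v)"
    by (rule intertwines_on_tensors[OF v])
       (simp add: maps adj_tens tensor_RU prod_map_RU derivation[OF adj_u'] P.raise_u[unfolded adj_tens] k1 k2 op_product_RU)
qed

definition reduced :: "'k \<Rightarrow> 'l \<Rightarrow> complex" where
  "reduced k k' = cinner (I \<times> I) (G k' (top_label (cl k))) (prod_map (F k (top_label (cl k))))"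

theorem op_product_expansion:
  "op_product I (G k\<^sub>1 l\<^sub>1) (G k\<^sub>2 l\<^sub>2) = (\<lambda>x. \<Sum>k\<in>K. \<Sum>l\<in>triples (cl k). \<Sum>k'\<in>{k' \<in> K'. cl' k' = cl k}.
     CG k l l\<^sub>1 l\<^sub>2 * reduced k k' * G k' l x)"
proof
  fix x
  have "op_product I (G k\<^sub>1 l\<^sub>1) (G k\<^sub>2 l\<^sub>2) x = prod_map (tensor_vec (e\<^sub>1 l\<^sub>1) (e\<^sub>2 l\<^sub>2)) x"
    by (simp add: prod_map_tensor)
  also have "tensor_vec (e\<^sub>1 l\<^sub>1) (e\<^sub>2 l\<^sub>2) = (\<lambda>i. \<Sum>k\<in>K. 1 * (\<Sum>l\<in>triples (cl k). CG k l l\<^sub>1 l\<^sub>2 * F k l i))"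
    using C.expand[OF tensor_vec_hilb[OF e\<^sub>1_hilb e\<^sub>2_hilb]] by (simp add: CG_def)
  also have "prod_map \<dots> x = (\<Sum>k\<in>K. \<Sum>l\<in>triples (cl k). CG k l l\<^sub>1 l\<^sub>2 * prod_map (F k l) x)"
    unfolding prod_map_sum by simp
  also have "\<dots> = (\<Sum>k\<in>K. \<Sum>l\<in>triples (cl k). CG k l l\<^sub>1 l\<^sub>2 * (\<Sum>k'\<in>{k' \<in> K'. cl' k' = cl k}. reduced k k' * G k' l x))"
    unfolding reduced_def by (intro sum.cong refl) (simp add: schur)
  finally show "op_product I (G k\<^sub>1 l\<^sub>1) (G k\<^sub>2 l\<^sub>2) x = (\<Sum>k\<in>K. \<Sum>l\<in>triples (cl k). \<Sum>k'\<in>{k' \<in> K'. cl' k' = cl k}.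
     CG k l l\<^sub>1 l\<^sub>2 * reduced k k' * G k' l x)"
    by (simp add: sum_distrib_left mult.assoc)
qed

end

lemma (in gt_coupling) CG_selection:
  assumes k: "k \<in> K" and l: "l \<in> triples (cl k)" and l1: "l\<^sub>1 \<in> triples a\<^sub>1" and l2: "l\<^sub>2 \<in> triples a\<^sub>2"
    and nz: "CG k l l\<^sub>1 l\<^sub>2 \<noteq> 0"
  shows "t_of (weight_of (cl k) l) = t_of (weight_of a\<^sub>1 l\<^sub>1) + t_of (weight_of a\<^sub>2 l\<^sub>2)"
    and "u_of (weight_of (cl k) l) = u_of (weight_of a\<^sub>1 l\<^sub>1) + u_of (weight_of a\<^sub>2 l\<^sub>2)"
    and "tri_delta (spin_of l\<^sub>1) (spin_of l\<^sub>2) (spin_of l) = 1"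
proof -
  note w = CG_weight[OF assms]
  have t: "t_of (weight_of c x) = of_int (weight_t c x) / 2" for c x
    by (cases x) (simp add: t_of_def weight_of_def weight_t_def)
  have u: "u_of (weight_of c x) = of_int (weight_u x) / 2" for c x
    by (cases x) (simp add: u_of_def weight_of_def weight_u_def)
  show "t_of (weight_of (cl k) l) = t_of (weight_of a\<^sub>1 l\<^sub>1) + t_of (weight_of a\<^sub>2 l\<^sub>2)"
    "u_of (weight_of (cl k) l) = u_of (weight_of a\<^sub>1 l\<^sub>1) + u_of (weight_of a\<^sub>2 l\<^sub>2)"
    unfolding t u w by (simp_all add: add_divide_distrib)
  obtain a b n where l_eq: "l = (a, b, n)" by (cases l)
  obtain a' b' n' where l1_eq: "l\<^sub>1 = (a', b', n')" by (cases l\<^sub>1)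
  obtain a'' b'' n'' where l2_eq: "l\<^sub>2 = (a'', b'', n'')" by (cases l\<^sub>2)
  note eqs = l_eq l1_eq l2_eq
  have "b - a \<le> (b' - a') + (b'' - a'')" "b' - a' \<le> (b - a) + (b'' - a'')" "b'' - a'' \<le> (b - a) + (b' - a')"
    using CG_triangle_sum[OF k, of b' a' b'' a'' b a n n' n''] CG_triangle_fst[OF k, of b a b'' a'' b' a' n n' n'']
      CG_triangle_snd[OF k, of b a b' a' b'' a'' n n' n''] nz
    unfolding eqs by fastforce+
  then have "real_of_int (b - a) \<le> of_int ((b' - a') + (b'' - a''))"
    "real_of_int (b' - a') \<le> of_int ((b - a) + (b'' - a''))"
    "real_of_int (b'' - a'') \<le> of_int ((b - a) + (b' - a'))"
    unfolding of_int_le_iff .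
  then have "spin_of l \<le> spin_of l\<^sub>1 + spin_of l\<^sub>2" "spin_of l\<^sub>1 \<le> spin_of l\<^sub>2 + spin_of l" "spin_of l\<^sub>2 \<le> spin_of l\<^sub>1 + spin_of l"
    by (simp_all add: eqs spin_of_def field_simps)
  moreover have "spin_of l\<^sub>1 + spin_of l\<^sub>2 + spin_of l = of_int (weight_u l + (n - a) + (n' - a') + (n'' - a''))"
    using w(2) by (simp add: eqs spin_of_def weight_u_def field_simps)
  ultimately show "tri_delta (spin_of l\<^sub>1) (spin_of l\<^sub>2) (spin_of l) = 1"
    unfolding tri_delta_def by (metis Ints_of_int)
qed

lemma op_product_sum:
  "op_product I (\<lambda>x. \<Sum>y\<in>Y. c y * f y x) B = (\<lambda>x. \<Sum>y\<in>Y. c y * op_product I (f y) B x)"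
  "op_product I A (\<lambda>x. \<Sum>y\<in>Y. c y * f y x) = (\<lambda>x. \<Sum>y\<in>Y. c y * op_product I A (f y) x)"
  unfolding op_product_def sum_distrib_left sum_distrib_right
  by (subst sum.swap; simp add: mult_ac)+

text \<open>
  Real vectors are those with real coordinates in the product basis.  They are closed under the
  operator product, as \<open>(|v\<rangle>\<langle>w|) (|v'\<rangle>\<langle>w'|) = \<langle>w|v'\<rangle> |v\<rangle>\<langle>w'|\<close>.
\<close>

locale gt_dual_coupling =
  gt_coupling I t u c f I t' u' "dual_class c" "\<lambda>l i. dual_sign c l * cnj (f (reflect c l) i)" K cl G
  for I :: "'i set" and t u c f t' u' and K :: "'k set" and cl G
begin

abbreviation f' :: "triple \<Rightarrow> 'i cvec" where
  "f' \<equiv> \<lambda>l i. dual_sign c l * cnj (f (reflect c l) i)"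

abbreviation pairs :: "(triple \<times> triple) set" where
  "pairs \<equiv> triples c \<times> triples (dual_class c)"

definition unit_op :: "triple \<times> triple \<Rightarrow> ('i \<times> 'i) cvec" where
  "unit_op y = tensor_vec (f (fst y)) (f' (snd y))"

definition real_vec :: "('i \<times> 'i) cvec \<Rightarrow> bool" where
  "real_vec A \<longleftrightarrow> (\<forall>y\<in>pairs. cinner (I \<times> I) (unit_op y) A \<in> \<real>)"

lemma unit_op_expand:
  "A \<in> hilb (I \<times> I) \<Longrightarrow> A = (\<lambda>x. \<Sum>y\<in>pairs. cinner (I \<times> I) (unit_op y) A * unit_op y x)"
  using tensor_expand[of A] by (simp add: unit_op_def sum.cartesian_product split_def)

lemma unit_op_orthonormal:
  "y \<in> pairs \<Longrightarrow> z \<in> pairs \<Longrightarrow> cinner (I \<times> I) (unit_op y) (unit_op z) = (if y = z then 1 else 0)"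
  unfolding unit_op_def cinner_tensor
  by (auto simp: A.orthonormal[OF singletonI singletonI] B.orthonormal[OF singletonI singletonI] mem_Times_iff prod_eq_iff
      simp del: split_paired_All)

lemma cinner_real:
  assumes "A \<in> hilb (I \<times> I)" "real_vec A" "real_vec B"
  shows "cinner (I \<times> I) A B \<in> \<real>"
proof -
  have "cinner (I \<times> I) A B = (\<Sum>y\<in>pairs. cnj (cinner (I \<times> I) (unit_op y) A) * cinner (I \<times> I) (unit_op y) B)"
    by (subst unit_op_expand[OF assms(1)]) (rule cinner_sum_left)
  also have "\<dots> \<in> \<real>"
    using assms(2,3) by (intro sum_in_Reals Reals_mult) (auto simp: real_vec_def Reals_cnj_iff complex_is_Real_iff)
  finally show ?thesis .
qed

lemma op_product_unit_op:
  "op_product I (unit_op (l\<^sub>1, l\<^sub>2)) (unit_op (m\<^sub>1, m\<^sub>2)) =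
    (\<lambda>x. (dual_sign c l\<^sub>2 * cinner I (f (reflect c l\<^sub>2)) (f m\<^sub>1)) * unit_op (l\<^sub>1, m\<^sub>2) x)"
  by (simp add: op_product_def unit_op_def tensor_vec_def cinner_def fun_eq_iff sum_distrib_left sum_distrib_right mult_ac)

lemma op_product_real:
  assumes A: "A \<in> hilb (I \<times> I)" "real_vec A" and B: "B \<in> hilb (I \<times> I)" "real_vec B"
  shows "real_vec (op_product I A B)"
  unfolding real_vec_def
proof
  fix z assume z: "z \<in> pairs"
  define a where "a y = cinner (I \<times> I) (unit_op y) A" for y
  define b where "b y = cinner (I \<times> I) (unit_op y) B" for y
  have "op_product I A B = op_product I (\<lambda>x. \<Sum>y\<in>pairs. a y * unit_op y x) (\<lambda>x. \<Sum>y\<in>pairs. b y * unit_op y x)"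
    unfolding a_def b_def using unit_op_expand[OF A(1)] unit_op_expand[OF B(1)] by simp
  also have "\<dots> = (\<lambda>x. \<Sum>y\<in>pairs. a y * (\<Sum>w\<in>pairs. b w * op_product I (unit_op y) (unit_op w) x))"
    unfolding op_product_sum ..
  finally have "cinner (I \<times> I) (unit_op z) (op_product I A B) =
    (\<Sum>y\<in>pairs. a y * (\<Sum>w\<in>pairs. b w * cinner (I \<times> I) (unit_op z) (op_product I (unit_op y) (unit_op w))))"
    by (simp only: cinner_sum_right)
  also have "\<dots> \<in> \<real>"
  proof (intro sum_in_Reals Reals_mult)
    fix y w assume y: "y \<in> pairs" and w: "w \<in> pairs"
    show "a y \<in> \<real>" "b w \<in> \<real>" using A(2) B(2) y w unfolding a_def b_def real_vec_def by blast+
    obtain l\<^sub>1 l\<^sub>2 m\<^sub>1 m\<^sub>2 where yw: "y = (l\<^sub>1, l\<^sub>2)" "w = (m\<^sub>1, m\<^sub>2)" by (cases y; cases w)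
    have "dual_sign c l\<^sub>2 \<in> \<real>" using dual_sign_cases[of c l\<^sub>2] by auto
    moreover have "cinner I (f (reflect c l\<^sub>2)) (f m\<^sub>1) \<in> \<real>"
      using y w by (simp add: yw A.orthonormal[OF singletonI singletonI] reflect_triples)
    moreover have "cinner (I \<times> I) (unit_op z) (unit_op (l\<^sub>1, m\<^sub>2)) \<in> \<real>"
      using y w z by (simp add: yw unit_op_orthonormal)
    ultimately show "cinner (I \<times> I) (unit_op z) (op_product I (unit_op y) (unit_op w)) \<in> \<real>"
      unfolding yw op_product_unit_op cinner_scale by (intro Reals_mult)
  qed
  finally show "cinner (I \<times> I) (unit_op z) (op_product I A B) \<in> \<real>" .
qed

lemma coupled_real:
  assumes "\<And>l\<^sub>1 l\<^sub>2. l\<^sub>1 \<in> triples c \<Longrightarrow> l\<^sub>2 \<in> triples (dual_class c) \<Longrightarrow> CG k l l\<^sub>1 l\<^sub>2 \<in> \<real>"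
  shows "real_vec (G k l)"
  unfolding real_vec_def
proof
  fix y assume "y \<in> pairs"
  then have "CG k l (fst y) (snd y) \<in> \<real>" using assms by auto
  moreover have "cinner (I \<times> I) (unit_op y) (G k l) = cnj (CG k l (fst y) (snd y))"
    by (simp add: CG_def unit_op_def cinner_cnj)
  ultimately show "cinner (I \<times> I) (unit_op y) (G k l) \<in> \<real>"
    by (simp add: complex_is_Real_iff)
qed

end

lemma (in gt_product) reduced_real:
  assumes dual: "gt_dual_coupling I t u c f t' u' K' cl' G"
    and real_CG: "\<And>l\<^sub>1 l\<^sub>2. l\<^sub>1 \<in> triples a\<^sub>1 \<Longrightarrow> l\<^sub>2 \<in> triples a\<^sub>2 \<Longrightarrow> CG k (top_label (cl k)) l\<^sub>1 l\<^sub>2 \<in> \<real>"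
    and real_G: "\<And>k' l l\<^sub>1 l\<^sub>2. k' \<in> K' \<Longrightarrow> l \<in> triples (cl' k') \<Longrightarrow> l\<^sub>1 \<in> triples c \<Longrightarrow> l\<^sub>2 \<in> triples (dual_class c) \<Longrightarrow>
      cinner (I \<times> I) (G k' l) (tensor_vec (f l\<^sub>1) (\<lambda>i. dual_sign c l\<^sub>2 * cnj (f (reflect c l\<^sub>2) i))) \<in> \<real>"
    and k': "k' \<in> K'" "cl' k' = cl k"
  shows "reduced k k' \<in> \<real>"
proof -
  interpret D: gt_dual_coupling I t u c f t' u' K' cl' G by (rule dual)
  have G: "D.real_vec (G k' l)" if "k' \<in> K'" "l \<in> triples (cl' k')" for k' l
    using real_G[OF that] by (intro D.coupled_real) (simp add: D.CG_def)
  have "reduced k k' = (\<Sum>y\<in>triples a\<^sub>1 \<times> triples a\<^sub>2.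
      cnj (CG k (top_label (cl k)) (fst y) (snd y)) *
      cinner (I \<times> I) (G k' (top_label (cl k))) (op_product I (G k\<^sub>1 (fst y)) (G k\<^sub>2 (snd y))))"
    unfolding reduced_def prod_map_def cinner_sum_right by (simp add: CG_def cinner_cnj)
  also have "\<dots> \<in> \<real>"
  proof (intro sum_in_Reals Reals_mult)
    fix y assume y: "y \<in> triples a\<^sub>1 \<times> triples a\<^sub>2"
    then show "cnj (CG k (top_label (cl k)) (fst y) (snd y)) \<in> \<real>"
      using real_CG[of "fst y" "snd y"] by (auto simp: complex_is_Real_iff)
    have "D.real_vec (op_product I (G k\<^sub>1 (fst y)) (G k\<^sub>2 (snd y)))"
      using y k1 k2 by (intro D.op_product_real G P.in_hilb) auto
    then show "cinner (I \<times> I) (G k' (top_label (cl k))) (op_product I (G k\<^sub>1 (fst y)) (G k\<^sub>2 (snd y))) \<in> \<real>"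
      using k' top_label_in_triples[of "cl k"] by (intro D.cinner_real G P.in_hilb) auto
  qed
  finally show ?thesis .
qed

section \<open>The decomposition of the operator product\<close>

lemma sum_fun_apply: "(\<Sum>y\<in>Y. f y) x = (\<Sum>y\<in>Y. f y x)"
  by (induction Y rule: infinite_finite_induct) auto

lemma Tm_dual:
  assumes "differentiable_rep I \<pi>" "i \<in> I" "j \<in> I"
  shows "Tm (dual_rep \<pi>) i j = - Tm \<pi> j i" and "Um (dual_rep \<pi>) i j = - Um \<pi> j i"
  using sl_rep_dual[OF assms(1) _ assms(2,3)] by (simp_all add: Tm_def Um_def lowering_pairs_def)

locale gt_setting =
  fixes I :: "irrep_class \<Rightarrow> 'i set"
    and \<pi> :: "irrep_class \<Rightarrow> 'i rep"
    and e :: "irrep_class \<Rightarrow> 'i gt_family"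
    and m :: "irrep_class \<Rightarrow> irrep_class \<Rightarrow> irrep_class \<Rightarrow> nat"
    and E :: "irrep_class \<Rightarrow> irrep_class \<Rightarrow> irrep_class \<Rightarrow> nat \<Rightarrow> ('i \<times> 'i) gt_family"
    and p :: irrep_class
  assumes irreps: "\<And>a. irrep_on a (I a) (\<pi> a) (hilb (I a))"
    and gt: "\<And>a. gt_basis a (I a) (\<pi> a) (hilb (I a)) (e a)"
    and coupled: "\<And>a\<^sub>1 a\<^sub>2. coupled_basis (I a\<^sub>1 \<times> snd_index I a\<^sub>1 a\<^sub>2)
                     (tensor_rep (\<pi> a\<^sub>1) (snd_rep \<pi> a\<^sub>1 a\<^sub>2)) (m a\<^sub>1 a\<^sub>2) (E a\<^sub>1 a\<^sub>2)"
    and real_cg: "\<And>a\<^sub>1 a\<^sub>2 a \<sigma> \<nu>\<^sub>1 J\<^sub>1 \<nu>\<^sub>2 J\<^sub>2 \<nu> J.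
        \<lbrakk>\<sigma> \<in> {1..m a\<^sub>1 a\<^sub>2 a}; (\<nu>\<^sub>1, J\<^sub>1) \<in> gt_labels a\<^sub>1; (\<nu>\<^sub>2, J\<^sub>2) \<in> gt_labels a\<^sub>2; (\<nu>, J) \<in> gt_labels a\<rbrakk>
        \<Longrightarrow> clebsch_gordan I e E a\<^sub>1 a\<^sub>2 a \<sigma> \<nu>\<^sub>1 J\<^sub>1 \<nu>\<^sub>2 J\<^sub>2 \<nu> J \<in> \<real>"
begin

abbreviation parts :: "irrep_class \<Rightarrow> irrep_class \<Rightarrow> (irrep_class \<times> nat) set" where
  "parts a\<^sub>1 a\<^sub>2 \<equiv> SIGMA a:UNIV. {1..m a\<^sub>1 a\<^sub>2 a}"

abbreviation family :: "irrep_class \<Rightarrow> irrep_class \<Rightarrow> irrep_class \<times> nat \<Rightarrow> triple \<Rightarrow> ('i \<times> 'i) cvec" where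
  "family a\<^sub>1 a\<^sub>2 \<equiv> \<lambda>(a, \<sigma>). gt_triple a (E a\<^sub>1 a\<^sub>2 a \<sigma>)"

lemma finite_I: "finite (I a)" and diff_\<pi>: "differentiable_rep (I a) (\<pi> a)"
  using irreps[of a] unitary_rep_differentiable[of "I a" "\<pi> a"]
  by (auto simp: irrep_on_def unitary_rep_def)

lemma finite_snd: "finite (snd_index I a\<^sub>1 a\<^sub>2)"
  by (simp add: snd_index_def finite_I)

lemma diff_snd: "differentiable_rep (snd_index I a\<^sub>1 a\<^sub>2) (snd_rep \<pi> a\<^sub>1 a\<^sub>2)"
  by (simp add: snd_index_def snd_rep_def diff_\<pi> dual_rep_differentiable)

lemma system_fst: "gt_system (I a) (Tm (\<pi> a)) (Um (\<pi> a)) {()} (\<lambda>_. a) (\<lambda>_. gt_triple a (e a))"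
  by (rule gt_basis_system[OF finite_I gt])

lemma system_dual:
  "gt_system (I a) (Tm (dual_rep (\<pi> a))) (Um (dual_rep (\<pi> a))) {()} (\<lambda>_. dual_class a)
    (\<lambda>_. gt_triple (dual_class a) (induced_gt a (e a)))"
  unfolding gt_triple_induced[abs_def] by (rule dual_system[OF system_fst]) (simp_all add: Tm_dual[OF diff_\<pi>])

lemma system_snd:
  "gt_system (snd_index I a\<^sub>1 a\<^sub>2) (Tm (snd_rep \<pi> a\<^sub>1 a\<^sub>2)) (Um (snd_rep \<pi> a\<^sub>1 a\<^sub>2)) {()} (\<lambda>_. a\<^sub>2)
    (\<lambda>_. gt_triple a\<^sub>2 (snd_gt e a\<^sub>1 a\<^sub>2))"
  using system_fst[of a\<^sub>2] system_dual[of a\<^sub>1] by (simp add: snd_index_def snd_rep_def snd_gt_def)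

lemma coupling:
  "gt_coupling (I a\<^sub>1) (Tm (\<pi> a\<^sub>1)) (Um (\<pi> a\<^sub>1)) a\<^sub>1 (gt_triple a\<^sub>1 (e a\<^sub>1))
    (snd_index I a\<^sub>1 a\<^sub>2) (Tm (snd_rep \<pi> a\<^sub>1 a\<^sub>2)) (Um (snd_rep \<pi> a\<^sub>1 a\<^sub>2)) a\<^sub>2 (gt_triple a\<^sub>2 (snd_gt e a\<^sub>1 a\<^sub>2))
    (parts a\<^sub>1 a\<^sub>2) fst (family a\<^sub>1 a\<^sub>2)"
  by (intro gt_coupling.intro system_fst system_snd coupled_system finite_I finite_snd diff_\<pi> diff_snd coupled)

lemma clebsch_gordan_family:
  assumes "(a, \<sigma>) \<in> parts a\<^sub>1 a\<^sub>2" "l \<in> triples a" "l\<^sub>1 \<in> triples a\<^sub>1" "l\<^sub>2 \<in> triples a\<^sub>2"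
  shows "cinner (I a\<^sub>1 \<times> snd_index I a\<^sub>1 a\<^sub>2) (gt_triple a (E a\<^sub>1 a\<^sub>2 a \<sigma>) l)
      (tensor_vec (gt_triple a\<^sub>1 (e a\<^sub>1) l\<^sub>1) (gt_triple a\<^sub>2 (snd_gt e a\<^sub>1 a\<^sub>2) l\<^sub>2)) =
    clebsch_gordan I e E a\<^sub>1 a\<^sub>2 a \<sigma> (weight_of a\<^sub>1 l\<^sub>1) (spin_of l\<^sub>1) (weight_of a\<^sub>2 l\<^sub>2) (spin_of l\<^sub>2) (weight_of a l) (spin_of l)"
    and "clebsch_gordan I e E a\<^sub>1 a\<^sub>2 a \<sigma> (weight_of a\<^sub>1 l\<^sub>1) (spin_of l\<^sub>1) (weight_of a\<^sub>2 l\<^sub>2) (spin_of l\<^sub>2) (weight_of a l) (spin_of l) \<in> \<real>"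
proof -
  show "cinner (I a\<^sub>1 \<times> snd_index I a\<^sub>1 a\<^sub>2) (gt_triple a (E a\<^sub>1 a\<^sub>2 a \<sigma>) l)
      (tensor_vec (gt_triple a\<^sub>1 (e a\<^sub>1) l\<^sub>1) (gt_triple a\<^sub>2 (snd_gt e a\<^sub>1 a\<^sub>2) l\<^sub>2)) =
    clebsch_gordan I e E a\<^sub>1 a\<^sub>2 a \<sigma> (weight_of a\<^sub>1 l\<^sub>1) (spin_of l\<^sub>1) (weight_of a\<^sub>2 l\<^sub>2) (spin_of l\<^sub>2) (weight_of a l) (spin_of l)"
    using assms by (simp add: clebsch_gordan_def gt_triple_def)
  have lab: "(weight_of c x, spin_of x) \<in> gt_labels c" if "x \<in> triples c" for c x
    using that by (simp add: gt_labels_eq label_of_def[symmetric])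
  show "clebsch_gordan I e E a\<^sub>1 a\<^sub>2 a \<sigma> (weight_of a\<^sub>1 l\<^sub>1) (spin_of l\<^sub>1) (weight_of a\<^sub>2 l\<^sub>2) (spin_of l\<^sub>2) (weight_of a l) (spin_of l) \<in> \<real>"
    using assms by (intro real_cg lab) auto
qed

lemma dual_coupling:
  "gt_dual_coupling (I p) (Tm (\<pi> p)) (Um (\<pi> p)) p (gt_triple p (e p)) (Tm (dual_rep (\<pi> p))) (Um (dual_rep (\<pi> p)))
    (parts p (dual_class p)) fst (family p (dual_class p))"
  using coupling[of p "dual_class p"]
  by (simp add: gt_dual_coupling_def snd_index_def snd_rep_def snd_gt_def gt_triple_induced[abs_def])

lemma product:
  assumes "(a\<^sub>1, \<sigma>\<^sub>1) \<in> parts p (dual_class p)" "(a\<^sub>2, \<sigma>\<^sub>2) \<in> parts p (dual_class p)"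
  shows "gt_product (I a\<^sub>1) (Tm (\<pi> a\<^sub>1)) (Um (\<pi> a\<^sub>1)) a\<^sub>1 (gt_triple a\<^sub>1 (e a\<^sub>1))
    (snd_index I a\<^sub>1 a\<^sub>2) (Tm (snd_rep \<pi> a\<^sub>1 a\<^sub>2)) (Um (snd_rep \<pi> a\<^sub>1 a\<^sub>2)) a\<^sub>2 (gt_triple a\<^sub>2 (snd_gt e a\<^sub>1 a\<^sub>2))
    (parts a\<^sub>1 a\<^sub>2) fst (family a\<^sub>1 a\<^sub>2)
    (I p) (Tm (\<pi> p)) (Tm (dual_rep (\<pi> p))) (Um (\<pi> p)) (Um (dual_rep (\<pi> p)))
    (parts p (dual_class p)) fst (family p (dual_class p)) (a\<^sub>1, \<sigma>\<^sub>1) (a\<^sub>2, \<sigma>\<^sub>2)"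
proof (intro gt_product.intro gt_product_axioms.intro coupling)
  show "gt_system (I p \<times> I p) (tens (Tm (\<pi> p)) (Tm (dual_rep (\<pi> p)))) (tens (Um (\<pi> p)) (Um (dual_rep (\<pi> p))))
    (parts p (dual_class p)) fst (family p (dual_class p))"
    using dual_coupling unfolding gt_dual_coupling_def gt_coupling_def by blast
qed (use assms finite_I Tm_dual[OF diff_\<pi>] in auto)

definition decomposes :: "irrep_class \<times> nat \<Rightarrow> irrep_class \<times> nat \<Rightarrow> (irrep_class \<times> nat \<times> nat \<Rightarrow> real) \<Rightarrow> bool" where
  "decomposes = (\<lambda>(a\<^sub>1, \<sigma>\<^sub>1) (a\<^sub>2, \<sigma>\<^sub>2) \<mu>. \<forall>\<nu>\<^sub>1 J\<^sub>1 \<nu>\<^sub>2 J\<^sub>2.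
      (\<nu>\<^sub>1, J\<^sub>1) \<in> gt_labels a\<^sub>1 \<longrightarrow> (\<nu>\<^sub>2, J\<^sub>2) \<in> gt_labels a\<^sub>2 \<longrightarrow>
      op_product (I p) (E p (dual_class p) a\<^sub>1 \<sigma>\<^sub>1 \<nu>\<^sub>1 J\<^sub>1) (E p (dual_class p) a\<^sub>2 \<sigma>\<^sub>2 \<nu>\<^sub>2 J\<^sub>2) =
      (\<Sum>(a, \<sigma>, \<sigma>', \<nu>, J) \<in>
          {(a, \<sigma>, \<sigma>', \<nu>, J). \<sigma> \<in> {1..m p (dual_class p) a} \<and> \<sigma>' \<in> {1..m a\<^sub>1 a\<^sub>2 a} \<and>
             (\<nu>, J) \<in> gt_labels a \<and> t_of \<nu> = t_of \<nu>\<^sub>1 + t_of \<nu>\<^sub>2 \<and> u_of \<nu> = u_of \<nu>\<^sub>1 + u_of \<nu>\<^sub>2 \<and>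
             tri_delta J\<^sub>1 J\<^sub>2 J = 1}.
        csc (clebsch_gordan I e E a\<^sub>1 a\<^sub>2 a \<sigma>' \<nu>\<^sub>1 J\<^sub>1 \<nu>\<^sub>2 J\<^sub>2 \<nu> J * of_real (\<mu> (a, \<sigma>, \<sigma>')))
          (E p (dual_class p) a \<sigma> \<nu> J)))"

lemma product_decomposition:
  assumes k1: "(a\<^sub>1, \<sigma>\<^sub>1) \<in> parts p (dual_class p)" and k2: "(a\<^sub>2, \<sigma>\<^sub>2) \<in> parts p (dual_class p)"
  shows "\<exists>\<mu>. decomposes (a\<^sub>1, \<sigma>\<^sub>1) (a\<^sub>2, \<sigma>\<^sub>2) \<mu>"
proof -
  let ?pd = "dual_class p"
  interpret P: gt_product "I a\<^sub>1" "Tm (\<pi> a\<^sub>1)" "Um (\<pi> a\<^sub>1)" a\<^sub>1 "gt_triple a\<^sub>1 (e a\<^sub>1)"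
    "snd_index I a\<^sub>1 a\<^sub>2" "Tm (snd_rep \<pi> a\<^sub>1 a\<^sub>2)" "Um (snd_rep \<pi> a\<^sub>1 a\<^sub>2)" a\<^sub>2 "gt_triple a\<^sub>2 (snd_gt e a\<^sub>1 a\<^sub>2)"
    "parts a\<^sub>1 a\<^sub>2" fst "family a\<^sub>1 a\<^sub>2"
    "I p" "Tm (\<pi> p)" "Tm (dual_rep (\<pi> p))" "Um (\<pi> p)" "Um (dual_rep (\<pi> p))"
    "parts p ?pd" fst "family p ?pd" "(a\<^sub>1, \<sigma>\<^sub>1)" "(a\<^sub>2, \<sigma>\<^sub>2)"
    by (rule product[OF assms])
  have CG: "P.CG (a, \<sigma>') l l\<^sub>1 l\<^sub>2 =
      clebsch_gordan I e E a\<^sub>1 a\<^sub>2 a \<sigma>' (weight_of a\<^sub>1 l\<^sub>1) (spin_of l\<^sub>1) (weight_of a\<^sub>2 l\<^sub>2) (spin_of l\<^sub>2) (weight_of a l) (spin_of l)"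
    "P.CG (a, \<sigma>') l l\<^sub>1 l\<^sub>2 \<in> \<real>"
    if "(a, \<sigma>') \<in> parts a\<^sub>1 a\<^sub>2" "l \<in> triples a" "l\<^sub>1 \<in> triples a\<^sub>1" "l\<^sub>2 \<in> triples a\<^sub>2" for a \<sigma>' l l\<^sub>1 l\<^sub>2
    using clebsch_gordan_family[OF that] by (simp_all add: P.CG_def)
  have real_G: "cinner (I p \<times> I p) (family p ?pd k' l) (tensor_vec (gt_triple p (e p) l\<^sub>1)
      (\<lambda>i. dual_sign p l\<^sub>2 * cnj (gt_triple p (e p) (reflect p l\<^sub>2) i))) \<in> \<real>"
    if "k' \<in> parts p ?pd" "l \<in> triples (fst k')" "l\<^sub>1 \<in> triples p" "l\<^sub>2 \<in> triples ?pd" for k' l l\<^sub>1 l\<^sub>2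
    using clebsch_gordan_family[of "fst k'" "snd k'" p ?pd l l\<^sub>1 l\<^sub>2] that
    by (simp add: snd_index_def snd_gt_def gt_triple_induced[abs_def] split_def)
  define \<mu> where "\<mu> = (\<lambda>(a, \<sigma>, \<sigma>'). Re (P.reduced (a, \<sigma>') (a, \<sigma>)))"
  have \<mu>: "of_real (\<mu> (a, \<sigma>, \<sigma>')) = P.reduced (a, \<sigma>') (a, \<sigma>)"
    if "(a, \<sigma>') \<in> parts a\<^sub>1 a\<^sub>2" "(a, \<sigma>) \<in> parts p ?pd" for a \<sigma> \<sigma>'
  proof -
    have "P.reduced (a, \<sigma>') (a, \<sigma>) \<in> \<real>"
      using that top_label_in_triples[of a] by (intro P.reduced_real[OF dual_coupling] real_G CG(2)) auto
    then show ?thesis by (simp add: \<mu>_def)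
  qed
  show ?thesis
    unfolding decomposes_def prod.case
  proof (intro exI[of _ \<mu>] allI impI)
    fix \<nu>\<^sub>1 J\<^sub>1 \<nu>\<^sub>2 J\<^sub>2 assume "(\<nu>\<^sub>1, J\<^sub>1) \<in> gt_labels a\<^sub>1" "(\<nu>\<^sub>2, J\<^sub>2) \<in> gt_labels a\<^sub>2"
    then obtain l\<^sub>1 l\<^sub>2 where l1: "l\<^sub>1 \<in> triples a\<^sub>1" and l2: "l\<^sub>2 \<in> triples a\<^sub>2"
      and \<nu>J: "\<nu>\<^sub>1 = weight_of a\<^sub>1 l\<^sub>1" "J\<^sub>1 = spin_of l\<^sub>1" "\<nu>\<^sub>2 = weight_of a\<^sub>2 l\<^sub>2" "J\<^sub>2 = spin_of l\<^sub>2"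
      unfolding gt_labels_eq label_of_def by blast
    define T where "T = {(a, \<sigma>, \<sigma>', \<nu>, J). \<sigma> \<in> {1..m p ?pd a} \<and> \<sigma>' \<in> {1..m a\<^sub>1 a\<^sub>2 a} \<and>
             (\<nu>, J) \<in> gt_labels a \<and> t_of \<nu> = t_of \<nu>\<^sub>1 + t_of \<nu>\<^sub>2 \<and> u_of \<nu> = u_of \<nu>\<^sub>1 + u_of \<nu>\<^sub>2 \<and>
             tri_delta J\<^sub>1 J\<^sub>2 J = 1}"
    define S where "S = {(a, \<sigma>, \<sigma>', \<nu>, J). \<sigma> \<in> {1..m p ?pd a} \<and> \<sigma>' \<in> {1..m a\<^sub>1 a\<^sub>2 a} \<and> (\<nu>, J) \<in> gt_labels a}"
    define B where "B = (SIGMA k:parts a\<^sub>1 a\<^sub>2. triples (fst k) \<times> {k' \<in> parts p ?pd. fst k' = fst k})"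
    define h :: "(irrep_class \<times> nat) \<times> triple \<times> (irrep_class \<times> nat) \<Rightarrow> irrep_class \<times> nat \<times> nat \<times> gt_weight \<times> real"
      where "h = (\<lambda>(k, l, k'). (fst k, snd k', snd k, label_of (fst k) l))"
    define g where "g = (\<lambda>(a, \<sigma>, \<sigma>', \<nu>, J).
        csc (clebsch_gordan I e E a\<^sub>1 a\<^sub>2 a \<sigma>' \<nu>\<^sub>1 J\<^sub>1 \<nu>\<^sub>2 J\<^sub>2 \<nu> J * of_real (\<mu> (a, \<sigma>, \<sigma>'))) (E p ?pd a \<sigma> \<nu> J))"
    have bij: "bij_betw h B S"
      unfolding bij_betw_def
    proof
      show "inj_on h B"
        by (auto simp: inj_on_def B_def h_def dest: injD[OF inj_label_of])
      show "h ` B = S"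
      proof (intro subset_antisym subsetI)
        fix y assume "y \<in> S"
        then obtain a \<sigma> \<sigma>' l where "y = (a, \<sigma>, \<sigma>', label_of a l)" "\<sigma> \<in> {1..m p ?pd a}" "\<sigma>' \<in> {1..m a\<^sub>1 a\<^sub>2 a}" "l \<in> triples a"
          unfolding S_def gt_labels_eq by blast
        then show "y \<in> h ` B"
          by (intro image_eqI[of _ _ "((a, \<sigma>'), l, (a, \<sigma>))"]) (auto simp: h_def B_def)
      qed (auto simp: S_def B_def h_def gt_labels_eq label_of_def)
    qed
    have fin: "\<forall>k\<in>parts a\<^sub>1 a\<^sub>2. finite (triples (fst k) \<times> {k' \<in> parts p ?pd. fst k' = fst k})"
      by (intro ballI finite_cartesian_product[OF finite_triples] finite_subset[OF _ P.P.finite_parts]) blast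
    have finB: "finite B"
      unfolding B_def using fin by (intro finite_SigmaI[OF P.C.finite_parts]) blast
    then have finS: "finite S" using bij bij_betw_finite by blast
    have g_h: "g (h (k, l, k')) x = P.CG k l l\<^sub>1 l\<^sub>2 * P.reduced k k' * family p ?pd k' l x"
      if "(k, l, k') \<in> B" for k l k' x
    proof -
      have "fst k' = fst k" using that by (simp add: B_def)
      then obtain a \<sigma>' \<sigma> where kk: "k = (a, \<sigma>')" "k' = (a, \<sigma>)"
        using prod.collapse by metis
      have mem: "(a, \<sigma>') \<in> parts a\<^sub>1 a\<^sub>2" "(a, \<sigma>) \<in> parts p ?pd" "l \<in> triples a"
        using that by (auto simp: B_def kk)
      show ?thesis
        using mem(3) CG(1)[OF mem(1,3) l1 l2] \<mu>[OF mem(1,2)]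
        by (simp add: g_def h_def kk label_of_def \<nu>J csc_def gt_triple_def)
    qed
    have zero: "g y = 0" if "y \<in> S - T" for y
    proof -
      have "y \<in> h ` B" using that unfolding bij_betw_imp_surj_on[OF bij] by blast
      then obtain z where "y = h z" "z \<in> B" by blast
      then obtain k l k' where y: "y = h (k, l, k')" and B: "(k, l, k') \<in> B"
        by (cases z) blast
      have "P.CG k l l\<^sub>1 l\<^sub>2 = 0"
      proof (rule ccontr)
        assume nz: "P.CG k l l\<^sub>1 l\<^sub>2 \<noteq> 0"
        have "k \<in> parts a\<^sub>1 a\<^sub>2" "l \<in> triples (fst k)" using B by (auto simp: B_def)
        from P.CG_selection[OF this l1 l2 nz] have "y \<in> T"
          using that by (auto simp: y h_def T_def S_def label_of_def \<nu>J)
        then show False using that by simp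
      qed
      then show ?thesis using g_h[OF B] by (simp add: y fun_eq_iff)
    qed
    have "op_product (I p) (E p ?pd a\<^sub>1 \<sigma>\<^sub>1 \<nu>\<^sub>1 J\<^sub>1) (E p ?pd a\<^sub>2 \<sigma>\<^sub>2 \<nu>\<^sub>2 J\<^sub>2) x = (\<Sum>y\<in>T. g y) x" for x
    proof -
      have "op_product (I p) (E p ?pd a\<^sub>1 \<sigma>\<^sub>1 \<nu>\<^sub>1 J\<^sub>1) (E p ?pd a\<^sub>2 \<sigma>\<^sub>2 \<nu>\<^sub>2 J\<^sub>2) x =
        op_product (I p) (family p ?pd (a\<^sub>1, \<sigma>\<^sub>1) l\<^sub>1) (family p ?pd (a\<^sub>2, \<sigma>\<^sub>2) l\<^sub>2) x"
        using l1 l2 by (simp add: gt_triple_def \<nu>J)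
      also have "\<dots> = (\<Sum>k\<in>parts a\<^sub>1 a\<^sub>2. \<Sum>l\<in>triples (fst k). \<Sum>k'\<in>{k' \<in> parts p ?pd. fst k' = fst k}.
          P.CG k l l\<^sub>1 l\<^sub>2 * P.reduced k k' * family p ?pd k' l x)"
        unfolding P.op_product_expansion ..
      also have "\<dots> = (\<Sum>(k, l, k')\<in>B. P.CG k l l\<^sub>1 l\<^sub>2 * P.reduced k k' * family p ?pd k' l x)"
        unfolding B_def sum.cartesian_product sum.Sigma[OF P.C.finite_parts fin] by (simp only: split_def)
      also have "\<dots> = (\<Sum>y\<in>B. g (h y) x)"
        by (intro sum.cong refl) (clarsimp simp only: prod.case g_h)
      also have "\<dots> = (\<Sum>y\<in>S. g y x)"
        by (rule sum.reindex_bij_betw[OF bij])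
      also have "\<dots> = (\<Sum>y\<in>T. g y x)"
        using finS zero by (intro sum.mono_neutral_right) (auto simp: S_def T_def)
      finally show ?thesis by (simp add: sum_fun_apply)
    qed
    then show "op_product (I p) (E p ?pd a\<^sub>1 \<sigma>\<^sub>1 \<nu>\<^sub>1 J\<^sub>1) (E p ?pd a\<^sub>2 \<sigma>\<^sub>2 \<nu>\<^sub>2 J\<^sub>2) =
      (\<Sum>(a, \<sigma>, \<sigma>', \<nu>, J) \<in>
          {(a, \<sigma>, \<sigma>', \<nu>, J). \<sigma> \<in> {1..m p ?pd a} \<and> \<sigma>' \<in> {1..m a\<^sub>1 a\<^sub>2 a} \<and>
             (\<nu>, J) \<in> gt_labels a \<and> t_of \<nu> = t_of \<nu>\<^sub>1 + t_of \<nu>\<^sub>2 \<and> u_of \<nu> = u_of \<nu>\<^sub>1 + u_of \<nu>\<^sub>2 \<and>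
             tri_delta J\<^sub>1 J\<^sub>2 J = 1}.
        csc (clebsch_gordan I e E a\<^sub>1 a\<^sub>2 a \<sigma>' \<nu>\<^sub>1 J\<^sub>1 \<nu>\<^sub>2 J\<^sub>2 \<nu> J * of_real (\<mu> (a, \<sigma>, \<sigma>')))
          (E p ?pd a \<sigma> \<nu> J))"
      unfolding T_def[symmetric] g_def[symmetric] by blast
  qed
qed

end

theorem lemma2p18:
  fixes I :: "irrep_class \<Rightarrow> 'i set"
    and \<pi> :: "irrep_class \<Rightarrow> 'i rep"
    and e :: "irrep_class \<Rightarrow> 'i gt_family"
    and m :: "irrep_class \<Rightarrow> irrep_class \<Rightarrow> irrep_class \<Rightarrow> nat"
    and E :: "irrep_class \<Rightarrow> irrep_class \<Rightarrow> irrep_class \<Rightarrow> nat \<Rightarrow> ('i \<times> 'i) gt_family"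
    and p :: irrep_class
  assumes irreps: "\<And>a. irrep_on a (I a) (\<pi> a) (hilb (I a))"
    and gt: "\<And>a. gt_basis a (I a) (\<pi> a) (hilb (I a)) (e a)"
    and coupled: "\<And>a\<^sub>1 a\<^sub>2. coupled_basis (I a\<^sub>1 \<times> snd_index I a\<^sub>1 a\<^sub>2)
                     (tensor_rep (\<pi> a\<^sub>1) (snd_rep \<pi> a\<^sub>1 a\<^sub>2)) (m a\<^sub>1 a\<^sub>2) (E a\<^sub>1 a\<^sub>2)"
    and real_cg: "\<And>a\<^sub>1 a\<^sub>2 a \<sigma> \<nu>\<^sub>1 J\<^sub>1 \<nu>\<^sub>2 J\<^sub>2 \<nu> J.
        \<lbrakk>\<sigma> \<in> {1..m a\<^sub>1 a\<^sub>2 a}; (\<nu>\<^sub>1, J\<^sub>1) \<in> gt_labels a\<^sub>1; (\<nu>\<^sub>2, J\<^sub>2) \<in> gt_labels a\<^sub>2; (\<nu>, J) \<in> gt_labels a\<rbrakk>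
        \<Longrightarrow> clebsch_gordan I e E a\<^sub>1 a\<^sub>2 a \<sigma> \<nu>\<^sub>1 J\<^sub>1 \<nu>\<^sub>2 J\<^sub>2 \<nu> J \<in> \<real>"
  shows "\<exists>M :: irrep_class \<times> nat \<Rightarrow> irrep_class \<times> nat \<Rightarrow> irrep_class \<times> nat \<times> nat \<Rightarrow> real.
    \<forall>a\<^sub>1 a\<^sub>2. \<forall>\<sigma>\<^sub>1 \<in> {1..m p (dual_class p) a\<^sub>1}. \<forall>\<sigma>\<^sub>2 \<in> {1..m p (dual_class p) a\<^sub>2}.
    \<forall>\<nu>\<^sub>1 J\<^sub>1 \<nu>\<^sub>2 J\<^sub>2. (\<nu>\<^sub>1, J\<^sub>1) \<in> gt_labels a\<^sub>1 \<longrightarrow> (\<nu>\<^sub>2, J\<^sub>2) \<in> gt_labels a\<^sub>2 \<longrightarrow>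
      op_product (I p) (E p (dual_class p) a\<^sub>1 \<sigma>\<^sub>1 \<nu>\<^sub>1 J\<^sub>1) (E p (dual_class p) a\<^sub>2 \<sigma>\<^sub>2 \<nu>\<^sub>2 J\<^sub>2) =
      (\<Sum>(a, \<sigma>, \<sigma>', \<nu>, J) \<in>
          {(a, \<sigma>, \<sigma>', \<nu>, J). \<sigma> \<in> {1..m p (dual_class p) a} \<and> \<sigma>' \<in> {1..m a\<^sub>1 a\<^sub>2 a} \<and>
             (\<nu>, J) \<in> gt_labels a \<and> t_of \<nu> = t_of \<nu>\<^sub>1 + t_of \<nu>\<^sub>2 \<and> u_of \<nu> = u_of \<nu>\<^sub>1 + u_of \<nu>\<^sub>2 \<and>
             tri_delta J\<^sub>1 J\<^sub>2 J = 1}.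
        csc (clebsch_gordan I e E a\<^sub>1 a\<^sub>2 a \<sigma>' \<nu>\<^sub>1 J\<^sub>1 \<nu>\<^sub>2 J\<^sub>2 \<nu> J * of_real (M (a\<^sub>1, \<sigma>\<^sub>1) (a\<^sub>2, \<sigma>\<^sub>2) (a, \<sigma>, \<sigma>')))
          (E p (dual_class p) a \<sigma> \<nu> J))"
proof -
  interpret gt_setting I \<pi> e m E p
    by (rule gt_setting.intro) (fact irreps gt coupled real_cg)+
  define M where "M k\<^sub>1 k\<^sub>2 = (SOME \<mu>. decomposes k\<^sub>1 k\<^sub>2 \<mu>)" for k\<^sub>1 k\<^sub>2
  have "decomposes (a\<^sub>1, \<sigma>\<^sub>1) (a\<^sub>2, \<sigma>\<^sub>2) (M (a\<^sub>1, \<sigma>\<^sub>1) (a\<^sub>2, \<sigma>\<^sub>2))"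
    if "\<sigma>\<^sub>1 \<in> {1..m p (dual_class p) a\<^sub>1}" "\<sigma>\<^sub>2 \<in> {1..m p (dual_class p) a\<^sub>2}" for a\<^sub>1 \<sigma>\<^sub>1 a\<^sub>2 \<sigma>\<^sub>2
    unfolding M_def
    by (rule someI_ex[of "decomposes (a\<^sub>1, \<sigma>\<^sub>1) (a\<^sub>2, \<sigma>\<^sub>2)"], rule product_decomposition) (use that in auto)
  then have "\<forall>a\<^sub>1 a\<^sub>2. \<forall>\<sigma>\<^sub>1\<in>{1..m p (dual_class p) a\<^sub>1}. \<forall>\<sigma>\<^sub>2\<in>{1..m p (dual_class p) a\<^sub>2}.
      decomposes (a\<^sub>1, \<sigma>\<^sub>1) (a\<^sub>2, \<sigma>\<^sub>2) (M (a\<^sub>1, \<sigma>\<^sub>1) (a\<^sub>2, \<sigma>\<^sub>2))"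
    by blast
  then show ?thesis
    unfolding decomposes_def prod.case by (rule exI[of _ M])
qed

end
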